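(* Let $S$ be a closed, bounded from below, densely defined symmetric operator on a separable Hilbert space $\mathcal H$ with finite and equal defect numbers $(n,n)$, and let $(\mathcal K,\Gamma_0,\Gamma_1)$ be a boundary triplet for $S$. Let $\mathcal L_1,\mathcal L_2$ and $\mathcal F$ be the Lagrangian planes in $(\mathcal K\oplus\mathcal K,\omega)$ corresponding to self-adjoint extensions $H_1$, $H_2$ and the Friedrichs extension $H_F$ of $S$, respectively. Let $\mathcal M(z)=\{(\Gamma_0f,\Gamma_1f):f\in\ker(S^*-z)\}$. Then $$N\big(H_1;(a,b]\big)-N\big(H_2;(a,b]\big)=\iota\big(\mathcal L_1,\mathcal L_2,\mathcal M(b)\big)-\iota\big(\mathcal L_1,\mathcal L_2,\mathcal M(a)\big)$$ for any $[a,b]\subset\mathbb R\setminus\operatorname{Spec}_{\mathrm{ess}}(S)$. In particular, the spectral shift is given by $$\sigma(H_1,H_2;\lambda)=\iota\big(\mathcal L_1,\mathcal L_2,\mathcal M(\lambda)\big)-\iota(\mathcal L_1,\mathcal L_2,\mathcal F)$$ for any $\lambda\in\mathbb R$ below the essential spectrum.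
   Context: All inner products are linear in the second argument. A boundary triplet $(\mathcal K,\Gamma_0,\Gamma_1)$ for $S$ consists of an $n$-dimensional complex Hilbert space $\mathcal K$ and linear maps $\Gamma_0,\Gamma_1:\operatorname{dom}(S^* )\to\mathcal K$ such that $\mathbf\Gamma f:=(\Gamma_0f,\Gamma_1f)$ defines a surjection $\operatorname{dom}(S^* )\to\mathcal K\oplus\mathcal K$ and $\langle f,S^*g\rangle_{\mathcal H}-\langle S^*f,g\rangle_{\mathcal H}=\langle\Gamma_0f,\Gamma_1g\rangle_{\mathcal K}-\langle\Gamma_1f,\Gamma_0g\rangle_{\mathcal K}$ for all $f,g\in\operatorname{dom}(S^* )$. The symplectic form on $\mathcal K\oplus\mathcal K$ is $\omega(u,v)=\langle u_0,v_1\rangle_{\mathcal K}-\langle u_1,v_0\rangle_{\mathcal K}$. A subspace $\mathcal L\subset\mathcal K\oplus\mathcal K$ is a Lagrangian plane if $\mathcal L=\{u:\omega(u,v)=0\ \forall v\in\mathcal L\}$. Self-adjoint extensions $H$ of $S$ are in one-to-one correspondence with Lagrangian planes $\mathcal L$ via $\operatorname{dom}(H)=\{f\in\operatorname{dom}(S^* ):\mathbf\Gamma f\in\mathcal L\}$ (and $H=S^*|_{\operatorname{dom}(H)}$); in particular $\mathcal F=\mathbf\Gamma(\operatorname{dom}(H_F))$. $\operatorname{Spec}_{\mathrm{ess}}(S):=\{z\in\mathbb C: S-z\text{ is not Fredholm}\}$; it equals $\operatorname{Spec}_{\mathrm{ess}}(H)$ for every self-adjoint extension $H$ of $S$. For an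 interval $I$ whose closure is disjoint from this set, $N(H;I):=\sum_{\lambda\in I}\dim\ker(H-\lambda)$. For $\lambda\in\mathbb R$ below the essential spectrum, $\sigma(H_1,H_2;\lambda):=N(H_1;(-\infty,\lambda])-N(H_2;(-\infty,\lambda])$. For real $s\notin\operatorname{Spec}_{\mathrm{ess}}(S)$ the space $\mathcal M(s)$ (the Cauchy data space) is a Lagrangian plane. Duistermaat index: for Lagrangian planes $\alpha,\beta,\gamma$ with $\alpha\cap\beta=0=\beta\cap\gamma$, $\gamma$ is the graph $\{u+Lu:u\in\alpha\}$ of a linear map $L:\alpha\to\beta$; let $Q(\alpha,\beta;\gamma)$ be the Hermitian form $(u_1,u_2)\mapsto\omega(u_1,Lu_2)$ on $\alpha$, and let $n_-$ of a Hermitian form be the maximal dimension of a subspace on which it is negative definite. For arbitrary Lagrangian planes $\mathcal L_1,\mathcal L_2,\mathcal L_3$, choose a Lagrangian plane $\hat{\mathcal L}$ transversal to all three and set $\iota(\mathcal L_1,\mathcal L_2,\mathcal L_3):=n_-(Q(\mathcal L_2,\hat{\mathcal L};\mathcal L_3))-n_-(Q(\mathcal L_1,\hat{\mathcal L};\mathcal L_3))+n_-(Q(\mathcal L_1,\hat{\mathcal L};\mathcal L_2))$, which does not depend on the choice of $\hat{\mathcal L}$. *)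

theory Defs
  imports "HOL-Analysis.Analysis"
begin

subsection \<open>Complex Hilbert spaces\<close>

class complex_vector = real_vector +
  fixes scaleC :: "complex \<Rightarrow> 'a \<Rightarrow> 'a"  (infixr \<open>*\<^sub>C\<close> 75)
  assumes scaleC_of_real: "complex_of_real r *\<^sub>C x = r *\<^sub>R x"
    and scaleC_add_right: "c *\<^sub>C (x + y) = c *\<^sub>C x + c *\<^sub>C y"
    and scaleC_add_left: "(c + d) *\<^sub>C x = c *\<^sub>C x + d *\<^sub>C x"
    and scaleC_scaleC: "c *\<^sub>C (d *\<^sub>C x) = (c * d) *\<^sub>C x"

global_interpretation complex_vector: vector_space "scaleC :: complex \<Rightarrow> 'a \<Rightarrow> 'a::complex_vector"
proof
  fix x :: 'a
  show "1 *\<^sub>C x = x"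
    using scaleC_of_real[of 1 x] by simp
qed (simp_all add: scaleC_add_right scaleC_add_left scaleC_scaleC)

abbreviation csubspace :: "'a::complex_vector set \<Rightarrow> bool"
  where "csubspace \<equiv> complex_vector.subspace"

abbreviation cspan :: "'a::complex_vector set \<Rightarrow> 'a set"
  where "cspan \<equiv> complex_vector.span"

abbreviation cdim :: "'a::complex_vector set \<Rightarrow> nat"
  where "cdim \<equiv> complex_vector.dim"

text \<open>Needed because \<^term>\<open>cdim V\<close> is 0 for infinite-dimensional \<^term>\<open>V\<close>.\<close>

definition cfinite_dim :: "'a::complex_vector set \<Rightarrow> bool"
  where "cfinite_dim V \<longleftrightarrow> (\<exists>B. finite B \<and> V \<subseteq> cspan B)"

text \<open>Inner products are linear in the second argument.\<close>

class complex_inner = complex_vector + real_normed_vector +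
  fixes cinner :: "'a \<Rightarrow> 'a \<Rightarrow> complex"
  assumes cinner_commute: "cinner x y = cnj (cinner y x)"
    and cinner_add_right: "cinner x (y + z) = cinner x y + cinner x z"
    and cinner_scaleC_right: "cinner x (c *\<^sub>C y) = c * cinner x y"
    and cinner_self: "cinner x x = complex_of_real ((norm x)\<^sup>2)"

class complex_hilbert = complex_inner + complete_space

instantiation complex :: complex_hilbert
begin

definition scaleC_complex :: "complex \<Rightarrow> complex \<Rightarrow> complex"
  where "scaleC_complex c x = c * x"

definition cinner_complex :: "complex \<Rightarrow> complex \<Rightarrow> complex"
  where "cinner_complex x y = cnj x * y"

instance
  by standard (auto simp: scaleC_complex_def cinner_complex_def scaleR_conv_of_real
      algebra_simps complex_norm_square simp flip: of_real_power)

end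

instantiation prod :: (complex_vector, complex_vector) complex_vector
begin

definition scaleC_prod :: "complex \<Rightarrow> 'a \<times> 'b \<Rightarrow> 'a \<times> 'b"
  where "scaleC_prod c u = (c *\<^sub>C fst u, c *\<^sub>C snd u)"

instance
  by standard (simp_all add: prod_eq_iff scaleC_prod_def scaleC_of_real scaleC_add_right
      scaleC_add_left scaleC_scaleC)

end


subsection \<open>Unbounded operators\<close>

text \<open>An operator is represented by its graph, so that extension is inclusion, the domain is
  \<^const>\<open>Domain\<close>, the range is \<^const>\<open>Range\<close>, and a closed operator is a closed graph.\<close>

type_synonym 'h operator = "('h \<times> 'h) set"

definition linear_operator :: "'h::complex_vector operator \<Rightarrow> bool"
  where "linear_operator T \<longleftrightarrow> csubspace T \<and> single_valued T"

definition op_app :: "'h operator \<Rightarrow> 'h \<Rightarrow> 'h"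
  where "op_app T f = (THE g. (f, g) \<in> T)"

definition op_ker :: "'h::zero operator \<Rightarrow> 'h set"
  where "op_ker T = {f. (f, 0) \<in> T}"

definition op_shift :: "'h::complex_vector operator \<Rightarrow> complex \<Rightarrow> 'h operator"  \<comment> \<open>\<open>T - z\<close>\<close>
  where "op_shift T z = {(f, g - z *\<^sub>C f) | f g. (f, g) \<in> T}"

definition densely_defined :: "'h::topological_space operator \<Rightarrow> bool"
  where "densely_defined T \<longleftrightarrow> closure (Domain T) = UNIV"

definition adjoint_op :: "'h::complex_inner operator \<Rightarrow> 'h operator"
  where "adjoint_op T = {(g, h). \<forall>f\<in>Domain T. cinner g (op_app T f) = cinner h f}"

definition symmetric_op :: "'h::complex_inner operator \<Rightarrow> bool"
  where "symmetric_op T \<longleftrightarrow>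
    (\<forall>f\<in>Domain T. \<forall>g\<in>Domain T. cinner f (op_app T g) = cinner (op_app T f) g)"

definition bounded_below :: "'h::complex_inner operator \<Rightarrow> bool"
  where "bounded_below T \<longleftrightarrow>
    (\<exists>c::real. \<forall>f\<in>Domain T. Re (cinner f (op_app T f)) \<ge> c * (norm f)\<^sup>2)"

definition self_adjoint :: "'h::complex_inner operator \<Rightarrow> bool"
  where "self_adjoint H \<longleftrightarrow> linear_operator H \<and> densely_defined H \<and> adjoint_op H = H"

definition self_adjoint_extension :: "'h::complex_inner operator \<Rightarrow> 'h operator \<Rightarrow> bool"
  where "self_adjoint_extension S H \<longleftrightarrow> self_adjoint H \<and> S \<subseteq> H"

definition defect_numbers :: "'h::complex_inner operator \<Rightarrow> nat \<Rightarrow> nat \<Rightarrow> bool"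
  where "defect_numbers S m n \<longleftrightarrow>
    cfinite_dim (op_ker (op_shift (adjoint_op S) \<i>)) \<and>
    cdim (op_ker (op_shift (adjoint_op S) \<i>)) = m \<and>
    cfinite_dim (op_ker (op_shift (adjoint_op S) (- \<i>))) \<and>
    cdim (op_ker (op_shift (adjoint_op S) (- \<i>))) = n"

text \<open>The domain of the closure of the quadratic form \<open>f \<mapsto> \<langle>f, S f\<rangle>\<close>. Since \<open>S\<close> is bounded from
  below and \<open>u\<close> converges, the Cauchy condition on the form is the one for the form norm.\<close>

definition form_domain :: "'h::complex_inner operator \<Rightarrow> 'h set"
  where "form_domain S = {f. \<exists>u. (\<forall>k. u k \<in> Domain S) \<and> u \<longlonglongrightarrow> f \<and>
    (\<forall>e>0. \<exists>N. \<forall>j\<ge>N. \<forall>k\<ge>N. cmod (cinner (u j - u k) (op_app S (u j - u k))) < e)}"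

text \<open>Friedrichs extension: the restriction of \<open>S\<^sup>*\<close> to \<open>dom(S\<^sup>*)\<close> intersected with the form
  domain.\<close>

definition friedrichs_extension :: "'h::complex_inner operator \<Rightarrow> 'h operator"
  where "friedrichs_extension S = {(f, g) \<in> adjoint_op S. f \<in> form_domain S}"

definition fredholm :: "'h::complex_inner operator \<Rightarrow> bool"
  where "fredholm T \<longleftrightarrow> closed T \<and> cfinite_dim (op_ker T) \<and> closed (Range T) \<and>
    (\<exists>B. finite B \<and> cspan (Range T \<union> B) = UNIV)"

definition Spec_ess :: "'h::complex_inner operator \<Rightarrow> complex set"
  where "Spec_ess T = {z. \<not> fredholm (op_shift T z)}"

text \<open>The sum over \<open>I\<close> is restricted to the eigenvalues, since \<^const>\<open>sum\<close> vanishes on infinite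
  index sets.\<close>

definition N_count :: "'h::complex_inner operator \<Rightarrow> real set \<Rightarrow> nat"
  where "N_count H I =
    (\<Sum>\<mu> \<in> {\<mu> \<in> I. op_ker (op_shift H (complex_of_real \<mu>)) \<noteq> {0}}.
      cdim (op_ker (op_shift H (complex_of_real \<mu>))))"

definition spectral_shift :: "'h::complex_inner operator \<Rightarrow> 'h operator \<Rightarrow> real \<Rightarrow> int"
  where "spectral_shift H1 H2 t = int (N_count H1 {..t}) - int (N_count H2 {..t})"


subsection \<open>Symplectic geometry of the boundary space\<close>

definition omega :: "'k::complex_inner \<times> 'k \<Rightarrow> 'k \<times> 'k \<Rightarrow> complex"
  where "omega u v = cinner (fst u) (snd v) - cinner (snd u) (fst v)"

definition lagrangian :: "('k::complex_inner \<times> 'k) set \<Rightarrow> bool"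
  where "lagrangian L \<longleftrightarrow> csubspace L \<and> L = {u. \<forall>v\<in>L. omega u v = 0}"

text \<open>\<open>n\<^sub>-\<close> of a Hermitian form \<open>Q\<close> on \<open>\<alpha>\<close>; the values \<open>Q u u\<close> are real, so \<^const>\<open>Re\<close> only
  adjusts the type.\<close>

definition n_minus :: "'a::complex_vector set \<Rightarrow> ('a \<Rightarrow> 'a \<Rightarrow> complex) \<Rightarrow> nat"
  where "n_minus \<alpha> Q =
    Max {cdim V | V. csubspace V \<and> V \<subseteq> \<alpha> \<and> (\<forall>u\<in>V. u \<noteq> 0 \<longrightarrow> Re (Q u u) < 0)}"

text \<open>For \<open>\<alpha> \<inter> \<beta> = 0 = \<beta> \<inter> \<gamma>\<close>, the value at \<open>u \<in> \<alpha>\<close> of the map \<open>L : \<alpha> \<rightarrow> \<beta>\<close> with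
  \<open>\<gamma> = {u + L u | u \<in> \<alpha>}\<close>.\<close>

definition graph_map :: "'a::plus set \<Rightarrow> 'a set \<Rightarrow> 'a set \<Rightarrow> 'a \<Rightarrow> 'a"
  where "graph_map \<alpha> \<beta> \<gamma> u = (THE v. u \<in> \<alpha> \<and> v \<in> \<beta> \<and> u + v \<in> \<gamma>)"

definition Q_form ::
  "('k::complex_inner \<times> 'k) set \<Rightarrow> ('k \<times> 'k) set \<Rightarrow> ('k \<times> 'k) set \<Rightarrow> 'k \<times> 'k \<Rightarrow> 'k \<times> 'k \<Rightarrow> complex"
  where "Q_form \<alpha> \<beta> \<gamma> u1 u2 = omega u1 (graph_map \<alpha> \<beta> \<gamma> u2)"

definition duistermaat_via ::
  "('k::complex_inner \<times> 'k) set \<Rightarrow> ('k \<times> 'k) set \<Rightarrow> ('k \<times> 'k) set \<Rightarrow> ('k \<times> 'k) set \<Rightarrow> int"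
  where "duistermaat_via L L1 L2 L3 =
    int (n_minus L2 (Q_form L2 L L3)) - int (n_minus L1 (Q_form L1 L L3))
      + int (n_minus L1 (Q_form L1 L L2))"

definition duistermaat ::
  "('k::complex_inner \<times> 'k) set \<Rightarrow> ('k \<times> 'k) set \<Rightarrow> ('k \<times> 'k) set \<Rightarrow> int"
  where "duistermaat L1 L2 L3 =
    duistermaat_via
      (SOME L. lagrangian L \<and> L \<inter> L1 = {0} \<and> L \<inter> L2 = {0} \<and> L \<inter> L3 = {0}) L1 L2 L3"


subsection \<open>Boundary triplets\<close>

text \<open>\<open>\<Gamma>\<^sub>0\<close> and \<open>\<Gamma>\<^sub>1\<close> are total functions of which only the values on \<open>dom(S\<^sup>*)\<close> matter; the space
  \<open>\<K>\<close> is the type \<^typ>\<open>'k\<close>.\<close>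

definition boundary_triplet ::
  "nat \<Rightarrow> 'h::complex_inner operator \<Rightarrow> ('h \<Rightarrow> 'k::complex_hilbert) \<Rightarrow> ('h \<Rightarrow> 'k) \<Rightarrow> bool"
  where "boundary_triplet n S \<Gamma>0 \<Gamma>1 \<longleftrightarrow>
    cfinite_dim (UNIV :: 'k set) \<and> cdim (UNIV :: 'k set) = n \<and>
    (\<forall>\<Gamma>\<in>{\<Gamma>0, \<Gamma>1}. \<forall>f\<in>Domain (adjoint_op S). \<forall>g\<in>Domain (adjoint_op S). \<forall>c.
      \<Gamma> (f + g) = \<Gamma> f + \<Gamma> g \<and> \<Gamma> (c *\<^sub>C f) = c *\<^sub>C \<Gamma> f) \<and>
    (\<lambda>f. (\<Gamma>0 f, \<Gamma>1 f)) ` Domain (adjoint_op S) = UNIV \<and>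
    (\<forall>f\<in>Domain (adjoint_op S). \<forall>g\<in>Domain (adjoint_op S).
      cinner f (op_app (adjoint_op S) g) - cinner (op_app (adjoint_op S) f) g =
      cinner (\<Gamma>0 f) (\<Gamma>1 g) - cinner (\<Gamma>1 f) (\<Gamma>0 g))"

text \<open>The Lagrangian plane \<open>\<Gamma>(dom H)\<close> corresponding to a self-adjoint extension \<open>H\<close>. As \<open>\<Gamma>\<close> is
  surjective, it is the only set \<open>L\<close> with \<open>dom H = {f \<in> dom(S\<^sup>*). \<Gamma> f \<in> L}\<close>.\<close>

definition boundary_plane ::
  "('h \<Rightarrow> 'k) \<Rightarrow> ('h \<Rightarrow> 'k) \<Rightarrow> 'h operator \<Rightarrow> ('k \<times> 'k) set"
  where "boundary_plane \<Gamma>0 \<Gamma>1 H = (\<lambda>f. (\<Gamma>0 f, \<Gamma>1 f)) ` Domain H"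

definition cauchy_data ::
  "'h::complex_inner operator \<Rightarrow> ('h \<Rightarrow> 'k) \<Rightarrow> ('h \<Rightarrow> 'k) \<Rightarrow> complex \<Rightarrow> ('k \<times> 'k) set"
  where "cauchy_data S \<Gamma>0 \<Gamma>1 z = (\<lambda>f. (\<Gamma>0 f, \<Gamma>1 f)) ` op_ker (op_shift (adjoint_op S) z)"

end

theory Submission
  imports Defs
begin

text \<open>The Duistermaat index is expressed through the negative index of the Kashiwara form on
  \<open>A \<times> B \<times> C\<close>, which involves no transversal plane. Hence a common transversal may be used for any
  finite number of planes, and \<open>\<iota>(L1, L2, C) - \<iota>(L1, L2, B)\<close> becomes a difference of the indices
  \<open>\<iota>(B, Lj, C)\<close>, up to the dimensions of \<open>Lj \<inter> B\<close>. If \<open>B \<inter> C = 0\<close>, then \<open>\<iota>(B, Lj, C)\<close> is read off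
  from the sign of \<open>\<omega>(b, c)\<close> for \<open>b + c \<in> Lj\<close>.

  For \<open>B, C = M(t0), M(t)\<close> with \<open>t\<close> close to \<open>t0\<close> this sign is that of \<open>(t - t0) Re \<langle>f, g\<rangle>\<close> with
  \<open>f \<in> ker(S\<^sup>* - t)\<close>, \<open>g \<in> ker(S\<^sup>* - t0)\<close> and \<open>f + g \<in> dom(Hj)\<close>; the reduced resolvent of \<open>Hj\<close> at \<open>t0\<close> is
  bounded, so \<open>g = -f + O(t - t0)\<close> up to a vector of \<open>ker(Hj - t0)\<close>, which is orthogonal to \<open>f\<close>.
  No continuity of \<open>M\<close> is needed, and bisection glues the local statements. For \<open>B, C = F, M(s)\<close>
  with \<open>s\<close> far to the left, the sign comes from the minimality of the Friedrichs form, and \<open>Hj\<close> has no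
  eigenvalues below \<open>s\<close> because it is bounded below.\<close>

subsection \<open>Finite-dimensional subspaces\<close>

text \<open>The index takes its transversal plane by Hilbert choice, so nothing can be computed with
  it before independence of that plane is known. The dimension terms of the cocycle are taken at the
  lower plane \<open>B\<close> only, and this asymmetry produces the half-open interval: at the
  start of \<open>{t0<..b}\<close> they compensate the dimension missing from
  \<open>duistermaat (M t0) (plane H) (M b)\<close>, at the end of \<open>{a<..t0}\<close> nothing
  compensates it. The same compensation at the bottom makes \<open>plane HF\<close> and
  \<open>M s\<close> interchangeable. Vectors of \<open>defect t\<close> with zero boundary values,
  such as eigenvectors of \<open>S\<close>, are invisible to all planes; they belong to both
  extensions, so only differences of counts can be matched with indices. An infinite set of
  eigenvalues would have sum 0 in \<open>N_count\<close>, so finiteness is carried along in the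
  gluing. No spectral theorem is involved: closed range and finite codimension of
  \<open>S - t\<close> supply the orthogonal decompositions, and the resolvent bound comes from
  uniform boundedness.\<close>

abbreviation cindependent :: "'a::complex_vector set \<Rightarrow> bool"
  where "cindependent \<equiv> complex_vector.independent"

lemmas scaleC_diff_right = complex_vector.scale_right_diff_distrib

lemmas csubspace_0 = complex_vector.subspace_0
  and csubspace_UNIV = complex_vector.subspace_UNIV
  and csubspace_add = complex_vector.subspace_add
  and csubspace_diff = complex_vector.subspace_diff
  and csubspace_inter = complex_vector.subspace_inter
  and csubspace_neg = complex_vector.subspace_neg
  and csubspace_scale = complex_vector.subspace_scale
  and csubspace_single_0 = complex_vector.subspace_single_0
  and csubspace_span = complex_vector.subspace_span
  and csubspace_sums = complex_vector.subspace_sums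

lemmas cspan_Un = complex_vector.span_Un
  and cspan_add = complex_vector.span_add
  and cspan_base = complex_vector.span_base
  and cspan_breakdown_eq = complex_vector.span_breakdown_eq
  and cspan_diff = complex_vector.span_diff
  and cspan_minimal = complex_vector.span_minimal
  and cspan_mono = complex_vector.span_mono
  and cspan_scale = complex_vector.span_scale
  and cspan_singleton = complex_vector.span_singleton
  and cspan_subspace = complex_vector.span_subspace
  and cspan_superset = complex_vector.span_superset
  and cspan_zero = complex_vector.span_zero

text \<open>Linearity is relative to a set because the boundary maps are controlled only on the
  domain of the adjoint and the forms only on a given subspace.\<close>

definition clinear_on :: "'a::complex_vector set \<Rightarrow> ('a \<Rightarrow> 'b::complex_vector) \<Rightarrow> bool"
  where "clinear_on V f \<longleftrightarrow>
    (\<forall>x\<in>V. \<forall>y\<in>V. f (x + y) = f x + f y) \<and> (\<forall>x\<in>V. \<forall>c. f (c *\<^sub>C x) = c *\<^sub>C f x)"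

lemma clinear_onI:
  assumes "\<And>x y. x \<in> V \<Longrightarrow> y \<in> V \<Longrightarrow> f (x + y) = f x + f y"
    and "\<And>x c. x \<in> V \<Longrightarrow> f (c *\<^sub>C x) = c *\<^sub>C f x"
  shows "clinear_on V f"
  using assms unfolding clinear_on_def by blast

lemma clinear_on_add: "clinear_on V f \<Longrightarrow> x \<in> V \<Longrightarrow> y \<in> V \<Longrightarrow> f (x + y) = f x + f y"
  and clinear_on_scale: "clinear_on V f \<Longrightarrow> x \<in> V \<Longrightarrow> f (c *\<^sub>C x) = c *\<^sub>C f x"
  unfolding clinear_on_def by blast+

lemma clinear_on_mono: "clinear_on V f \<Longrightarrow> W \<subseteq> V \<Longrightarrow> clinear_on W f"
  unfolding clinear_on_def by blast

lemma scaleC_minus1: "(-1) *\<^sub>C (x::'a::complex_vector) = - x"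
  by (metis complex_vector.scale_minus_left complex_vector.scale_one)

lemma clinear_on_0: "clinear_on V f \<Longrightarrow> csubspace V \<Longrightarrow> f 0 = 0"
  using clinear_on_scale[of V f 0 0] by (simp add: csubspace_0)

lemma clinear_on_minus: "clinear_on V f \<Longrightarrow> x \<in> V \<Longrightarrow> f (- x) = - f x"
  using clinear_on_scale[of V f x "-1"] by (simp add: scaleC_minus1)

lemma csubspace_image:
  assumes "csubspace V" and "clinear_on V f"
  shows "csubspace (f ` V)"
  unfolding complex_vector.subspace_def
proof (intro conjI ballI allI)
  show "0 \<in> f ` V"
    using assms clinear_on_0 csubspace_0 by (metis image_eqI)
  fix x y c assume "x \<in> f ` V"
  then obtain a where a: "x = f a" "a \<in> V" by blast
  show "c *\<^sub>C x \<in> f ` V"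
    using a assms clinear_on_scale[of V f a c] csubspace_scale by (metis image_eqI)
  assume "y \<in> f ` V"
  then obtain b where b: "y = f b" "b \<in> V" by blast
  show "x + y \<in> f ` V"
    using a b assms clinear_on_add[of V f a b] csubspace_add by (metis image_eqI)
qed

lemma csubspace_kernel:
  assumes "csubspace V" and "clinear_on V f"
  shows "csubspace {x \<in> V. f x = 0}"
  unfolding complex_vector.subspace_def
  using assms clinear_on_0[OF assms(2,1)]
  by (auto simp: csubspace_0 csubspace_add
      csubspace_scale clinear_on_add clinear_on_scale)

lemma csubspace_Times: "csubspace V \<Longrightarrow> csubspace W \<Longrightarrow> csubspace (V \<times> W)"
  unfolding complex_vector.subspace_def
  by (auto simp: zero_prod_def plus_prod_def scaleC_prod_def)

lemma cfinite_dim_mono: "cfinite_dim V \<Longrightarrow> W \<subseteq> V \<Longrightarrow> cfinite_dim W"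
  unfolding cfinite_dim_def by blast

lemma cfinite_dim_basis:
  assumes "cfinite_dim V"
  obtains B where "B \<subseteq> V" "finite B" "cindependent B" "V \<subseteq> cspan B" "card B = cdim V"
proof -
  obtain T where T: "finite T" "V \<subseteq> cspan T"
    using assms unfolding cfinite_dim_def by blast
  obtain B where B: "B \<subseteq> V" "cindependent B" "V \<subseteq> cspan B" "card B = cdim V"
    using complex_vector.basis_exists by blast
  then have "finite B"
    using complex_vector.independent_span_bound[OF T(1) B(2)] T(2) by blast
  then show ?thesis using B that by blast
qed

lemma cfinite_dim_span_basis:
  assumes "cfinite_dim V" "csubspace V"
  obtains B where "finite B" "cindependent B" "cspan B = V"
  using cfinite_dim_basis[OF assms(1)] assms(2) cspan_subspace by metis

lemma cdim_mono:
  assumes "cfinite_dim W" "V \<subseteq> W"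
  shows "cdim V \<le> cdim W"
proof -
  obtain B where B: "B \<subseteq> W" "finite B" "W \<subseteq> cspan B" "card B = cdim W"
    using cfinite_dim_basis[OF assms(1)] by metis
  then show ?thesis
    using complex_vector.dim_le_card[of V B] assms(2) by auto
qed

lemma cdim_eq_imp_subset:
  assumes "cfinite_dim W" "csubspace V" "V \<subseteq> W" "cdim W \<le> cdim V"
  shows "V = W"
proof (rule ccontr)
  assume "V \<noteq> W"
  then obtain x where x: "x \<in> W" "x \<notin> V" using assms(3) by blast
  obtain B where B: "B \<subseteq> V" "finite B" "cindependent B" "V \<subseteq> cspan B" "card B = cdim V"
    using cfinite_dim_basis[OF cfinite_dim_mono[OF assms(1,3)]] by metis
  have "cspan B = V" using B assms(2) cspan_subspace by metis
  then have "cindependent (insert x B)"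
    using complex_vector.independent_insertI[of x B] x B by simp
  moreover obtain C where C: "finite C" "W \<subseteq> cspan C" "card C = cdim W"
    using cfinite_dim_basis[OF assms(1)] by metis
  ultimately have "card (insert x B) \<le> card C"
    using complex_vector.independent_span_bound[of C "insert x B"] x(1) B(1) assms(3) by blast
  moreover have "x \<notin> B" using x B by blast
  ultimately show False using B C assms(4) by simp
qed

lemma cdim_0_imp:
  assumes "cfinite_dim V" "cdim V = 0"
  shows "V \<subseteq> {0}"
proof -
  obtain B where "finite B" "V \<subseteq> cspan B" "card B = cdim V"
    using cfinite_dim_basis[OF assms(1)] by metis
  then show ?thesis using assms(2) by simp
qed

lemma cdim_zero [simp]: "cdim {0 :: 'a::complex_vector} = 0"
  using complex_vector.dim_span[of "{} :: 'a set"] complex_vector.dim_eq_card_independent[of "{} :: 'a set"]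
  by (simp add: complex_vector.independent_empty)

lemma cfinite_dim_zero [simp]: "cfinite_dim {0}"
  unfolding cfinite_dim_def by (intro exI[of _ "{}"]) simp

lemma csubspace_zero [simp]: "csubspace {0}"
  by (rule csubspace_single_0)

text \<open>\<open>f\<close> is linear only on \<open>V\<close>, so it is replaced by a globally
  linear \<open>g\<close> that agrees with it on a basis of \<open>V\<close> extending a basis of
  the kernel. The images of the added basis vectors then form a basis of the image.\<close>

lemma rank_nullity:
  fixes f :: "'a::complex_vector \<Rightarrow> 'b::complex_vector"
  assumes V: "csubspace V" "cfinite_dim V" and f: "clinear_on V f"
  shows "cfinite_dim (f ` V)" and "cdim V = cdim {x \<in> V. f x = 0} + cdim (f ` V)"
proof -
  interpret vector_space_pair "scaleC :: complex \<Rightarrow> 'a \<Rightarrow> 'a" "scaleC :: complex \<Rightarrow> 'b \<Rightarrow> 'b"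
    by (simp add: vector_space_pair_def complex_vector.vector_space_axioms)
  define K where "K = {x \<in> V. f x = 0}"
  have K: "csubspace K" unfolding K_def by (rule csubspace_kernel[OF V(1) f])
  obtain B0 where B0: "B0 \<subseteq> K" "finite B0" "cindependent B0" "K \<subseteq> cspan B0" "card B0 = cdim K"
    using cfinite_dim_basis[OF cfinite_dim_mono[OF V(2)], of K] unfolding K_def by blast
  have B0V: "B0 \<subseteq> V" using B0(1) K_def by auto
  obtain B where B: "B0 \<subseteq> B" "B \<subseteq> V" "cindependent B" "V \<subseteq> cspan B"
    using complex_vector.maximal_independent_subset_extend[OF B0V B0(3)] by blast
  obtain T where T: "finite T" "V \<subseteq> cspan T" using V(2) unfolding cfinite_dim_def by blast
  have fB: "finite B" using complex_vector.independent_span_bound[OF T(1) B(3)] B T by blast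
  have spB: "cspan B = V" using B V(1) cspan_subspace by metis
  have spB0: "cspan B0 = K" using B0 K cspan_subspace by metis
  obtain g where g: "Vector_Spaces.linear scaleC scaleC g" "\<And>x. x \<in> B \<Longrightarrow> g x = f x"
    using linear_independent_extend[OF B(3), of f] by blast
  have gadd: "g (x + y) = g x + g y" and gsc: "g (c *\<^sub>C x) = c *\<^sub>C g x" for x y c
    using g(1) by (auto simp: Vector_Spaces.linear_iff)
  have gf: "g x = f x" if "x \<in> V" for x
  proof -
    have "csubspace {x \<in> V. g x - f x = 0}"
      by (rule csubspace_kernel[OF V(1)])
        (auto intro!: clinear_onI simp: gadd gsc clinear_on_add[OF f] clinear_on_scale[OF f]
          scaleC_diff_right)
    moreover have "B \<subseteq> {x \<in> V. g x - f x = 0}" using B g(2) by auto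
    ultimately have "cspan B \<subseteq> {x \<in> V. g x - f x = 0}"
      by (rule cspan_minimal[rotated])
    then show ?thesis using that spB by auto
  qed
  define C where "C = B - B0"
  have indC: "cindependent C"
    using B(3) C_def complex_vector.independent_mono by blast
  \<comment> \<open>A vector in both spans has a single coordinate function with respect to
    \<open>B\<close>, and that function is supported in the disjoint sets \<open>C\<close> and
    \<open>B0\<close>.\<close>
  have inter: "x = 0" if "x \<in> cspan C" "x \<in> cspan B0" for x
  proof -
    have "complex_vector.representation B x = complex_vector.representation C x"
      by (rule complex_vector.representation_extend[OF B(3) that(1)]) (simp add: C_def)
    moreover have "complex_vector.representation B x = complex_vector.representation B0 x"
      by (rule complex_vector.representation_extend[OF B(3) that(2) B(1)])
    ultimately have rep: "complex_vector.representation B0 x b = complex_vector.representation C x b" for b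
      by simp
    have "complex_vector.representation B0 x b = 0" for b
      using complex_vector.representation_ne_zero[of C x b]
        complex_vector.representation_ne_zero[of B0 x b] rep[of b] unfolding C_def by (metis DiffD2)
    then show ?thesis
      using complex_vector.sum_nonzero_representation_eq[OF B0(3) that(2)] by simp
  qed
  have inj: "inj_on g (cspan C)"
  proof (rule inj_onI)
    fix x y assume xy: "x \<in> cspan C" "y \<in> cspan C" "g x = g y"
    have d: "x - y \<in> cspan C" using xy by (rule_tac cspan_diff)
    then have "x - y \<in> V" using spB C_def cspan_mono[of C B] by blast
    moreover have "g (x - y) = 0" using xy gadd[of "x - y" y] by simp
    ultimately have "x - y \<in> K" using gf K_def by auto
    then show "x = y" using inter[of "x - y"] d spB0 by simp
  qed
  have indgC: "cindependent (g ` C)"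
    by (rule linear_independent_injective_image[OF g(1) indC inj])
  have "f ` V = g ` V" using gf by auto
  also have "\<dots> = cspan (g ` B)" unfolding spB[symmetric] by (rule linear_span_image[OF g(1), symmetric])
  also have "\<dots> = cspan (g ` C)"
  proof -
    have "g ` B \<subseteq> insert 0 (g ` C)" using B0(1) C_def gf K_def by auto
    then have "cspan (g ` B) \<subseteq> cspan (insert 0 (g ` C))" by (rule cspan_mono)
    moreover have "cspan (g ` C) \<subseteq> cspan (g ` B)" by (rule cspan_mono) (auto simp: C_def)
    ultimately show ?thesis by simp
  qed
  finally have im: "f ` V = cspan (g ` C)" .
  have fC: "finite C" using fB C_def by simp
  show "cfinite_dim (f ` V)" unfolding cfinite_dim_def im using fC by blast
  have "cdim (f ` V) = card (g ` C)" unfolding im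
    by (rule complex_vector.dim_span_eq_card_independent[OF indgC])
  also have "\<dots> = card C"
    using inj cspan_superset by (intro card_image) (rule inj_on_subset)
  finally have "cdim (f ` V) = card C" .
  moreover have "cdim V = card B" using complex_vector.basis_card_eq_dim B by metis
  moreover have "card B = card B0 + card C"
    unfolding C_def using B(1) fB by (simp add: card_Diff_subset finite_subset card_mono)
  ultimately show "cdim V = cdim {x \<in> V. f x = 0} + cdim (f ` V)"
    using B0(5) K_def by simp
qed

lemma cdim_inj_image:
  assumes "csubspace V" "cfinite_dim V" "clinear_on V f" "\<And>x. x \<in> V \<Longrightarrow> f x = 0 \<Longrightarrow> x = 0"
  shows "cdim (f ` V) = cdim V"
proof -
  have "{x \<in> V. f x = 0} = {0}"
    using assms csubspace_0[OF assms(1)] clinear_on_0[OF assms(3,1)] by auto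
  then show ?thesis using rank_nullity(2)[OF assms(1-3)] by simp
qed

lemma clinear_on_span:
  assumes "clinear_on UNIV f" "\<And>b. b \<in> B \<Longrightarrow> f b \<in> cspan D" "x \<in> cspan B"
  shows "f x \<in> cspan D"
proof -
  have "csubspace {x. f x \<in> cspan D}"
    unfolding complex_vector.subspace_def
    using clinear_on_0[OF assms(1)] clinear_on_add[OF assms(1)] clinear_on_scale[OF assms(1)]
      cspan_zero[of D] cspan_add[of _ D] cspan_scale[of _ D]
    by simp
  then show ?thesis using cspan_minimal[of B "{x. f x \<in> cspan D}"] assms by blast
qed

lemma cfinite_dim_Times:
  assumes "cfinite_dim (V::'a::complex_vector set)" "cfinite_dim (W::'b::complex_vector set)"
  shows "cfinite_dim (V \<times> W)"
proof -
  obtain B C where BC: "finite B" "V \<subseteq> cspan B" "finite C" "W \<subseteq> cspan C"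
    using assms unfolding cfinite_dim_def by blast
  let ?D = "(\<lambda>b. (b, 0::'b)) ` B \<union> (\<lambda>c. (0::'a, c)) ` C"
  have l: "clinear_on UNIV (\<lambda>v. (v::'a, 0::'b))" and r: "clinear_on UNIV (\<lambda>w. (0::'a, w::'b))"
    by (auto intro!: clinear_onI simp: scaleC_prod_def)
  have "(v, 0) \<in> cspan ?D" if "v \<in> cspan B" for v
    by (rule clinear_on_span[OF l _ that]) (auto intro: cspan_base)
  moreover have "(0, w) \<in> cspan ?D" if "w \<in> cspan C" for w
    by (rule clinear_on_span[OF r _ that]) (auto intro: cspan_base)
  ultimately have "(v, w) \<in> cspan ?D" if "v \<in> V" "w \<in> W" for v w
    using cspan_add[of "(v, 0)" ?D "(0, w)"] that BC by auto
  then have "V \<times> W \<subseteq> cspan ?D" by blast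
  then show ?thesis unfolding cfinite_dim_def using BC by (intro exI[of _ ?D]) auto
qed

lemma clinear_on_fst: "clinear_on V fst" and clinear_on_snd: "clinear_on V snd"
  by (auto intro!: clinear_onI simp: scaleC_prod_def)

lemma cdim_Times:
  assumes "csubspace V" "cfinite_dim V" "csubspace W" "cfinite_dim W"
  shows "cdim (V \<times> W) = cdim V + cdim W"
proof -
  note s = csubspace_Times[OF assms(1,3)] and f = cfinite_dim_Times[OF assms(2,4)]
  have 0: "0 \<in> V" "0 \<in> W" using assms csubspace_0 by auto
  have k: "{x \<in> V \<times> W. fst x = 0} = {0} \<times> W" using 0 by auto
  have "fst ` (V \<times> W) = V" using 0 by force
  moreover have "cdim (snd ` ({0::'a} \<times> W)) = cdim ({0::'a} \<times> W)"
    using assms by (intro cdim_inj_image csubspace_Times cfinite_dim_Times clinear_on_snd)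
      (auto simp: zero_prod_def)
  moreover have "snd ` ({0::'a} \<times> W) = W" by force
  ultimately show ?thesis using rank_nullity(2)[OF s f clinear_on_fst] k by simp
qed

text \<open>Rank-nullity for addition on \<open>U \<times> V\<close>: its kernel is the antidiagonal
  copy of \<open>U \<inter> V\<close>.\<close>

lemma cdim_sum_Int:
  assumes "csubspace U" "cfinite_dim U" "csubspace V" "cfinite_dim V"
  shows "cdim U + cdim V = cdim {u + v | u v. u \<in> U \<and> v \<in> V} + cdim (U \<inter> V)"
proof -
  note s = csubspace_Times[OF assms(1,3)] and f = cfinite_dim_Times[OF assms(2,4)]
  define g where "g = (\<lambda>(u, v). u + v :: 'a)"
  have g: "clinear_on (U \<times> V) g"
    unfolding g_def by (auto intro!: clinear_onI simp: scaleC_prod_def scaleC_add_right)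
  have im: "g ` (U \<times> V) = {u + v | u v. u \<in> U \<and> v \<in> V}" unfolding g_def by (auto simp: image_iff Bex_def)
  have "(\<lambda>x. (x, - x)) ` (U \<inter> V) = {x \<in> U \<times> V. g x = 0}"
  proof
    show "(\<lambda>x. (x, - x)) ` (U \<inter> V) \<subseteq> {x \<in> U \<times> V. g x = 0}"
      using assms csubspace_neg unfolding g_def by auto
    show "{x \<in> U \<times> V. g x = 0} \<subseteq> (\<lambda>x. (x, - x)) ` (U \<inter> V)"
    proof clarify
      fix a b assume h: "a \<in> U" "b \<in> V" "g (a, b) = 0"
      then have b: "b = - a" unfolding g_def by (simp add: eq_neg_iff_add_eq_0 add.commute)
      then have "a \<in> V" using h(2) csubspace_neg[OF assms(3)] by fastforce
      then show "(a, b) \<in> (\<lambda>x. (x, - x)) ` (U \<inter> V)" using h b by auto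
    qed
  qed
  moreover have "cdim ((\<lambda>x. (x, - x)) ` (U \<inter> V)) = cdim (U \<inter> V)"
    using assms by (intro cdim_inj_image csubspace_inter)
      (auto intro!: clinear_onI cfinite_dim_mono[of U] simp: scaleC_prod_def zero_prod_def)
  ultimately show ?thesis
    using rank_nullity(2)[OF s f g] cdim_Times[OF assms] im by simp
qed

lemma cdim_disjoint_le:
  assumes "cfinite_dim W" "csubspace W" "csubspace U" "csubspace V" "U \<subseteq> W" "V \<subseteq> W"
    and "\<And>x. x \<in> U \<Longrightarrow> x \<in> V \<Longrightarrow> x = 0"
  shows "cdim U + cdim V \<le> cdim W"
proof -
  have "U \<inter> V = {0}" using assms csubspace_0 by blast
  moreover have "{u + v | u v. u \<in> U \<and> v \<in> V} \<subseteq> W"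
    using assms csubspace_add by blast
  ultimately show ?thesis
    using cdim_sum_Int[of U V] assms cdim_mono[OF assms(1)] cfinite_dim_mono[OF assms(1)] by simp
qed

lemma cdim_direct_sum_decomp:
  assumes "cfinite_dim W" "csubspace W" "csubspace U" "csubspace V" "U \<subseteq> W" "V \<subseteq> W"
    and "\<And>x. x \<in> U \<Longrightarrow> x \<in> V \<Longrightarrow> x = 0" and "cdim W \<le> cdim U + cdim V" and "w \<in> W"
  obtains u v where "u \<in> U" "v \<in> V" "w = u + v"
proof -
  have "U \<inter> V = {0}" using assms csubspace_0 by blast
  moreover have sub: "{u + v | u v. u \<in> U \<and> v \<in> V} \<subseteq> W"
    using assms csubspace_add by blast
  ultimately have "{u + v | u v. u \<in> U \<and> v \<in> V} = W"
    using cdim_sum_Int[of U V] assms cfinite_dim_mono[OF assms(1)]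
    by (intro cdim_eq_imp_subset csubspace_sums) auto
  then show ?thesis using that assms(9) by blast
qed

lemma csubspace_complement:
  assumes "cfinite_dim W" "csubspace W" "csubspace U" "U \<subseteq> W"
  obtains C where "csubspace C" "C \<subseteq> W" "\<And>x. x \<in> U \<Longrightarrow> x \<in> C \<Longrightarrow> x = 0" "cdim U + cdim C = cdim W"
proof -
  obtain B0 where B0: "B0 \<subseteq> U" "finite B0" "cindependent B0" "U \<subseteq> cspan B0" "card B0 = cdim U"
    using cfinite_dim_basis[OF cfinite_dim_mono[OF assms(1,4)]] by metis
  have spB0: "cspan B0 = U" using B0 assms cspan_subspace by metis
  obtain B where B: "B0 \<subseteq> B" "B \<subseteq> W" "cindependent B" "W \<subseteq> cspan B"
    using complex_vector.maximal_independent_subset_extend[of B0 W] B0 assms(4) by blast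
  have cB: "card B = cdim W" using complex_vector.basis_card_eq_dim B by metis
  obtain T where "finite T" "W \<subseteq> cspan T" using assms(1) unfolding cfinite_dim_def by blast
  then have fB: "finite B" using complex_vector.independent_span_bound[of T B] B by blast
  define C where "C = cspan (B - B0)"
  have CW: "C \<subseteq> W" unfolding C_def using B assms(2) by (intro cspan_minimal) auto
  have cC: "cdim C = card (B - B0)" unfolding C_def
    using B(3) complex_vector.independent_mono by (intro complex_vector.dim_span_eq_card_independent) blast
  have "{u + v | u v. u \<in> U \<and> v \<in> C} = W"
  proof
    show "{u + v | u v. u \<in> U \<and> v \<in> C} \<subseteq> W"
      using assms CW csubspace_add by blast
    have "B0 \<union> (B - B0) = B" using B by blast
    then have "cspan B = {u + v | u v. u \<in> U \<and> v \<in> C}"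
      using cspan_Un[of B0 "B - B0"] spB0 C_def by simp
    then show "W \<subseteq> {u + v | u v. u \<in> U \<and> v \<in> C}" using B by simp
  qed
  moreover have "card B = card B0 + card (B - B0)"
    using B(1) fB by (simp add: card_Diff_subset finite_subset card_mono)
  moreover have sC: "csubspace C" unfolding C_def by (rule csubspace_span)
  moreover have fd: "cfinite_dim U" "cfinite_dim C" using cfinite_dim_mono assms(1,4) CW by blast+
  ultimately have "cdim (U \<inter> C) = 0"
    using cdim_sum_Int[of U C] assms(3) cB cC B0(5) by simp
  then have "U \<inter> C \<subseteq> {0}" using fd by (intro cdim_0_imp cfinite_dim_mono[OF fd(1)]) auto
  then show ?thesis
    using that[of C] sC CW cC cB B0(5) \<open>card B = card B0 + card (B - B0)\<close> by auto
qed

lemma cdim_complex_functional: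
  fixes f :: "'a::complex_vector \<Rightarrow> complex"
  assumes "csubspace V" "cfinite_dim V" "clinear_on V f"
  shows "cdim V \<le> cdim {x \<in> V. f x = 0} + 1"
proof -
  have "f ` V \<subseteq> cspan {1}"
  proof clarify
    fix x
    have "f x *\<^sub>C (1::complex) \<in> cspan {1}"
      by (intro cspan_scale cspan_base) simp
    then show "f x \<in> cspan {1}" by (simp add: scaleC_complex_def)
  qed
  then have "cdim (f ` V) \<le> 1" using complex_vector.dim_le_card[of "f ` V" "{1}"] by simp
  then show ?thesis using rank_nullity(2)[OF assms] by simp
qed

text \<open>Each functional lowers the dimension by at most one. This bounds orthogonal complements
  from below, for Hermitian forms and for \<open>omega\<close> alike.\<close>

lemma cdim_functionals:
  fixes f :: "'b \<Rightarrow> 'a::complex_vector \<Rightarrow> complex"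
  assumes "finite B" "csubspace V" "cfinite_dim V" "\<And>b. b \<in> B \<Longrightarrow> clinear_on V (f b)"
  shows "csubspace {x \<in> V. \<forall>b\<in>B. f b x = 0} \<and> cdim V \<le> cdim {x \<in> V. \<forall>b\<in>B. f b x = 0} + card B"
  using assms(1,4)
proof (induction B rule: finite_induct)
  case empty
  then show ?case using assms by simp
next
  case (insert b B)
  let ?W = "{x \<in> V. \<forall>b\<in>B. f b x = 0}"
  have W: "csubspace ?W" "cdim V \<le> cdim ?W + card B" using insert by auto
  have f: "clinear_on ?W (f b)" by (rule clinear_on_mono[of V]) (use insert in auto)
  have eq: "{x \<in> V. \<forall>b\<in>insert b B. f b x = 0} = {x \<in> ?W. f b x = 0}" by auto
  have "cfinite_dim ?W" by (rule cfinite_dim_mono[OF assms(3)]) auto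
  then have "cdim ?W \<le> cdim {x \<in> ?W. f b x = 0} + 1"
    using cdim_complex_functional[OF W(1) _ f] by simp
  then show ?case unfolding eq using W csubspace_kernel[OF W(1) f] insert by simp
qed

subsection \<open>Hermitian forms\<close>

definition hermitian_on :: "'a::complex_vector set \<Rightarrow> ('a \<Rightarrow> 'a \<Rightarrow> complex) \<Rightarrow> bool"
  where "hermitian_on V q \<longleftrightarrow> (\<forall>x\<in>V. clinear_on V (q x)) \<and> (\<forall>x\<in>V. \<forall>y\<in>V. q x y = cnj (q y x))"

lemma hermitian_onI:
  assumes "\<And>x y z. x \<in> V \<Longrightarrow> y \<in> V \<Longrightarrow> z \<in> V \<Longrightarrow> q x (y + z) = q x y + q x z"
    and "\<And>x y c. x \<in> V \<Longrightarrow> y \<in> V \<Longrightarrow> q x (c *\<^sub>C y) = c * q x y"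
    and "\<And>x y. x \<in> V \<Longrightarrow> y \<in> V \<Longrightarrow> q x y = cnj (q y x)"
  shows "hermitian_on V q"
  unfolding hermitian_on_def
proof (intro conjI ballI clinear_onI)
  fix x y c assume "x \<in> V" "y \<in> V"
  then show "q x (c *\<^sub>C y) = c *\<^sub>C q x y" by (simp add: assms(2) scaleC_complex_def)
qed (fact assms(1) assms(3))+

lemma hermitian_on_clinear: "hermitian_on V q \<Longrightarrow> x \<in> V \<Longrightarrow> clinear_on V (q x)"
  unfolding hermitian_on_def by blast

lemma hermitian_on_commute: "hermitian_on V q \<Longrightarrow> x \<in> V \<Longrightarrow> y \<in> V \<Longrightarrow> q x y = cnj (q y x)"
  unfolding hermitian_on_def by blast

lemma hermitian_on_mono: "hermitian_on V q \<Longrightarrow> W \<subseteq> V \<Longrightarrow> hermitian_on W q"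
  unfolding hermitian_on_def using clinear_on_mono by blast

lemma hermitian_on_add:
  "hermitian_on V q \<Longrightarrow> x \<in> V \<Longrightarrow> y \<in> V \<Longrightarrow> z \<in> V \<Longrightarrow> q x (y + z) = q x y + q x z"
  using hermitian_on_clinear clinear_on_add by blast

lemma hermitian_on_scale:
  "hermitian_on V q \<Longrightarrow> x \<in> V \<Longrightarrow> y \<in> V \<Longrightarrow> q x (c *\<^sub>C y) = c * q x y"
  using clinear_on_scale[OF hermitian_on_clinear] by (metis scaleC_complex_def)

lemma hermitian_on_add_left:
  assumes "hermitian_on V q" "csubspace V" "x \<in> V" "y \<in> V" "z \<in> V"
  shows "q (x + y) z = q x z + q y z"
proof -
  have "q (x + y) z = cnj (q z (x + y))"
    using assms by (intro hermitian_on_commute[OF assms(1)] csubspace_add)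
  also have "\<dots> = cnj (q z x) + cnj (q z y)"
    using hermitian_on_add[OF assms(1)] assms by simp
  also have "\<dots> = q x z + q y z"
    using hermitian_on_commute[OF assms(1), of x z] hermitian_on_commute[OF assms(1), of y z] assms by simp
  finally show ?thesis .
qed

lemma hermitian_on_scale_left:
  assumes "hermitian_on V q" "csubspace V" "x \<in> V" "y \<in> V"
  shows "q (c *\<^sub>C x) y = cnj c * q x y"
proof -
  have "q (c *\<^sub>C x) y = cnj (q y (c *\<^sub>C x))"
    using assms by (intro hermitian_on_commute[OF assms(1)] csubspace_scale)
  also have "\<dots> = cnj c * cnj (q y x)"
    using hermitian_on_scale[OF assms(1)] assms by simp
  also have "\<dots> = cnj c * q x y"
    using hermitian_on_commute[OF assms(1), of x y] assms by simp
  finally show ?thesis .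
qed

lemma hermitian_on_expand:
  assumes "hermitian_on V q" "csubspace V" "x \<in> V" "y \<in> V"
  shows "Re (q (x + c *\<^sub>C y) (x + c *\<^sub>C y)) = Re (q x x) + 2 * Re (c * q x y) + (cmod c)\<^sup>2 * Re (q y y)"
proof -
  have cy: "c *\<^sub>C y \<in> V" and s: "x + c *\<^sub>C y \<in> V"
    using assms by (simp_all add: csubspace_add csubspace_scale)
  have "q (x + c *\<^sub>C y) (x + c *\<^sub>C y) = q x x + c * q x y + (cnj (c * q x y) + (c * cnj c) * q y y)"
    using assms cy s hermitian_on_commute[OF assms(1), of y x]
    by (simp add: hermitian_on_add[OF assms(1)] hermitian_on_add_left[OF assms(1,2)]
        hermitian_on_scale[OF assms(1)] hermitian_on_scale_left[OF assms(1,2)] algebra_simps)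
  then have "Re (q (x + c *\<^sub>C y) (x + c *\<^sub>C y))
      = Re (q x x) + Re (c * q x y) + (Re (cnj (c * q x y)) + Re (of_real ((cmod c)\<^sup>2) * q y y))"
    by (simp only: plus_complex.sel complex_norm_square)
  then show ?thesis by (simp del: of_real_power)
qed

text \<open>With \<open>z = q x y\<close>, nonnegativity on \<open>x - t cnj z y\<close> for real
  \<open>t\<close> is a quadratic inequality in \<open>t\<close>. If \<open>b > 0\<close>, its
  optimum is \<open>t = 1 / b\<close>; the form may degenerate, and for \<open>b = 0\<close> a large
  \<open>t\<close> forces \<open>z = 0\<close>.\<close>

lemma hermitian_on_cauchy_schwarz:
  assumes "hermitian_on V q" "csubspace V" "\<And>v. v \<in> V \<Longrightarrow> 0 \<le> Re (q v v)" "x \<in> V" "y \<in> V"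
  shows "(cmod (q x y))\<^sup>2 \<le> Re (q x x) * Re (q y y)"
proof -
  define z a b where "z = q x y" and "a = Re (q x x)" and "b = Re (q y y)"
  have ineq: "0 \<le> a - 2 * t * (cmod z)\<^sup>2 + t\<^sup>2 * (cmod z)\<^sup>2 * b" for t :: real
  proof -
    define c where "c = - complex_of_real t * cnj z"
    have "x + c *\<^sub>C y \<in> V"
      using assms by (simp add: csubspace_add csubspace_scale)
    then have "0 \<le> a + 2 * Re (c * z) + (cmod c)\<^sup>2 * b"
      using assms(3)[of "x + c *\<^sub>C y"]
      unfolding hermitian_on_expand[OF assms(1,2,4,5)] z_def a_def b_def by blast
    moreover have "c * z = complex_of_real (- t * (cmod z)\<^sup>2)"
      using complex_norm_square[of z] unfolding c_def by (simp add: mult.assoc mult.commute)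
    moreover have "(cmod c)\<^sup>2 = t\<^sup>2 * (cmod z)\<^sup>2"
      unfolding c_def by (simp add: norm_mult power_mult_distrib)
    ultimately show ?thesis by simp
  qed
  have b0: "0 \<le> b" "0 \<le> a" using assms unfolding a_def b_def by auto
  show ?thesis
  proof (cases "b = 0")
    case True
    have "(cmod z)\<^sup>2 = 0"
    proof (rule ccontr)
      assume "(cmod z)\<^sup>2 \<noteq> 0"
      then have "2 * ((a + 1) / (cmod z)\<^sup>2) * (cmod z)\<^sup>2 = 2 * (a + 1)" by simp
      then have "0 \<le> a - 2 * (a + 1)" using ineq[of "(a + 1) / (cmod z)\<^sup>2"] True by simp
      then show False using b0 by simp
    qed
    then show ?thesis using b0 unfolding z_def a_def b_def by simp
  next
    case False
    then have "0 \<le> a - (cmod z)\<^sup>2 / b"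
      using ineq[of "1 / b"] by (simp add: power2_eq_square field_simps)
    then show ?thesis using False b0 unfolding z_def a_def b_def by (simp add: field_simps)
  qed
qed

text \<open>Only for a finite nonempty set does the \<open>Max\<close> in \<open>n_minus\<close>
  carry information.\<close>

lemma n_minus_set:
  fixes q :: "'a::complex_vector \<Rightarrow> 'a \<Rightarrow> complex"
  assumes "csubspace V" "cfinite_dim V"
  defines "D \<equiv> {cdim N | N. csubspace N \<and> N \<subseteq> V \<and> (\<forall>u\<in>N. u \<noteq> 0 \<longrightarrow> Re (q u u) < 0)}"
  shows "finite D" "D \<noteq> {}"
proof -
  have "D \<subseteq> {..cdim V}" unfolding D_def using cdim_mono[OF assms(2)] by auto
  then show "finite D" using finite_subset by blast
  have "cdim {0::'a} \<in> D" unfolding D_def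
    using csubspace_zero csubspace_0[OF assms(1)] by blast
  then show "D \<noteq> {}" by blast
qed

lemma n_minus_obtain:
  assumes "csubspace V" "cfinite_dim V"
  obtains N where "csubspace N" "N \<subseteq> V" "\<And>u. u \<in> N \<Longrightarrow> u \<noteq> 0 \<Longrightarrow> Re (q u u) < 0" "cdim N = n_minus V q"
  using Max_in[OF n_minus_set[OF assms, of q]] unfolding n_minus_def by auto

lemma n_minus_ge:
  assumes "csubspace V" "cfinite_dim V" "csubspace N" "N \<subseteq> V" "\<And>u. u \<in> N \<Longrightarrow> u \<noteq> 0 \<Longrightarrow> Re (q u u) < 0"
  shows "cdim N \<le> n_minus V q"
  unfolding n_minus_def using assms(3-5) by (intro Max_ge n_minus_set[OF assms(1,2)]) auto

text \<open>A negative definite subspace and a nonnegative one meet only in zero, so both fit side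
  by side into \<open>V\<close>.\<close>

lemma n_minus_le:
  assumes V: "csubspace V" "cfinite_dim V" and P: "csubspace P" "P \<subseteq> V" "\<And>u. u \<in> P \<Longrightarrow> 0 \<le> Re (q u u)"
  shows "n_minus V q + cdim P \<le> cdim V"
proof -
  obtain N where N: "csubspace N" "N \<subseteq> V" "\<And>u. u \<in> N \<Longrightarrow> u \<noteq> 0 \<Longrightarrow> Re (q u u) < 0" "cdim N = n_minus V q"
    using n_minus_obtain[OF V, where q = q] by blast
  then show ?thesis
    using cdim_disjoint_le[OF V(2,1) N(1) P(1) N(2) P(2)] P(3) by (metis linorder_not_le)
qed

text \<open>\<open>n_minus\<close> reads only diagonal values, so a change of variables has to match
  these alone. This admits a function of one variable, such as \<open>kashiwara\<close>, in place of
  a form.\<close>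

lemma n_minus_image:
  assumes V: "csubspace V" "cfinite_dim V" and f: "clinear_on V f" "\<And>x. x \<in> V \<Longrightarrow> f x = 0 \<Longrightarrow> x = 0"
    and eq: "\<And>u. u \<in> V \<Longrightarrow> Re (q' (f u) (f u)) = Re (q u u)"
  shows "n_minus (f ` V) q' = n_minus V q"
proof (rule antisym)
  have W: "csubspace (f ` V)" "cfinite_dim (f ` V)"
    using csubspace_image[OF V(1) f(1)] rank_nullity[OF V f(1)] by auto
  note f0 = clinear_on_0[OF f(1) V(1)]
  show "n_minus V q \<le> n_minus (f ` V) q'"
  proof -
    obtain N where N: "csubspace N" "N \<subseteq> V" "\<And>u. u \<in> N \<Longrightarrow> u \<noteq> 0 \<Longrightarrow> Re (q u u) < 0" "cdim N = n_minus V q"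
      using n_minus_obtain[OF V, where q = q] by blast
    note fN = clinear_on_mono[OF f(1) N(2)]
    have "cdim (f ` N) \<le> n_minus (f ` V) q'"
      by (rule n_minus_ge[OF W csubspace_image[OF N(1) fN]]) (use N(2,3) eq f0 in \<open>auto, metis subsetD\<close>)
    moreover have "cdim (f ` N) = cdim N"
      using cdim_inj_image[OF N(1) cfinite_dim_mono[OF V(2) N(2)] fN] f(2) N(2) by auto
    ultimately show ?thesis using N(4) by simp
  qed
  show "n_minus (f ` V) q' \<le> n_minus V q"
  proof -
    obtain N where N: "csubspace N" "N \<subseteq> f ` V" "\<And>u. u \<in> N \<Longrightarrow> u \<noteq> 0 \<Longrightarrow> Re (q' u u) < 0" "cdim N = n_minus (f ` V) q'"
      using n_minus_obtain[OF W, where q = q'] by blast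
    define M where "M = {u \<in> V. f u \<in> N}"
    have M: "csubspace M" unfolding M_def complex_vector.subspace_def
      using V(1) N(1) f0
      by (simp add: clinear_on_add[OF f(1)] clinear_on_scale[OF f(1)] csubspace_0
          csubspace_add csubspace_scale)
    have MV: "M \<subseteq> V" unfolding M_def by auto
    have "f ` M = N" unfolding M_def using N(2) by auto
    moreover have "cdim (f ` M) = cdim M"
      using cdim_inj_image[OF M cfinite_dim_mono[OF V(2) MV] clinear_on_mono[OF f(1) MV]] f(2) MV by auto
    moreover have "cdim M \<le> n_minus V q"
      by (rule n_minus_ge[OF V M MV]) (use N(3) eq f(2) in \<open>auto simp: M_def, metis\<close>)
    ultimately show ?thesis using N(4) by simp
  qed
qed

lemma n_minus_cong:
  assumes "\<And>u. u \<in> V \<Longrightarrow> Re (q' u u) = Re (q u u)"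
  shows "n_minus V q' = n_minus V q"
proof -
  have "(csubspace N \<and> N \<subseteq> V \<and> (\<forall>u\<in>N. u \<noteq> 0 \<longrightarrow> Re (q' u u) < 0))
      = (csubspace N \<and> N \<subseteq> V \<and> (\<forall>u\<in>N. u \<noteq> 0 \<longrightarrow> Re (q u u) < 0))" for N
    using assms by (metis subsetD)
  then show ?thesis unfolding n_minus_def by simp
qed

text \<open>A complement of \<open>U\<close> is negative definite and gives the lower bound;
  \<open>U\<close> itself is nonnegative and gives the upper bound.\<close>

lemma n_minus_semidefinite:
  assumes V: "csubspace V" "cfinite_dim V" and U: "csubspace U" "U \<subseteq> V"
    and "\<And>u. u \<in> V \<Longrightarrow> u \<notin> U \<Longrightarrow> Re (q u u) < 0" "\<And>u. u \<in> U \<Longrightarrow> 0 \<le> Re (q u u)"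
  shows "n_minus V q + cdim U = cdim V"
proof -
  obtain C where C: "csubspace C" "C \<subseteq> V" "\<And>x. x \<in> U \<Longrightarrow> x \<in> C \<Longrightarrow> x = 0" "cdim U + cdim C = cdim V"
    using csubspace_complement[OF V(2,1) U] by metis
  have "cdim C \<le> n_minus V q" using C assms(5) by (intro n_minus_ge[OF V C(1,2)]) auto
  then show ?thesis using n_minus_le[where q = q, OF V U assms(6)] C(4) by simp
qed

text \<open>The orthogonal complement of a maximal negative subspace is nonnegative.\<close>

lemma n_minus_decomposition:
  assumes V: "csubspace V" "cfinite_dim V" and q: "hermitian_on V q"
  obtains N P where "csubspace N" "N \<subseteq> V" "\<forall>u\<in>N. u \<noteq> 0 \<longrightarrow> Re (q u u) < 0" "cdim N = n_minus V q"
    "csubspace P" "P \<subseteq> V" "\<forall>u\<in>P. 0 \<le> Re (q u u)" "cdim N + cdim P = cdim V"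
    "\<forall>u\<in>N. \<forall>v\<in>P. q u v = 0" "\<forall>v\<in>V. (\<forall>u\<in>N. q u v = 0) \<longrightarrow> v \<in> P"
proof -
  obtain N where N: "csubspace N" "N \<subseteq> V" "\<And>u. u \<in> N \<Longrightarrow> u \<noteq> 0 \<Longrightarrow> Re (q u u) < 0" "cdim N = n_minus V q"
    using n_minus_obtain[OF V, where q = q] by blast
  obtain B where B: "B \<subseteq> N" "finite B" "N \<subseteq> cspan B" "card B = cdim N"
    using cfinite_dim_basis[OF cfinite_dim_mono[OF V(2) N(2)]] by metis
  define P where "P = {v \<in> V. \<forall>b\<in>B. q b v = 0}"
  have P: "csubspace P" "cdim V \<le> cdim P + cdim N"
    using cdim_functionals[OF B(2) V, of q] B(1,4) N(2) hermitian_on_clinear[OF q]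
    unfolding P_def by auto
  have PV: "P \<subseteq> V" unfolding P_def by auto
  have orth: "q u v = 0" if "u \<in> N" "v \<in> P" for u v
  proof -
    have "csubspace {u \<in> V. q v u = 0}"
      using csubspace_kernel[OF V(1) hermitian_on_clinear[OF q]] that PV by auto
    moreover have "B \<subseteq> {u \<in> V. q v u = 0}"
    proof
      fix b assume "b \<in> B"
      then have "b \<in> V" "v \<in> V" "q b v = 0" using B(1) N(2) that unfolding P_def by auto
      then show "b \<in> {u \<in> V. q v u = 0}" using hermitian_on_commute[OF q, of v b] by simp
    qed
    ultimately have "u \<in> {u \<in> V. q v u = 0}"
      using cspan_minimal that(1) B(3) by blast
    then show ?thesis using hermitian_on_commute[OF q, of u v] that PV by auto
  qed
  \<comment> \<open>Otherwise \<open>N\<close> together with the line through \<open>p\<close> would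
    be negative definite, of dimension one more than \<open>n_minus V q\<close>.\<close>
  have nonneg: "0 \<le> Re (q p p)" if p: "p \<in> P" for p
  proof (rule ccontr)
    assume neg: "\<not> 0 \<le> Re (q p p)"
    have pV: "p \<in> V" using p PV by blast
    let ?L = "cspan {p}"
    have L: "?L = range (\<lambda>c. c *\<^sub>C p)" by (rule cspan_singleton)
    have p0: "p \<noteq> 0" using neg clinear_on_0[OF hermitian_on_clinear[OF q pV] V(1)] by auto
    have dL: "cdim ?L = 1"
      using p0 complex_vector.dim_span_eq_card_independent[of "{p}"] by simp
    have LV: "?L \<subseteq> V" using pV V(1) by (intro cspan_minimal) auto
    have sL: "csubspace ?L" by simp
    have NL: "N \<inter> ?L = {0}"
    proof -
      have "c *\<^sub>C p = 0" if "c *\<^sub>C p \<in> N" for c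
        using orth[OF that p] hermitian_on_scale_left[OF q V(1) pV pV, of c] neg by auto
      then show ?thesis using L csubspace_0[OF N(1)] cspan_zero by auto
    qed
    let ?M = "{u + v | u v. u \<in> N \<and> v \<in> ?L}"
    have MV: "?M \<subseteq> V" using N(2) LV V(1) csubspace_add by blast
    have "Re (q w w) < 0" if w': "w \<in> ?M" "w \<noteq> 0" for w
    proof -
      obtain u c where w: "w = u + c *\<^sub>C p" "u \<in> N" using w'(1) unfolding L by blast
      have "Re (q w w) = Re (q u u) + (cmod c)\<^sup>2 * Re (q p p)"
        using hermitian_on_expand[OF q V(1), of u p c] orth[OF w(2) p] w N(2) pV by auto
      moreover have "Re (q u u) \<le> 0"
        using N(3)[OF w(2)] clinear_on_0[OF hermitian_on_clinear[OF q, of 0] V(1)] csubspace_0[OF V(1)]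
        by (cases "u = 0") auto
      moreover have "u \<noteq> 0 \<or> c \<noteq> 0" using w w'(2) by auto
      ultimately show ?thesis
        using N(3)[OF w(2)] neg mult_pos_neg[of "(cmod c)\<^sup>2" "Re (q p p)"] by (cases "c = 0") auto
    qed
    then have "cdim ?M \<le> n_minus V q"
      using MV N(1) sL by (intro n_minus_ge[OF V csubspace_sums]) auto
    moreover have "cdim N + cdim ?L = cdim ?M + cdim (N \<inter> ?L)"
      using N sL LV cfinite_dim_mono[OF V(2)] by (intro cdim_sum_Int) auto
    ultimately show False using NL N(4) dL by simp
  qed
  have "cdim N + cdim P \<le> cdim V"
    using nonneg N(3) PV N(1,2) P(1) by (intro cdim_disjoint_le[OF V(2,1)]) force+
  then have "cdim N + cdim P = cdim V" using P(2) by simp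
  moreover have "\<forall>v\<in>V. (\<forall>u\<in>N. q u v = 0) \<longrightarrow> v \<in> P"
    using B(1) unfolding P_def by blast
  moreover have "\<forall>u\<in>N. u \<noteq> 0 \<longrightarrow> Re (q u u) < 0" using N(3) by simp
  moreover have "\<forall>u\<in>P. 0 \<le> Re (q u u)" using nonneg by simp
  moreover have "\<forall>u\<in>N. \<forall>v\<in>P. q u v = 0" using orth by simp
  ultimately show ?thesis
    by (intro that[OF N(1,2) _ N(4) P(1) PV])
qed

text \<open>This is the law of inertia. \<open>V\<close> splits into \<open>N\<close>, the radical
  \<open>R\<close>, and a complement \<open>C\<close> of \<open>R\<close> in \<open>P\<close>. The
  form is positive definite on \<open>C\<close>, which bounds the positive index from below; it is
  nonpositive on \<open>N + R\<close>, which bounds that index from above.\<close>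

lemma sylvester:
  assumes V: "csubspace V" "cfinite_dim V" and q: "hermitian_on V q"
  shows "n_minus V q + n_minus V (\<lambda>u v. - q u v) + cdim {v \<in> V. \<forall>u\<in>V. q u v = 0} = cdim V"
proof -
  obtain N P where N: "csubspace N" "N \<subseteq> V" "\<forall>u\<in>N. u \<noteq> 0 \<longrightarrow> Re (q u u) < 0" "cdim N = n_minus V q"
    and P: "csubspace P" "P \<subseteq> V" "\<forall>u\<in>P. 0 \<le> Re (q u u)" "cdim N + cdim P = cdim V"
    and orth: "\<forall>u\<in>N. \<forall>v\<in>P. q u v = 0"
    and PI: "\<forall>v\<in>V. (\<forall>u\<in>N. q u v = 0) \<longrightarrow> v \<in> P"
    by (rule n_minus_decomposition[OF V q]) (rule that; assumption)
  define R where "R = {v \<in> V. \<forall>u\<in>V. q u v = 0}"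
  have zero: "q u 0 = 0" if "u \<in> V" for u
    using clinear_on_0[OF hermitian_on_clinear[OF q that] V(1)] .
  have R: "csubspace R" unfolding R_def complex_vector.subspace_def
    using V(1)
    by (simp add: zero hermitian_on_add[OF q] hermitian_on_scale[OF q] csubspace_0
        csubspace_add csubspace_scale)
  have RP: "R \<subseteq> P" using PI N(2) unfolding R_def by blast
  note fP = cfinite_dim_mono[OF V(2) P(2)]
  obtain C where C: "csubspace C" "C \<subseteq> P" "\<And>x. x \<in> R \<Longrightarrow> x \<in> C \<Longrightarrow> x = 0" "cdim R + cdim C = cdim P"
    using csubspace_complement[OF fP P(1) R RP] by metis
  have NP: "x = 0" if "x \<in> N" "x \<in> P" for x using that N(3) P(3) by force
  have pos: "Re (- q u u) < 0" if u: "u \<in> C" "u \<noteq> 0" for u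
  proof (rule ccontr)
    assume "\<not> Re (- q u u) < 0"
    moreover have uP: "u \<in> P" using u C(2) by blast
    ultimately have z: "Re (q u u) = 0" using P(3)[rule_format, OF uP] by simp
    \<comment> \<open>By Cauchy-Schwarz on the nonnegative subspace \<open>P\<close>, an isotropic
      vector is orthogonal to all of \<open>P\<close>; being orthogonal to \<open>N\<close> as well,
      it lies in the radical.\<close>
    have Pz: "q v u = 0" if "v \<in> P" for v
      using hermitian_on_cauchy_schwarz[OF hermitian_on_mono[OF q P(2)] P(1) _ that uP] P(3) z by simp
    have "u \<in> R" unfolding R_def
    proof (intro CollectI conjI ballI)
      show uV: "u \<in> V" using uP P(2) by blast
      fix w assume "w \<in> V"
      obtain n p where np: "n \<in> N" "p \<in> P" "w = n + p"
        using cdim_direct_sum_decomp[OF V(2,1) N(1) P(1) N(2) P(2) NP _ \<open>w \<in> V\<close>] P(4) by (metis order_refl)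
      then show "q w u = 0"
        using hermitian_on_add_left[OF q V(1), of n p u] orth[rule_format, OF np(1) uP] Pz[OF np(2)] uV N(2) P(2) by auto
    qed
    then show False using C(3) u by blast
  qed
  have "cdim C \<le> n_minus V (\<lambda>u v. - q u v)"
    using C P pos by (intro n_minus_ge[OF V C(1)]) auto
  moreover have "n_minus V (\<lambda>u v. - q u v) + cdim {u + v | u v. u \<in> N \<and> v \<in> R} \<le> cdim V"
  proof (rule n_minus_le[OF V csubspace_sums[OF N(1) R]])
    show "{u + v | u v. u \<in> N \<and> v \<in> R} \<subseteq> V"
      using N(2) RP P(2) V(1) csubspace_add by blast
    fix w assume "w \<in> {u + v | u v. u \<in> N \<and> v \<in> R}"
    then obtain u v where uv: "w = u + v" "u \<in> N" "v \<in> R" by blast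
    have "v \<in> V" "u \<in> V" "q u v = 0" "q v v = 0" using uv N(2) unfolding R_def by auto
    then have "Re (q w w) = Re (q u u)"
      using hermitian_on_expand[OF q V(1), of u v 1] uv(1) by simp
    then show "0 \<le> Re (- q w w)" using N(3)[rule_format, OF uv(2)] zero[of 0] csubspace_0[OF V(1)]
      by (cases "u = 0") auto
  qed
  moreover have "cdim N + cdim R = cdim {u + v | u v. u \<in> N \<and> v \<in> R}"
  proof -
    have "N \<inter> R = {0}" using NP RP csubspace_0 N(1) R by blast
    then show ?thesis
      using cdim_sum_Int[OF N(1) cfinite_dim_mono[OF V(2) N(2)] R cfinite_dim_mono[OF fP RP]] by simp
  qed
  ultimately show ?thesis using N(4) P(4) C(4) unfolding R_def by linarith
qed

text \<open>The product of the maximal negative subspaces is negative, the product of their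
  nonnegative complements is nonnegative, and the two dimensions exhaust the product space.\<close>

lemma n_minus_Times:
  assumes V: "csubspace V" "cfinite_dim V" and W: "csubspace W" "cfinite_dim W"
    and q: "hermitian_on V q" and q': "hermitian_on W q'"
    and Q: "\<And>v w. v \<in> V \<Longrightarrow> w \<in> W \<Longrightarrow> Re (Q (v, w) (v, w)) = Re (q v v) + Re (q' w w)"
  shows "n_minus (V \<times> W) Q = n_minus V q + n_minus W q'"
proof -
  obtain N P where N: "csubspace N" "N \<subseteq> V" "\<forall>u\<in>N. u \<noteq> 0 \<longrightarrow> Re (q u u) < 0" "cdim N = n_minus V q"
    and P: "csubspace P" "P \<subseteq> V" "\<forall>u\<in>P. 0 \<le> Re (q u u)" "cdim N + cdim P = cdim V"
    by (rule n_minus_decomposition[OF V q]) (rule that; assumption)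
  obtain N' P' where N': "csubspace N'" "N' \<subseteq> W" "\<forall>u\<in>N'. u \<noteq> 0 \<longrightarrow> Re (q' u u) < 0" "cdim N' = n_minus W q'"
    and P': "csubspace P'" "P' \<subseteq> W" "\<forall>u\<in>P'. 0 \<le> Re (q' u u)" "cdim N' + cdim P' = cdim W"
    by (rule n_minus_decomposition[OF W q']) (rule that; assumption)
  note VW = csubspace_Times[OF V(1) W(1)] cfinite_dim_Times[OF V(2) W(2)]
  have fin: "cfinite_dim N" "cfinite_dim N'" "cfinite_dim P" "cfinite_dim P'"
    using cfinite_dim_mono V(2) W(2) N(2) N'(2) P(2) P'(2) by blast+
  have z: "q 0 0 = 0" "q' 0 0 = 0"
    using clinear_on_0[OF hermitian_on_clinear[OF q] V(1)] clinear_on_0[OF hermitian_on_clinear[OF q'] W(1)]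
      csubspace_0 V(1) W(1) by blast+
  have "cdim (N \<times> N') \<le> n_minus (V \<times> W) Q"
  proof (rule n_minus_ge[OF VW csubspace_Times[OF N(1) N'(1)]])
    fix x assume x: "x \<in> N \<times> N'" "x \<noteq> 0"
    then obtain v w where vw: "x = (v, w)" "v \<in> N" "w \<in> N'" by blast
    have "Re (q v v) \<le> 0" "v \<noteq> 0 \<Longrightarrow> Re (q v v) < 0" "Re (q' w w) \<le> 0" "w \<noteq> 0 \<Longrightarrow> Re (q' w w) < 0"
      using N(3) N'(3) vw(2,3) z by (cases "v = 0"; cases "w = 0"; force)+
    moreover have "v \<noteq> 0 \<or> w \<noteq> 0" using x vw by (auto simp: zero_prod_def)
    ultimately show "Re (Q x x) < 0" using Q[of v w] vw N(2) N'(2) by fastforce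
  qed (use N N' in auto)
  moreover have "n_minus (V \<times> W) Q + cdim (P \<times> P') \<le> cdim (V \<times> W)"
  proof (rule n_minus_le[OF VW csubspace_Times[OF P(1) P'(1)]])
    fix x assume "x \<in> P \<times> P'"
    then obtain v w where vw: "x = (v, w)" "v \<in> P" "w \<in> P'" by blast
    then show "0 \<le> Re (Q x x)" using Q[of v w] P(2,3) P'(2,3) by fastforce
  qed (use P P' in auto)
  ultimately show ?thesis
    using N(1,4) P(1,4) N'(1,4) P'(1,4) fin V W by (simp add: cdim_Times)
qed

subsection \<open>Lagrangian planes\<close>

lemma cinner_add_left: "cinner (x + y) (z::'a::complex_inner) = cinner x z + cinner y z"
  using cinner_commute[of "x + y" z] cinner_commute[of x z] cinner_commute[of y z]
  by (simp add: cinner_add_right)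

lemma cinner_scaleC_left: "cinner (c *\<^sub>C x) (z::'a::complex_inner) = cnj c * cinner x z"
  using cinner_commute[of "c *\<^sub>C x" z] cinner_commute[of x z] by (simp add: cinner_scaleC_right)

lemma cinner_zero_right [simp]: "cinner (x::'a::complex_inner) 0 = 0"
  using cinner_add_right[of x 0 0] by simp

lemma cinner_zero_left [simp]: "cinner 0 (x::'a::complex_inner) = 0"
  using cinner_add_left[of 0 0 x] by simp

lemma cinner_minus_right [simp]: "cinner (x::'a::complex_inner) (- y) = - cinner x y"
  using cinner_scaleC_right[of x "-1" y] by (simp add: scaleC_minus1)

lemma cinner_minus_left [simp]: "cinner (- (x::'a::complex_inner)) y = - cinner x y"
  using cinner_scaleC_left[of "-1" x y] by (simp add: scaleC_minus1)

lemma cinner_diff_right: "cinner (x::'a::complex_inner) (y - z) = cinner x y - cinner x z"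
  using cinner_add_right[of x y "- z"] by simp

lemma cinner_diff_left: "cinner (x - y) (z::'a::complex_inner) = cinner x z - cinner y z"
  using cinner_add_left[of x "- y" z] by simp

lemma cinner_self_eq_0 [simp]: "cinner (x::'a::complex_inner) x = 0 \<longleftrightarrow> x = 0"
  by (simp add: cinner_self)

lemma cinner_eq_0_sym: "cinner (x::'a::complex_inner) y = 0 \<longleftrightarrow> cinner y x = 0"
  using cinner_commute[of x y] by simp

lemma clinear_on_cinner: "clinear_on V (cinner (x::'a::complex_inner))"
  by (rule clinear_onI) (simp_all add: cinner_add_right cinner_scaleC_right scaleC_complex_def)

lemma hermitian_on_cinner: "hermitian_on V (cinner :: 'a::complex_inner \<Rightarrow> 'a \<Rightarrow> complex)"
  by (rule hermitian_onI) (simp_all add: cinner_add_right cinner_scaleC_right flip: cinner_commute)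

lemma fst_scaleC [simp]: "fst (c *\<^sub>C u) = c *\<^sub>C fst u"
  and snd_scaleC [simp]: "snd (c *\<^sub>C u) = c *\<^sub>C snd u"
  and scaleC_Pair: "c *\<^sub>C (x, y) = (c *\<^sub>C x, c *\<^sub>C y)"
  by (simp_all add: scaleC_prod_def)

lemma omega_add_right: "omega u (v + w) = omega u v + omega u w"
  by (simp add: omega_def cinner_add_right)

lemma omega_add_left: "omega (u + v) w = omega u w + omega v w"
  by (simp add: omega_def cinner_add_left)

lemma omega_scale_right: "omega u (c *\<^sub>C v) = c * omega u v"
  by (simp add: omega_def scaleC_prod_def cinner_scaleC_right algebra_simps)

lemma omega_minus_right [simp]: "omega u (- v) = - omega u v"
  using omega_scale_right[of u "-1" v] by (simp add: scaleC_minus1)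

lemma omega_commute: "omega u v = - cnj (omega v u)"
  unfolding omega_def using cinner_commute[of "fst u" "snd v"] cinner_commute[of "snd u" "fst v"] by simp

lemma omega_minus_left [simp]: "omega (- u) v = - omega u v"
  using omega_commute[of "- u" v] omega_commute[of u v] by simp

lemma omega_diff_right: "omega u (v - w) = omega u v - omega u w"
  using omega_add_right[of u v "- w"] by simp

lemma omega_diff_left: "omega (u - v) w = omega u w - omega v w"
  using omega_add_left[of u "- v" w] by simp

lemma omega_zero [simp]: "omega u 0 = 0" "omega 0 u = 0"
  by (simp_all add: omega_def)

lemma omega_eq_0_sym: "omega u v = 0 \<longleftrightarrow> omega v u = 0"
  using omega_commute[of u v] by simp

lemma omega_nondegenerate:
  assumes "\<And>v. omega u v = 0"
  shows "u = 0"
proof -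
  have "cinner (snd u) (snd u) = 0" using assms[of "(snd u, 0)"] by (simp add: omega_def)
  moreover have "cinner (fst u) (fst u) = 0" using assms[of "(0, fst u)"] by (simp add: omega_def)
  ultimately show ?thesis by (simp add: prod_eq_iff)
qed

lemma clinear_on_omega: "clinear_on V (omega u)"
  by (rule clinear_onI) (simp_all add: omega_add_right omega_scale_right scaleC_complex_def)

lemma lagrangian_subspace: "lagrangian L \<Longrightarrow> csubspace L"
  unfolding lagrangian_def by blast

lemma lagrangian_isotropic: "lagrangian L \<Longrightarrow> u \<in> L \<Longrightarrow> v \<in> L \<Longrightarrow> omega u v = 0"
  unfolding lagrangian_def by blast

lemma lagrangian_maximal: "lagrangian L \<Longrightarrow> (\<And>v. v \<in> L \<Longrightarrow> omega u v = 0) \<Longrightarrow> u \<in> L"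
  unfolding lagrangian_def by blast

lemma lagrangianI:
  assumes "csubspace L" "\<And>u v. u \<in> L \<Longrightarrow> v \<in> L \<Longrightarrow> omega u v = 0"
    and "\<And>u. (\<And>v. v \<in> L \<Longrightarrow> omega u v = 0) \<Longrightarrow> u \<in> L"
  shows "lagrangian L"
  unfolding lagrangian_def using assms by blast

lemma cfinite_dim_UNIV_prod:
  assumes "cfinite_dim (UNIV :: 'k::complex_vector set)"
  shows "cfinite_dim (V :: ('k \<times> 'k) set)"
  using cfinite_dim_Times[OF assms assms] by (rule cfinite_dim_mono) simp

lemma cdim_UNIV_prod:
  assumes "cfinite_dim (UNIV :: 'k::complex_vector set)"
  shows "cdim (UNIV :: ('k \<times> 'k) set) = 2 * cdim (UNIV :: 'k set)"
  using cdim_Times[OF csubspace_UNIV assms csubspace_UNIV assms] by simp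

text \<open>On the graph of multiplication by \<open>\<i>\<close> the value \<open>omega u u\<close>
  is \<open>2 \<i>\<close> times a squared norm, so an isotropic space meets this graph only in
  zero; this is the upper bound. For the lower bound, maximality of \<open>L\<close> makes it
  contain the common kernel of \<open>cdim L\<close> functionals on a space of twice the
  dimension.\<close>

lemma cdim_lagrangian:
  fixes L :: "('k::complex_inner \<times> 'k) set"
  assumes fin: "cfinite_dim (UNIV :: 'k set)" and L: "lagrangian L"
  shows "cdim L = cdim (UNIV :: 'k set)"
proof (rule antisym)
  note f2 = cfinite_dim_UNIV_prod[OF fin]
  let ?g = "\<lambda>x::'k. (x, \<i> *\<^sub>C x)"
  have g: "clinear_on UNIV ?g"
    by (rule clinear_onI) (simp_all add: scaleC_prod_def scaleC_add_right scaleC_scaleC mult.commute)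
  have "x = 0" if "?g x \<in> L" for x
  proof -
    have "\<i> * cinner x x + \<i> * cinner x x = 0"
      using lagrangian_isotropic[OF L that that]
      by (simp add: omega_def cinner_scaleC_left cinner_scaleC_right)
    then show ?thesis by (simp flip: mult_2)
  qed
  moreover have dim: "cdim (range ?g) = cdim (UNIV :: 'k set)"
    by (rule cdim_inj_image[OF _ fin g]) (auto simp: zero_prod_def)
  ultimately have "x = 0" if "x \<in> L" "x \<in> range ?g" for x
    using that by (auto simp: zero_prod_def)
  then have "cdim L + cdim (range ?g) \<le> cdim (UNIV :: ('k \<times> 'k) set)"
    by (intro cdim_disjoint_le f2 lagrangian_subspace[OF L] csubspace_image[OF _ g]) auto
  then show "cdim L \<le> cdim (UNIV :: 'k set)"
    using dim cdim_UNIV_prod[OF fin] by simp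
  obtain B where B: "B \<subseteq> L" "finite B" "L \<subseteq> cspan B" "card B = cdim L"
    using cfinite_dim_basis[OF f2[of L]] by metis
  have "{x \<in> UNIV. \<forall>b\<in>B. omega b x = 0} \<subseteq> L"
  proof clarify
    fix u1 u2 assume *: "\<forall>b\<in>B. omega b (u1, u2) = 0"
    have "omega (u1, u2) b = 0" if "b \<in> B" for b
      using * that omega_eq_0_sym[of b "(u1, u2)"] by simp
    then have "B \<subseteq> {v \<in> UNIV. omega (u1, u2) v = 0}" by blast
    then have "cspan B \<subseteq> {v \<in> UNIV. omega (u1, u2) v = 0}"
      by (intro cspan_minimal csubspace_kernel clinear_on_omega) auto
    then show "(u1, u2) \<in> L" using B(3) by (intro lagrangian_maximal[OF L]) auto
  qed
  then have "cdim {x \<in> UNIV. \<forall>b\<in>B. omega b x = 0} \<le> cdim L"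
    by (rule cdim_mono[OF f2])
  then show "cdim (UNIV :: 'k set) \<le> cdim L"
    using conjunct2[OF cdim_functionals[OF B(2) csubspace_UNIV f2 clinear_on_omega, of "\<lambda>b. b"]]
      cdim_UNIV_prod[OF fin] B(4) by simp
qed

lemma independent_orthogonal:
  fixes B :: "'a::complex_inner set"
  assumes "\<And>x. x \<in> B \<Longrightarrow> x \<noteq> 0" "\<And>x y. x \<in> B \<Longrightarrow> y \<in> B \<Longrightarrow> x \<noteq> y \<Longrightarrow> cinner x y = 0"
  shows "cindependent B"
  unfolding complex_vector.dependent_def
proof clarify
  fix a assume a: "a \<in> B" "a \<in> cspan (B - {a})"
  have "B - {a} \<subseteq> {v \<in> UNIV. cinner a v = 0}" using assms(2)[OF a(1)] by auto
  then have "cspan (B - {a}) \<subseteq> {v \<in> UNIV. cinner a v = 0}"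
    by (intro cspan_minimal csubspace_kernel clinear_on_cinner) auto
  then show False using a assms(1) by force
qed

lemma lagrangian_scalar_graph:
  "lagrangian (range (\<lambda>x::'k::complex_inner. (x, complex_of_real t *\<^sub>C x)))" (is "lagrangian ?G")
proof (rule lagrangianI)
  show "csubspace ?G"
    by (intro csubspace_image clinear_onI)
      (simp_all add: scaleC_prod_def scaleC_add_right scaleC_scaleC mult.commute)
  show "omega u v = 0" if "u \<in> ?G" "v \<in> ?G" for u v
    using that by (auto simp: omega_def cinner_scaleC_left cinner_scaleC_right)
  show "u \<in> ?G" if u: "\<And>v. v \<in> ?G \<Longrightarrow> omega u v = 0" for u
  proof -
    \<comment> \<open>Pairing \<open>u\<close> with the graph vector over \<open>?d\<close> gives
      exactly \<open>cinner ?d ?d\<close>.\<close>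
    let ?d = "complex_of_real t *\<^sub>C fst u - snd u"
    have "omega u (?d, complex_of_real t *\<^sub>C ?d) = 0" by (rule u) blast
    then have "cinner ?d ?d = 0"
      by (simp add: omega_def cinner_diff_left cinner_scaleC_left cinner_scaleC_right)
    then show ?thesis by (cases u) auto
  qed
qed

text \<open>Vectors in which a Lagrangian plane meets the graphs of two different real multiples of the
  identity have orthogonal first components, so it meets only finitely many of these graphs.\<close>

lemma lagrangian_common_transversal:
  fixes \<A> :: "('k::complex_inner \<times> 'k) set set"
  assumes fin: "cfinite_dim (UNIV :: 'k set)" and \<A>: "finite \<A>" "\<And>A. A \<in> \<A> \<Longrightarrow> lagrangian A"
  obtains L where "lagrangian L" "\<And>A. A \<in> \<A> \<Longrightarrow> L \<inter> A = {0}"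
proof -
  define bad where "bad A = {t. \<exists>x\<noteq>0. (x, complex_of_real t *\<^sub>C x) \<in> A}" for A :: "('k \<times> 'k) set"
  have "finite (bad A)" if "A \<in> \<A>" for A
  proof -
    note A = \<A>(2)[OF that]
    obtain x where x: "\<And>t. t \<in> bad A \<Longrightarrow> x t \<noteq> 0 \<and> (x t, complex_of_real t *\<^sub>C x t) \<in> A"
      using bchoice[of "bad A" "\<lambda>t x. x \<noteq> 0 \<and> (x, complex_of_real t *\<^sub>C x) \<in> A"]
      unfolding bad_def by blast
    have orth: "cinner (x s) (x t) = 0" if "s \<in> bad A" "t \<in> bad A" "s \<noteq> t" for s t
    proof -
      have "(complex_of_real t - complex_of_real s) * cinner (x s) (x t) = 0"
        using lagrangian_isotropic[OF A conjunct2[OF x[OF that(1)]] conjunct2[OF x[OF that(2)]]]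
        by (simp add: omega_def cinner_scaleC_left cinner_scaleC_right algebra_simps)
      then show ?thesis using that(3) by simp
    qed
    have "inj_on x (bad A)"
    proof (rule inj_onI, rule ccontr)
      fix s t assume st: "s \<in> bad A" "t \<in> bad A" "x s = x t" "s \<noteq> t"
      then have "cinner (x s) (x s) = 0" using orth[of s t] by simp
      then show False using x[OF st(1)] by simp
    qed
    moreover have "finite (x ` bad A)"
    proof -
      obtain T where T: "finite T" "(UNIV :: 'k set) \<subseteq> cspan T" using fin unfolding cfinite_dim_def by blast
      have "cindependent (x ` bad A)"
        using x orth by (intro independent_orthogonal) auto
      then show ?thesis using complex_vector.independent_span_bound[OF T(1)] T(2) by blast
    qed
    ultimately show ?thesis using finite_imageD by blast
  qed
  then have "finite (\<Union>A\<in>\<A>. bad A)" using \<A>(1) by blast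
  then obtain t where "t \<notin> (\<Union>A\<in>\<A>. bad A)"
    using ex_new_if_finite[OF infinite_UNIV_char_0[where 'a = real]] by blast
  then have t: "t \<notin> bad A" if "A \<in> \<A>" for A using that by blast
  show ?thesis
  proof (rule that[OF lagrangian_scalar_graph[of t]])
    fix A assume A: "A \<in> \<A>"
    have "0 \<in> A" by (rule csubspace_0[OF lagrangian_subspace[OF \<A>(2)[OF A]]])
    moreover have "(0::'k \<times> 'k) \<in> range (\<lambda>x. (x, complex_of_real t *\<^sub>C x))"
      by (rule csubspace_0[OF lagrangian_subspace[OF lagrangian_scalar_graph]])
    moreover have "u = 0" if "u \<in> range (\<lambda>x::'k. (x, complex_of_real t *\<^sub>C x))" "u \<in> A" for u
      using that t[OF A] unfolding bad_def by (auto simp: zero_prod_def)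
    ultimately show "range (\<lambda>x::'k. (x, complex_of_real t *\<^sub>C x)) \<inter> A = {0}" by blast
  qed
qed

lemma hermitian_on_Times:
  assumes q: "hermitian_on V q" and q': "hermitian_on W q'"
  shows "hermitian_on (V \<times> W) (\<lambda>x y. q (fst x) (fst y) + q' (snd x) (snd y))"
proof (rule hermitian_onI)
  fix x y assume "x \<in> V \<times> W" "y \<in> V \<times> W"
  then have xy: "fst x \<in> V" "snd x \<in> W" "fst y \<in> V" "snd y \<in> W" by auto
  show "q (fst x) (fst y) + q' (snd x) (snd y) = cnj (q (fst y) (fst x) + q' (snd y) (snd x))"
    using hermitian_on_commute[OF q xy(1,3)] hermitian_on_commute[OF q' xy(2,4)] by simp
  show "q (fst x) (fst (c *\<^sub>C y)) + q' (snd x) (snd (c *\<^sub>C y)) = c * (q (fst x) (fst y) + q' (snd x) (snd y))" for c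
    using hermitian_on_scale[OF q xy(1,3)] hermitian_on_scale[OF q' xy(2,4)] by (simp add: algebra_simps)
  fix z assume "z \<in> V \<times> W"
  then have z: "fst z \<in> V" "snd z \<in> W" by auto
  show "q (fst x) (fst (y + z)) + q' (snd x) (snd (y + z))
      = q (fst x) (fst y) + q' (snd x) (snd y) + (q (fst x) (fst z) + q' (snd x) (snd z))"
    using hermitian_on_add[OF q xy(1,3) z(1)] hermitian_on_add[OF q' xy(2,4) z(2)] by simp
qed

section \<open>Pairwise forms of planes transversal to a fixed Lagrangian plane\<close>

locale lagrangian_reference =
  fixes L :: "('k::complex_inner \<times> 'k) set"
  assumes fin: "cfinite_dim (UNIV :: 'k set)" and L: "lagrangian L"
begin

definition transversal :: "('k \<times> 'k) set \<Rightarrow> bool"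
  where "transversal A \<longleftrightarrow> lagrangian A \<and> L \<inter> A = {0}"

definition proj :: "('k \<times> 'k) set \<Rightarrow> 'k \<times> 'k \<Rightarrow> 'k \<times> 'k"
  where "proj A u = (THE v. v \<in> A \<and> u - v \<in> L)"

lemma fin2: "cfinite_dim (V :: ('k \<times> 'k) set)"
  by (rule cfinite_dim_UNIV_prod[OF fin])

lemma transversalD: "transversal A \<Longrightarrow> lagrangian A" "transversal A \<Longrightarrow> csubspace A"
  unfolding transversal_def lagrangian_def by blast+

lemma transversal_cdim: "transversal A \<Longrightarrow> cdim A = cdim (UNIV :: 'k set)"
  using transversalD cdim_lagrangian[OF fin] by blast

lemma transversal_inter: "transversal A \<Longrightarrow> u \<in> A \<Longrightarrow> u \<in> L \<Longrightarrow> u = 0"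
  unfolding transversal_def by blast

lemma proj_ex:
  assumes A: "transversal A"
  obtains v where "v \<in> A" "u - v \<in> L"
proof -
  have "cdim (UNIV :: ('k \<times> 'k) set) \<le> cdim A + cdim L"
    using transversal_cdim[OF A] cdim_lagrangian[OF fin L] cdim_UNIV_prod[OF fin] by simp
  then obtain v w where "v \<in> A" "w \<in> L" "u = v + w"
    using cdim_direct_sum_decomp[OF fin2 csubspace_UNIV transversalD(2)[OF A]
        lagrangian_subspace[OF L] subset_UNIV subset_UNIV transversal_inter[OF A] _ UNIV_I, of u] by metis
  then show ?thesis using that[of v] by simp
qed

lemma proj_unique:
  assumes A: "transversal A" and v: "v \<in> A" "u - v \<in> L"
  shows "proj A u = v"
  unfolding proj_def
proof (rule the_equality)
  fix w assume w: "w \<in> A \<and> u - w \<in> L"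
  have "w - v \<in> A"
    by (rule csubspace_diff[OF transversalD(2)[OF A] conjunct1[OF w] v(1)])
  moreover have "(u - v) - (u - w) \<in> L"
    by (rule csubspace_diff[OF lagrangian_subspace[OF L] v(2) conjunct2[OF w]])
  ultimately show "w = v" using transversal_inter[OF A, of "w - v"] by simp
qed (use v in simp)

lemma proj_in: "transversal A \<Longrightarrow> proj A u \<in> A" and proj_diff: "transversal A \<Longrightarrow> u - proj A u \<in> L"
  using proj_ex[of A u] proj_unique[of A _ u] by metis+

lemma proj_eqI: "transversal A \<Longrightarrow> u - u' \<in> L \<Longrightarrow> proj A u = proj A u'"
proof -
  assume A: "transversal A" and u: "u - u' \<in> L"
  have "(u - u') + (u' - proj A u') \<in> L"
    by (intro csubspace_add[OF lagrangian_subspace[OF L]] u proj_diff A)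
  then show ?thesis using proj_unique[OF A proj_in[OF A]] by simp
qed

lemma proj_id: "transversal A \<Longrightarrow> u \<in> A \<Longrightarrow> proj A u = u"
  using proj_unique[of A u u] csubspace_0[OF lagrangian_subspace[OF L]] by simp

lemma proj_proj: "transversal A \<Longrightarrow> transversal B \<Longrightarrow> proj B (proj A u) = proj B u"
  using proj_eqI[of B u "proj A u"] proj_diff[of A u] by simp

lemma clinear_on_proj:
  assumes A: "transversal A"
  shows "clinear_on V (proj A)"
proof (rule clinear_onI)
  note sA = transversalD(2)[OF A] and sL = lagrangian_subspace[OF L]
  fix x y c
  have "(x - proj A x) + (y - proj A y) \<in> L"
    by (intro csubspace_add[OF sL] proj_diff A)
  then show "proj A (x + y) = proj A x + proj A y"
    by (intro proj_unique[OF A] csubspace_add[OF sA] proj_in A)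
      (simp add: algebra_simps)
  have "c *\<^sub>C (x - proj A x) \<in> L" by (intro csubspace_scale[OF sL] proj_diff A)
  then show "proj A (c *\<^sub>C x) = c *\<^sub>C proj A x"
    by (intro proj_unique[OF A] csubspace_scale[OF sA] proj_in A)
      (simp add: scaleC_diff_right)
qed

text \<open>This is \<open>Q_form A L B\<close> moved from \<open>A\<close> to the whole space.
  Since \<open>proj\<close> depends only on the class modulo \<open>L\<close>, the forms of all
  pairs of planes live on one space and can be added.\<close>

definition mform :: "('k \<times> 'k) set \<Rightarrow> ('k \<times> 'k) set \<Rightarrow> 'k \<times> 'k \<Rightarrow> 'k \<times> 'k \<Rightarrow> complex"
  where "mform A B u v = omega (proj A u) (proj B v)"

lemma proj_diff_in: "transversal A \<Longrightarrow> transversal B \<Longrightarrow> proj A u - proj B u \<in> L"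
  using csubspace_diff[OF lagrangian_subspace[OF L] proj_diff[of B u] proj_diff[of A u]]
  by simp

lemma mform_self: "transversal A \<Longrightarrow> mform A A u v = 0"
  unfolding mform_def by (rule lagrangian_isotropic[OF transversalD(1) proj_in proj_in])

text \<open>Differences of projections lie in the isotropic plane \<open>L\<close>; expanding the
  vanishing product of two such differences gives the chain rule, because \<open>B\<close> is
  isotropic too.\<close>

lemma mform_add:
  assumes "transversal A" "transversal B" "transversal C"
  shows "mform A B u v + mform B C u v = mform A C u v"
proof -
  have "omega (proj A u - proj B u) (proj B v - proj C v) = 0"
    by (intro lagrangian_isotropic[OF L] proj_diff_in assms)
  moreover have "omega (proj B u) (proj B v) = 0"
    using mform_self[OF assms(2)] unfolding mform_def .
  ultimately show ?thesis unfolding mform_def by (simp add: omega_diff_left omega_diff_right)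
qed

lemma mform_swap: "transversal A \<Longrightarrow> transversal B \<Longrightarrow> mform B A u v = - mform A B u v"
  using mform_add[of A B A u v] mform_self[of A u v] by (simp add: add_eq_0_iff)

lemma mform_commute:
  assumes "transversal A" "transversal B"
  shows "mform A B u v = cnj (mform A B v u)"
  using mform_swap[OF assms, of u v] omega_commute[of "proj B u" "proj A v"] unfolding mform_def by simp

lemma hermitian_on_mform:
  assumes "transversal A" "transversal B"
  shows "hermitian_on V (mform A B)"
proof (rule hermitian_onI)
  show "mform A B x y = cnj (mform A B y x)" for x y by (rule mform_commute[OF assms])
qed (simp_all add: mform_def clinear_on_add[OF clinear_on_proj[OF assms(2)], of _ UNIV]
    clinear_on_scale[OF clinear_on_proj[OF assms(2)], of _ UNIV] omega_add_right omega_scale_right)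

definition pair_index :: "('k \<times> 'k) set \<Rightarrow> ('k \<times> 'k) set \<Rightarrow> nat"
  where "pair_index A B = n_minus A (mform A B)"

lemma n_minus_Q_form:
  assumes A: "transversal A" and B: "transversal B"
  shows "n_minus A (Q_form A L B) = pair_index A B"
  unfolding pair_index_def
proof (rule n_minus_cong)
  fix u assume u: "u \<in> A"
  have "graph_map A L B u = proj B u - u"
    unfolding graph_map_def
  proof (rule the_equality)
    show "u \<in> A \<and> proj B u - u \<in> L \<and> u + (proj B u - u) \<in> B"
      using u proj_in[OF B] csubspace_neg[OF lagrangian_subspace[OF L] proj_diff[OF B, of u]] by simp
    fix v assume v: "u \<in> A \<and> v \<in> L \<and> u + v \<in> B"
    then have "proj B u = u + v"
      using csubspace_neg[OF lagrangian_subspace[OF L], of v] by (intro proj_unique[OF B]) auto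
    then show "v = proj B u - u" by simp
  qed
  then show "Re (Q_form A L B u u) = Re (mform A B u u)"
    using lagrangian_isotropic[OF transversalD(1)[OF A] u u]
    unfolding Q_form_def mform_def by (simp add: omega_diff_right proj_id[OF A u])
qed

text \<open>Every plane transversal to \<open>L\<close> represents the same quotient by
  \<open>L\<close>, so the index can be computed on any of them.\<close>

lemma pair_index_on:
  assumes A: "transversal A" and B: "transversal B" and C: "transversal C"
  shows "n_minus C (mform A B) = pair_index A B"
proof -
  have "proj A ` C = A"
  proof
    show "A \<subseteq> proj A ` C"
    proof
      fix a assume "a \<in> A"
      then have "a = proj A (proj C a)" using proj_proj[OF C A] proj_id[OF A] by simp
      then show "a \<in> proj A ` C" using proj_in[OF C] by blast
    qed
  qed (use proj_in[OF A] in auto)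
  moreover have "n_minus (proj A ` C) (mform A B) = n_minus C (mform A B)"
  proof (rule n_minus_image[OF transversalD(2)[OF C] fin2 clinear_on_proj[OF A]])
    show "x = 0" if "x \<in> C" "proj A x = 0" for x
      using that transversal_inter[OF C, of x] proj_diff[OF A, of x] by simp
    show "Re (mform A B (proj A u) (proj A u)) = Re (mform A B u u)" for u
      unfolding mform_def using proj_proj[OF A A] proj_proj[OF A B] by simp
  qed
  ultimately show ?thesis unfolding pair_index_def by simp
qed

text \<open>The law of inertia for \<open>mform A B\<close> on \<open>A\<close>: exchanging the
  planes changes the sign of the form, and its radical is \<open>A \<inter> B\<close>.\<close>

lemma pair_index_sum:
  assumes A: "transversal A" and B: "transversal B"
  shows "pair_index A B + pair_index B A + cdim (A \<inter> B) = cdim (UNIV :: 'k set)"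
proof -
  have "pair_index B A = n_minus A (mform B A)" using pair_index_on[OF B A A] by simp
  also have "\<dots> = n_minus A (\<lambda>u v. - mform A B u v)"
    by (rule n_minus_cong) (simp add: mform_swap[OF A B])
  finally have "pair_index B A = n_minus A (\<lambda>u v. - mform A B u v)" .
  moreover have "{v \<in> A. \<forall>u\<in>A. mform A B u v = 0} = A \<inter> B"
  proof
    show "A \<inter> B \<subseteq> {v \<in> A. \<forall>u\<in>A. mform A B u v = 0}"
      using lagrangian_isotropic[OF transversalD(1)[OF A]] by (auto simp: mform_def proj_id[OF A] proj_id[OF B])
    show "{v \<in> A. \<forall>u\<in>A. mform A B u v = 0} \<subseteq> A \<inter> B"
    proof (intro subsetI, elim CollectE conjE)
      fix v assume v: "v \<in> A" "\<forall>u\<in>A. mform A B u v = 0"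
      \<comment> \<open>\<open>proj B v\<close> is symplectically orthogonal to \<open>A\<close>,
        hence in \<open>A\<close>; then \<open>v - proj B v\<close> lies in \<open>A\<close> and in
        \<open>L\<close> and vanishes.\<close>
      have "proj B v \<in> A"
        using v(2) omega_eq_0_sym[of "proj B v"]
        by (intro lagrangian_maximal[OF transversalD(1)[OF A]]) (auto simp: mform_def proj_id[OF A])
      then have "v - proj B v \<in> A" using v(1) csubspace_diff[OF transversalD(2)[OF A]] by blast
      then have "v - proj B v = 0" using transversal_inter[OF A] proj_diff[OF B] by blast
      then have "v = proj B v" by simp
      then show "v \<in> A \<inter> B" using v(1) proj_in[OF B, of v] by simp
    qed
  qed
  ultimately show ?thesis
    using sylvester[OF transversalD(2)[OF A] fin2 hermitian_on_mform[OF A B]] transversal_cdim[OF A]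
    unfolding pair_index_def by simp
qed

lemma duistermaat_via_eq:
  assumes "transversal A" "transversal B" "transversal C"
  shows "duistermaat_via L A B C = int (pair_index B C) - int (pair_index A C) + int (pair_index A B)"
  unfolding duistermaat_via_def using assms by (simp add: n_minus_Q_form)

end

text \<open>The Kashiwara form does not refer to a transversal plane, and over any transversal plane it
  splits into the three pairwise forms.\<close>

definition kashiwara :: "('k::complex_inner \<times> 'k) \<times> ('k \<times> 'k) \<times> ('k \<times> 'k) \<Rightarrow> complex"
  where "kashiwara x = (case x of (a, b, c) \<Rightarrow> omega a b + omega b c + omega c a)"

definition n_kashiwara ::
  "('k::complex_inner \<times> 'k) set \<Rightarrow> ('k \<times> 'k) set \<Rightarrow> ('k \<times> 'k) set \<Rightarrow> nat"
  where "n_kashiwara A B C = n_minus (A \<times> B \<times> C) (\<lambda>x _. kashiwara x)"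

context lagrangian_reference
begin

lemma n_kashiwara_eq:
  assumes A: "transversal A" and B: "transversal B" and C: "transversal C"
  shows "n_kashiwara A B C = pair_index A B + pair_index B C + pair_index C A"
proof -
  note sA = transversalD(2)[OF A] and sB = transversalD(2)[OF B] and sC = transversalD(2)[OF C]
  note pA = clinear_on_add[OF clinear_on_proj[OF A, of UNIV]] clinear_on_scale[OF clinear_on_proj[OF A, of UNIV]]
    and pB = clinear_on_add[OF clinear_on_proj[OF B, of UNIV]] clinear_on_scale[OF clinear_on_proj[OF B, of UNIV]]
    and pC = clinear_on_add[OF clinear_on_proj[OF C, of UNIV]] clinear_on_scale[OF clinear_on_proj[OF C, of UNIV]]
  \<comment> \<open>For \<open>x = (r, p, q)\<close> the new triple is
    \<open>(r + q, p + r, q + p)\<close> modulo \<open>L\<close>. In these variables the mixed terms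
    of the Kashiwara form have zero real part in total, and one diagonal term remains for each pair
    of planes.\<close>
  define f where "f x = (fst x + proj A (snd (snd x)), fst (snd x) + proj B (fst x), snd (snd x) + proj C (fst (snd x)))"
    for x
  let ?V = "A \<times> B \<times> C"
  have V: "csubspace ?V" "cfinite_dim ?V"
    using sA sB sC fin2 by (simp_all add: csubspace_Times cfinite_dim_Times)
  have f: "clinear_on ?V f"
    by (rule clinear_onI) (simp_all add: f_def scaleC_Pair pA pB pC scaleC_add_right)
  have fV: "f ` ?V \<subseteq> ?V"
    unfolding f_def using proj_in A B C sA sB sC by (auto intro!: csubspace_add)
  have inj: "x = 0" if x: "x \<in> ?V" "f x = 0" for x
  proof -
    obtain r p q where rpq: "x = (r, p, q)" "r \<in> A" "p \<in> B" "q \<in> C" using x(1) by auto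
    have e: "r + proj A q = 0" "p + proj B r = 0" "q + proj C p = 0"
      using x(2) rpq(1) unfolding f_def by (simp_all add: zero_prod_def)
    \<comment> \<open>Modulo \<open>L\<close> the equations say that \<open>r + q\<close>,
      \<open>p + r\<close> and \<open>q + p\<close> vanish, which gives
      \<open>2 r = 0\<close>.\<close>
    have "proj A (p + proj B r) + proj A r = 0 + proj A r" using e(2) clinear_on_0[OF clinear_on_proj[OF A, of UNIV]] by simp
    then have 1: "proj A p = - r"
      using pA(1)[of p "proj B r"] proj_proj[OF B A] proj_id[OF A rpq(2)] by (simp add: eq_neg_iff_add_eq_0)
    have "proj A (q + proj C p) = 0" using e(3) clinear_on_0[OF clinear_on_proj[OF A, of UNIV]] by simp
    then have "proj A q + proj A p = 0" using pA(1)[of q "proj C p"] proj_proj[OF C A] by simp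
    then have "r + r = 0" using 1 e(1) by (simp add: algebra_simps add_eq_0_iff)
    then have "(2::real) *\<^sub>R r = 0" by (simp add: scaleR_2)
    then have r: "r = 0" by simp
    then have "p = 0" using e(2) clinear_on_0[OF clinear_on_proj[OF B, of UNIV]] by simp
    moreover from this have "q = 0" using e(3) clinear_on_0[OF clinear_on_proj[OF C, of UNIV]] by simp
    ultimately show ?thesis using r rpq(1) by (simp add: zero_prod_def)
  qed
  have "f ` ?V = ?V"
    by (rule cdim_eq_imp_subset[OF V(2) csubspace_image[OF V(1) f] fV])
      (simp add: cdim_inj_image[OF V f inj])
  then have "n_kashiwara A B C = n_minus (f ` ?V) (\<lambda>x _. kashiwara x)"
    unfolding n_kashiwara_def by simp
  also have "\<dots> = n_minus ?V (\<lambda>x _. kashiwara (f x))"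
    by (rule n_minus_image[OF V f inj]) simp_all
  also have "\<dots> = n_minus A (mform A B) + n_minus (B \<times> C) (\<lambda>x y. mform B C (fst x) (fst y) + mform C A (snd x) (snd y))"
  proof (rule n_minus_Times[OF sA fin2 csubspace_Times[OF sB sC] cfinite_dim_Times[OF fin2 fin2]
        hermitian_on_mform[OF A B]])
    show "hermitian_on (B \<times> C) (\<lambda>x y. mform B C (fst x) (fst y) + mform C A (snd x) (snd y))"
      by (rule hermitian_on_Times[OF hermitian_on_mform[OF B C] hermitian_on_mform[OF C A]])
    fix r x assume r: "r \<in> A" and x: "x \<in> B \<times> C"
    define p q where "p = fst x" and "q = snd x"
    have pq: "p \<in> B" "q \<in> C" using x unfolding p_def q_def by auto
    have "f (r, x) = (proj A (q + r), proj B (r + p), proj C (p + q))"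
      unfolding f_def using r pq
      by (simp add: p_def[symmetric] q_def[symmetric] pA pB pC proj_id[OF A] proj_id[OF B] proj_id[OF C]
          add.commute)
    then have "kashiwara (f (r, x)) = mform A B (q + r) (r + p) + mform B C (r + p) (p + q)
        - (mform A B (p + q) (q + r) + mform B C (p + q) (q + r))"
      unfolding kashiwara_def mform_add[OF A B C] using mform_swap[OF A C, of "p + q" "q + r"]
      by (simp add: mform_def)
    also have "Re \<dots> = Re (mform A B r r) + (Re (mform B C p p) - Re (mform A B q q) - Re (mform B C q q))"
    proof -
      have c: "Re (mform A B u v) = Re (mform A B v u)" "Re (mform B C u v) = Re (mform B C v u)" for u v
        using mform_commute[OF A B, of u v] mform_commute[OF B C, of u v] by simp_all
      have e: "mform X Y (u + v) (u' + v') = mform X Y u u' + mform X Y u v' + mform X Y v u' + mform X Y v v'"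
        if "transversal X" "transversal Y" for X Y u v u' v'
        using clinear_on_add[OF clinear_on_proj[OF that(1), of UNIV], of u v]
          clinear_on_add[OF clinear_on_proj[OF that(2), of UNIV], of u' v']
        by (simp add: mform_def omega_add_left omega_add_right)
      show ?thesis
        unfolding e[OF A B] e[OF B C] using c[of p q] c[of q r] c[of r p] by simp
    qed
    also have "\<dots> = Re (mform A B r r) + (Re (mform B C p p) + Re (mform C A q q))"
      unfolding mform_swap[OF A C] mform_add[OF A B C, symmetric] by simp
    finally show "Re (kashiwara (f (r, x)))
        = Re (mform A B r r) + Re (mform B C (fst x) (fst x) + mform C A (snd x) (snd x))"
      unfolding p_def q_def by simp
  qed
  also have "\<dots> = pair_index A B + (pair_index B C + pair_index C A)"
    unfolding pair_index_def
    using n_minus_Times[OF sB fin2 sC fin2 hermitian_on_mform[OF B C] hermitian_on_mform[OF C A]]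
    by simp
  finally show ?thesis by simp
qed

end

text \<open>By \<open>pair_index_sum\<close>, the term \<open>- pair_index A C\<close> becomes
  \<open>pair_index C A\<close> up to dimensions. The sum is then cyclic, and \<open>L\<close> is
  gone from the right-hand side.\<close>

lemma (in lagrangian_reference) duistermaat_via_kashiwara:
  assumes "transversal A" "transversal B" "transversal C"
  shows "duistermaat_via L A B C
    = int (n_kashiwara A B C) - int (cdim (UNIV :: 'k set)) + int (cdim (A \<inter> C))"
proof -
  have "int (pair_index A C) + int (pair_index C A) + int (cdim (A \<inter> C)) = int (cdim (UNIV :: 'k set))"
    using pair_index_sum[OF assms(1,3)] by simp
  then show ?thesis using duistermaat_via_eq[OF assms] n_kashiwara_eq[OF assms] by simp
qed

text \<open>A common transversal exists, so the Hilbert choice in \<open>duistermaat\<close> returns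
  one, and by the previous formula any one gives the same value.\<close>

lemma duistermaat_kashiwara:
  fixes A B C :: "('k::complex_inner \<times> 'k) set"
  assumes fin: "cfinite_dim (UNIV :: 'k set)" and lag: "lagrangian A" "lagrangian B" "lagrangian C"
  shows "duistermaat A B C
    = int (n_kashiwara A B C) - int (cdim (UNIV :: 'k set)) + int (cdim (A \<inter> C))"
proof -
  let ?P = "\<lambda>L. lagrangian L \<and> L \<inter> A = {0} \<and> L \<inter> B = {0} \<and> L \<inter> C = {0}"
  obtain L0 where L0: "lagrangian L0" "\<And>X. X \<in> {A, B, C} \<Longrightarrow> L0 \<inter> X = {0}"
    using lagrangian_common_transversal[OF fin, of "{A, B, C}"] lag by blast
  then have "?P L0" by simp
  then have P: "?P (SOME L. ?P L)" by (rule someI)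
  interpret lagrangian_reference "SOME L. ?P L"
    using fin P by unfold_locales auto
  show ?thesis
    unfolding duistermaat_def using P lag by (intro duistermaat_via_kashiwara) (auto simp: transversal_def)
qed

text \<open>In pair indices over one transversal of all four planes, the two sides differ by
  exchanging \<open>pair_index B A1\<close> and \<open>pair_index B A2\<close> with their reversals,
  which costs the dimensions of the intersections with \<open>B\<close>. The right-hand side
  separates \<open>A1\<close> from \<open>A2\<close>, so each extension can be studied by
  itself.\<close>

lemma duistermaat_cocycle:
  fixes A1 A2 B C :: "('k::complex_inner \<times> 'k) set"
  assumes fin: "cfinite_dim (UNIV :: 'k set)"
    and lag: "lagrangian A1" "lagrangian A2" "lagrangian B" "lagrangian C"
  shows "duistermaat A1 A2 C - duistermaat A1 A2 B
    = (duistermaat B A2 C + int (cdim (A2 \<inter> B))) - (duistermaat B A1 C + int (cdim (A1 \<inter> B)))"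
proof -
  obtain L where L0: "lagrangian L" "\<And>X. X \<in> {A1, A2, B, C} \<Longrightarrow> L \<inter> X = {0}"
    using lagrangian_common_transversal[OF fin, of "{A1, A2, B, C}"] lag by blast
  interpret lagrangian_reference L using fin L0(1) by unfold_locales
  have transversal: "transversal A1" "transversal A2" "transversal B" "transversal C" using lag L0(2) unfolding transversal_def by auto
  have via: "duistermaat X Y Z = int (pair_index Y Z) - int (pair_index X Z) + int (pair_index X Y)"
    if "transversal X" "transversal Y" "transversal Z" for X Y Z
    using duistermaat_kashiwara[OF fin transversalD(1)[OF that(1)] transversalD(1)[OF that(2)] transversalD(1)[OF that(3)]]
      duistermaat_via_kashiwara[OF that] duistermaat_via_eq[OF that] by simp
  have "pair_index A1 B + pair_index B A1 + cdim (A1 \<inter> B) = pair_index A2 B + pair_index B A2 + cdim (A2 \<inter> B)"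
    using pair_index_sum[OF transversal(1,3)] pair_index_sum[OF transversal(2,3)] by simp
  then show ?thesis using transversal by (simp add: via)
qed

text \<open>The Kashiwara form of \<open>B\<close>, \<open>A\<close>, \<open>C\<close> splits into a hyperbolic form on \<open>B \<times> C\<close> and the form
  \<open>b + c \<mapsto> \<omega>(b, c)\<close> on \<open>A\<close>.\<close>

lemma duistermaat_transversal:
  fixes A B C U :: "('k::complex_inner \<times> 'k) set"
  assumes fin: "cfinite_dim (UNIV :: 'k set)" and lag: "lagrangian A" "lagrangian B" "lagrangian C"
    and BC: "B \<inter> C = {0}" and U: "csubspace U" "U \<subseteq> A"
    and neg: "\<And>b c. b \<in> B \<Longrightarrow> c \<in> C \<Longrightarrow> b + c \<in> A \<Longrightarrow> b + c \<notin> U \<Longrightarrow> Re (omega b c) < 0"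
    and nonneg: "\<And>b c. b \<in> B \<Longrightarrow> c \<in> C \<Longrightarrow> b + c \<in> U \<Longrightarrow> 0 \<le> Re (omega b c)"
  shows "duistermaat B A C = int (cdim (UNIV :: 'k set)) - int (cdim U)"
proof -
  \<comment> \<open>\<open>C\<close> itself is the reference plane, so \<open>proj B a\<close> and
    \<open>a - proj B a\<close> are the components of \<open>a\<close> in \<open>B\<close> and in
    \<open>C\<close>.\<close>
  interpret lagrangian_reference C using fin lag(3) by unfold_locales
  have B: "transversal B" unfolding transversal_def using lag(2) BC by blast
  note sA = lagrangian_subspace[OF lag(1)] and sB = lagrangian_subspace[OF lag(2)]
    and sC = lagrangian_subspace[OF lag(3)]
  note pB = clinear_on_add[OF clinear_on_proj[OF B, of UNIV]] clinear_on_scale[OF clinear_on_proj[OF B, of UNIV]]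
  define q where "q = (\<lambda>a a'. omega (proj B a) (a' - proj B a'))"
  \<comment> \<open>The Hermitian symmetrization of \<open>- omega b c\<close> on
    \<open>B \<times> C\<close>. The form \<open>q\<close> is already Hermitian because
    \<open>A\<close> is isotropic.\<close>
  define h where "h = (\<lambda>x y :: ('k \<times> 'k) \<times> ('k \<times> 'k). (omega (snd x) (fst y) - omega (fst x) (snd y)) / 2)"
  have iso: "omega (proj B u) (proj B v) = 0" "omega (u - proj B u) (v - proj B v) = 0" for u v
    using lagrangian_isotropic[OF lag(2) proj_in[OF B] proj_in[OF B]]
      lagrangian_isotropic[OF lag(3) proj_diff[OF B] proj_diff[OF B]] by simp_all
  have q: "hermitian_on A q"
  proof (rule hermitian_onI)
    fix x y assume xy: "x \<in> A" "y \<in> A"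
    have "omega (proj B x + (x - proj B x)) (proj B y + (y - proj B y)) = 0"
      using lagrangian_isotropic[OF lag(1) xy] by simp
    then have "omega (proj B x) (y - proj B y) = - omega (x - proj B x) (proj B y)"
      unfolding omega_add_left omega_add_right iso by (simp add: eq_neg_iff_add_eq_0 add.commute)
    then show "q x y = cnj (q y x)"
      unfolding q_def using omega_commute[of "x - proj B x" "proj B y"] by simp
  qed (simp_all add: q_def pB omega_add_right omega_diff_right omega_scale_right algebra_simps)
  have h: "hermitian_on (B \<times> C) h"
  proof (rule hermitian_onI)
    fix x y :: "('k \<times> 'k) \<times> ('k \<times> 'k)"
    show "h x y = cnj (h y x)"
      unfolding h_def using omega_commute[of "snd x" "fst y"] omega_commute[of "fst x" "snd y"] by simp
  qed (simp_all add: h_def omega_add_right omega_scale_right algebra_simps add_divide_distrib diff_divide_distrib)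
  have V: "csubspace (A \<times> (B \<times> C))" "cfinite_dim (A \<times> (B \<times> C))" and W: "csubspace (B \<times> C)" "cfinite_dim (B \<times> C)"
    using sA sB sC fin2 by (simp_all add: csubspace_Times cfinite_dim_Times)
  have dim: "cdim A = cdim (UNIV :: 'k set)" "cdim B = cdim (UNIV :: 'k set)" "cdim C = cdim (UNIV :: 'k set)"
    using lag by (simp_all add: cdim_lagrangian[OF fin])
  \<comment> \<open>Completing the square: shifting \<open>b\<close> and \<open>c\<close> by the
    components \<open>a1\<close>, \<open>a2\<close> of \<open>a\<close> cancels the mixed real parts
    and leaves \<open>omega a1 a2 - omega b c\<close>.\<close>
  define f where "f x = (fst (snd x) + proj B (fst x), fst x, snd (snd x) + (fst x - proj B (fst x)))"
    for x :: "('k \<times> 'k) \<times> ('k \<times> 'k) \<times> ('k \<times> 'k)"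
  have f: "clinear_on (A \<times> (B \<times> C)) f"
    by (rule clinear_onI)
      (simp_all add: f_def scaleC_Pair pB scaleC_add_right scaleC_diff_right)
  have inj: "x = 0" if x: "f x = 0" for x
  proof -
    have "fst (snd (f x)) = 0" "fst (f x) = 0" "snd (snd (f x)) = 0" using x by simp_all
    then have "fst x = 0" "fst (snd x) = 0" "snd (snd x) = 0"
      using clinear_on_0[OF clinear_on_proj[OF B, of UNIV]] unfolding f_def by simp_all
    then show ?thesis by (intro prod_eqI) simp_all
  qed
  have "f ` (A \<times> (B \<times> C)) = B \<times> A \<times> C"
  proof (rule cdim_eq_imp_subset)
    show "f ` (A \<times> (B \<times> C)) \<subseteq> B \<times> A \<times> C"
      unfolding f_def using proj_in[OF B] proj_diff[OF B] sB sC
      by (auto intro!: csubspace_add)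
    have "cdim (f ` (A \<times> (B \<times> C))) = cdim (A \<times> (B \<times> C))"
      using cdim_inj_image[OF V f] inj by blast
    then show "cdim (B \<times> A \<times> C) \<le> cdim (f ` (A \<times> (B \<times> C)))"
      using sA sB sC fin2 by (simp add: cdim_Times csubspace_Times cfinite_dim_Times)
  qed (use V f fin2 in \<open>simp_all add: csubspace_image cfinite_dim_Times\<close>)
  then have "n_kashiwara B A C = n_minus (f ` (A \<times> (B \<times> C))) (\<lambda>x _. kashiwara x)"
    unfolding n_kashiwara_def by simp
  also have "\<dots> = n_minus (A \<times> (B \<times> C)) (\<lambda>x _. kashiwara (f x))"
    by (rule n_minus_image[OF V f]) (use inj in auto)
  also have "\<dots> = n_minus A q + n_minus (B \<times> C) h"
  proof (rule n_minus_Times[OF sA fin2 W q h])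
    fix a x assume "a \<in> A" and x: "x \<in> B \<times> C"
    define b c where "b = fst x" and "c = snd x"
    have bc: "b \<in> B" "c \<in> C" using x unfolding b_def c_def by auto
    define a1 a2 where "a1 = proj B a" and "a2 = a - proj B a"
    have a: "a = a1 + a2" "a1 \<in> B" "a2 \<in> C"
      unfolding a1_def a2_def using proj_in[OF B] proj_diff[OF B] by auto
    have fx: "f (a, x) = (b + a1, a1 + a2, c + a2)"
      unfolding f_def b_def c_def a1_def a2_def by simp
    have z: "omega b a1 = 0" "omega a1 a1 = 0" "omega a2 c = 0" "omega a2 a2 = 0"
      using lagrangian_isotropic[OF lag(2) bc(1) a(2)] lagrangian_isotropic[OF lag(2) a(2) a(2)]
        lagrangian_isotropic[OF lag(3) a(3) bc(2)] lagrangian_isotropic[OF lag(3) a(3) a(3)] by simp_all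
    have r: "Re (omega u v) = - Re (omega v u)" for u v :: "'k \<times> 'k" using omega_commute[of u v] by simp
    have "Re (kashiwara (f (a, x))) = Re (omega a1 a2) - Re (omega b c)"
      unfolding fx kashiwara_def prod.case omega_add_left omega_add_right z
      using r[of c b] r[of c a1] r[of a2 b] r[of a2 a1] by simp
    also have "\<dots> = Re (q a a) + Re (h x x)"
      unfolding q_def h_def using r[of "snd x" "fst x"] by (simp add: a1_def a2_def b_def c_def)
    finally show "Re (kashiwara (f (a, x))) = Re (q a a) + Re (h x x)" .
  qed
  also have "n_minus (B \<times> C) h = cdim (UNIV :: 'k set)"
  proof -
    \<comment> \<open>The sign change on \<open>C\<close> turns \<open>h\<close> into
      \<open>- h\<close>, so the positive and negative indices agree; as \<open>h\<close> is
      nondegenerate, each is half the dimension of \<open>B \<times> C\<close>.\<close>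
    define g where "g x = (fst x, - snd x)" for x :: "('k \<times> 'k) \<times> ('k \<times> 'k)"
    have g: "clinear_on (B \<times> C) g"
      by (rule clinear_onI) (simp_all add: g_def scaleC_Pair)
    have "g ` (B \<times> C) = B \<times> C"
    proof
      show 1: "g ` (B \<times> C) \<subseteq> B \<times> C" unfolding g_def using csubspace_neg[OF sC] by auto
      show "B \<times> C \<subseteq> g ` (B \<times> C)"
      proof
        fix x assume "x \<in> B \<times> C"
        then have "g x \<in> B \<times> C" using 1 by blast
        moreover have "x = g (g x)" unfolding g_def by simp
        ultimately show "x \<in> g ` (B \<times> C)" by (rule image_eqI[rotated])
      qed
    qed
    moreover have "n_minus (g ` (B \<times> C)) (\<lambda>x y. - h x y) = n_minus (B \<times> C) h"
      by (rule n_minus_image[OF W g]) (simp_all add: g_def h_def prod_eq_iff field_simps)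
    ultimately have sym: "n_minus (B \<times> C) (\<lambda>x y. - h x y) = n_minus (B \<times> C) h" by simp
    have "{v \<in> B \<times> C. \<forall>u\<in>B \<times> C. h u v = 0} \<subseteq> {0}"
    proof (intro subsetI, elim CollectE conjE)
      fix v assume v: "v \<in> B \<times> C" "\<forall>u\<in>B \<times> C. h u v = 0"
      have 0: "0 \<in> B" "0 \<in> C" using sB sC csubspace_0 by blast+
      have vBC: "fst v \<in> B" "snd v \<in> C" using v(1) by auto
      have "snd v \<in> B"
      proof (rule lagrangian_maximal[OF lag(2)])
        fix b assume "b \<in> B"
        then have "h (b, 0) v = 0" using v(2) 0 by blast
        then show "omega (snd v) b = 0" unfolding h_def using omega_eq_0_sym[of b "snd v"] by simp
      qed
      moreover have "fst v \<in> C"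
      proof (rule lagrangian_maximal[OF lag(3)])
        fix c assume "c \<in> C"
        then have "h (0, c) v = 0" using v(2) 0 by blast
        then show "omega (fst v) c = 0" unfolding h_def using omega_eq_0_sym[of c "fst v"] by simp
      qed
      ultimately have "fst v \<in> B \<inter> C" "snd v \<in> B \<inter> C" using vBC by simp_all
      then have "fst v = 0" "snd v = 0" unfolding BC by simp_all
      then show "v \<in> {0}" by (simp add: prod_eq_iff)
    qed
    from cdim_mono[OF cfinite_dim_zero this]
    have "cdim {v \<in> B \<times> C. \<forall>u\<in>B \<times> C. h u v = 0} = 0" by (simp only: cdim_zero le_zero_eq)
    then show ?thesis
      using sylvester[OF W h] sym cdim_Times[OF sB fin2 sC fin2] dim by simp
  qed
  finally have n: "n_kashiwara B A C = n_minus A q + cdim (UNIV :: 'k set)" .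
  have "n_minus A q + cdim U = cdim A"
  proof (rule n_minus_semidefinite[OF sA fin2 U])
    fix a assume a: "a \<in> A" "a \<notin> U"
    show "Re (q a a) < 0"
      unfolding q_def using neg[OF proj_in[OF B] proj_diff[OF B], of a a] a by simp
  next
    fix a assume "a \<in> U"
    then show "0 \<le> Re (q a a)"
      unfolding q_def using nonneg[OF proj_in[OF B] proj_diff[OF B], of a a] by simp
  qed
  then show ?thesis
    using duistermaat_kashiwara[OF fin lag(2,1,3)] n dim(1) BC by simp
qed

subsection \<open>Hilbert spaces\<close>

lemma norm_sq_Re_cinner: "(norm (x::'a::complex_inner))\<^sup>2 = Re (cinner x x)"
  by (simp add: cinner_self flip: of_real_power)

lemma norm_scaleC: "norm (c *\<^sub>C (x::'a::complex_inner)) = cmod c * norm x"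
proof -
  have "complex_of_real ((norm (c *\<^sub>C x))\<^sup>2) = complex_of_real ((cmod c * norm x)\<^sup>2)"
    using complex_norm_square[of c]
    unfolding cinner_self[symmetric] cinner_scaleC_left cinner_scaleC_right power_mult_distrib
    by (simp add: cinner_self mult.commute)
  then have "(norm (c *\<^sub>C x))\<^sup>2 = (cmod c * norm x)\<^sup>2" by (simp only: of_real_eq_iff)
  then show ?thesis by (rule power2_eq_imp_eq) simp_all
qed

lemma cinner_cauchy_schwarz: "cmod (cinner x y) \<le> norm (x::'a::complex_inner) * norm y"
proof -
  have "(cmod (cinner x y))\<^sup>2 \<le> Re (cinner x x) * Re (cinner y y)"
    by (rule hermitian_on_cauchy_schwarz[OF hermitian_on_cinner csubspace_UNIV])
      (simp_all flip: norm_sq_Re_cinner)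
  then have "(cmod (cinner x y))\<^sup>2 \<le> (norm x * norm y)\<^sup>2"
    by (simp add: norm_sq_Re_cinner power_mult_distrib)
  then show ?thesis by (rule power2_le_imp_le) simp
qed

lemma bounded_bilinear_cinner: "bounded_bilinear (cinner :: 'a::complex_inner \<Rightarrow> 'a \<Rightarrow> complex)"
proof
  show "\<exists>K. \<forall>a b. cmod (cinner a b) \<le> norm a * norm (b::'a) * K"
    by (intro exI[of _ 1]) (simp add: cinner_cauchy_schwarz)
qed (simp_all add: cinner_add_left cinner_add_right cinner_scaleC_left cinner_scaleC_right
    scaleR_conv_of_real flip: scaleC_of_real)

lemmas tendsto_cinner = bounded_bilinear.tendsto[OF bounded_bilinear_cinner]

lemma norm_add_sq:
  "(norm (x + y :: 'a::complex_inner))\<^sup>2 = (norm x)\<^sup>2 + 2 * Re (cinner x y) + (norm y)\<^sup>2"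
  using hermitian_on_expand[OF hermitian_on_cinner csubspace_UNIV UNIV_I UNIV_I, of x 1 y]
  by (simp add: norm_sq_Re_cinner)

text \<open>A minimizing sequence of \<open>v \<mapsto> q(v, v) - 2 Re \<langle>w, v\<rangle>\<close> is Cauchy in the form norm by the
  parallelogram law, and it satisfies the Euler equation in the limit.\<close>

lemma coercive_form_minimization:
  fixes V :: "'h::complex_hilbert set"
  assumes V: "csubspace V" and q: "hermitian_on V q"
    and coercive: "\<And>v. v \<in> V \<Longrightarrow> (norm v)\<^sup>2 \<le> Re (q v v)"
  obtains u f where "\<forall>k. u k \<in> V" "u \<longlonglongrightarrow> f"
    "\<forall>e>0. \<exists>N. \<forall>j\<ge>N. \<forall>k\<ge>N. Re (q (u j - u k) (u j - u k)) < e"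
    "\<forall>v\<in>V. (\<lambda>k. q (u k) v) \<longlonglongrightarrow> cinner w v"
proof -
  define J where "J v = Re (q v v) - 2 * Re (cinner w v)" for v
  define m where "m = Inf (J ` V)"
  have "- (norm w)\<^sup>2 \<le> J v" if "v \<in> V" for v
  proof -
    have "0 \<le> (norm (v + (- w)))\<^sup>2" by simp
    also have "\<dots> = (norm v)\<^sup>2 - 2 * Re (cinner v w) + (norm w)\<^sup>2"
      unfolding norm_add_sq by simp
    finally show ?thesis
      using coercive[OF that] cinner_commute[of v w] unfolding J_def by simp
  qed
  then have bdd: "bdd_below (J ` V)" by (intro bdd_belowI2)
  have ne: "J ` V \<noteq> {}" using csubspace_0[OF V] by blast
  have mJ: "m \<le> J v" if "v \<in> V" for v
    unfolding m_def using bdd that by (intro cInf_lower) auto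
  define e where "e k = inverse (real (Suc k))" for k
  have e0: "0 < e k" for k unfolding e_def by simp
  have "\<exists>v\<in>V. J v < m + e k" for k
    using cInf_lessD[OF ne, of "m + e k"] e0[of k] unfolding m_def by auto
  then obtain u where u: "\<And>k. u k \<in> V" "\<And>k. J (u k) < m + e k" by metis
  have elim: "e \<longlonglongrightarrow> 0" unfolding e_def by (rule LIMSEQ_inverse_real_of_nat)
  have diffV: "x - y \<in> V" if "x \<in> V" "y \<in> V" for x y
    by (rule csubspace_diff[OF V that])
  have para: "Re (q (u j - u k) (u j - u k)) < 2 * e j + 2 * e k" for j k
  proof -
    define s where "s = u j + u k"
    have s: "s \<in> V" unfolding s_def by (intro csubspace_add[OF V] u(1))
    have h: "(1/2) *\<^sub>C s \<in> V" by (intro csubspace_scale[OF V] s)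
    have "Re (q (u j - u k) (u j - u k)) + Re (q s s) = 2 * Re (q (u j) (u j)) + 2 * Re (q (u k) (u k))"
      using hermitian_on_expand[OF q V u(1)[of j] u(1)[of k], of 1]
        hermitian_on_expand[OF q V u(1)[of j] u(1)[of k], of "-1"]
      unfolding s_def by (simp add: scaleC_minus1)
    moreover have "J ((1/2) *\<^sub>C s) = Re (q s s) / 4 - Re (cinner w (u j)) - Re (cinner w (u k))"
      unfolding J_def hermitian_on_scale[OF q h s] hermitian_on_scale_left[OF q V s s]
      by (simp add: cinner_scaleC_right s_def cinner_add_right add_divide_distrib)
    ultimately show ?thesis
      using mJ[OF h] u(2)[of j] u(2)[of k] unfolding J_def by simp
  qed
  have cauchy: "\<exists>N. \<forall>j\<ge>N. \<forall>k\<ge>N. Re (q (u j - u k) (u j - u k)) < d" if "0 < d" for d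
  proof -
    obtain N where N: "\<And>k. k \<ge> N \<Longrightarrow> e k < d / 4"
      using order_tendstoD(2)[OF elim, of "d / 4"] \<open>0 < d\<close> unfolding eventually_sequentially by auto
    have "Re (q (u j - u k) (u j - u k)) < d" if "j \<ge> N" "k \<ge> N" for j k
      using para[of j k] N[OF that(1)] N[OF that(2)] by simp
    then show ?thesis by blast
  qed
  have "Cauchy u"
  proof (rule metric_CauchyI)
    fix d :: real assume "0 < d"
    then obtain N where N: "\<forall>j\<ge>N. \<forall>k\<ge>N. Re (q (u j - u k) (u j - u k)) < d\<^sup>2"
      using cauchy[of "d\<^sup>2"] by auto
    have "dist (u j) (u k) < d" if "j \<ge> N" "k \<ge> N" for j k
    proof -
      have "(norm (u j - u k))\<^sup>2 < d\<^sup>2"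
        using N that coercive[OF diffV[OF u(1)[of j] u(1)[of k]]] by fastforce
      then show ?thesis unfolding dist_norm using \<open>0 < d\<close> by (intro power_less_imp_less_base[of _ 2 d]) simp_all
    qed
    then show "\<exists>N. \<forall>j\<ge>N. \<forall>k\<ge>N. dist (u j) (u k) < d" by blast
  qed
  then obtain f where f: "u \<longlonglongrightarrow> f" using convergent_eq_Cauchy by blast
  have euler: "(\<lambda>k. q (u k) v) \<longlonglongrightarrow> cinner w v" if v: "v \<in> V" for v
  proof -
    \<comment> \<open>The summand 1 keeps \<open>a\<close> positive when
      \<open>v = 0\<close>.\<close>
    define a where "a = Re (q v v) + 1"
    have a: "0 < a" "Re (q v v) \<le> a"
      using coercive[OF v] unfolding a_def by (simp_all add: add_nonneg_pos order_trans[OF zero_le_power2])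
    have bound: "(cmod (q (u k) v - cinner w v))\<^sup>2 \<le> e k * a" for k
    proof -
      define z where "z = q (u k) v - cinner w v"
      \<comment> \<open>Moving from \<open>u k\<close> by this multiple of \<open>v\<close> lowers
        \<open>J\<close> by at least \<open>(cmod z)^2 / a\<close>, while \<open>J (u k)\<close>
        exceeds the infimum by less than \<open>e k\<close>.\<close>
      define c where "c = - cnj z / complex_of_real a"
      have cv: "u k + c *\<^sub>C v \<in> V"
        by (intro csubspace_add[OF V] csubspace_scale[OF V] u v)
      have cz: "c * z = complex_of_real (- (cmod z)\<^sup>2 / a)"
        unfolding c_def using complex_norm_square[of z] by (simp add: mult.commute)
      have cc: "(cmod c)\<^sup>2 = (cmod z)\<^sup>2 / a\<^sup>2"
        unfolding c_def by (simp add: norm_divide power_divide)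
      have "J (u k + c *\<^sub>C v) = J (u k) + 2 * Re (c * z) + (cmod c)\<^sup>2 * Re (q v v)"
        unfolding J_def hermitian_on_expand[OF q V u(1) v] z_def
        by (simp add: cinner_add_right cinner_scaleC_right algebra_simps)
      moreover have "(cmod c)\<^sup>2 * Re (q v v) \<le> (cmod z)\<^sup>2 / a\<^sup>2 * a"
        unfolding cc using a by (intro mult_left_mono) simp_all
      moreover have "(cmod z)\<^sup>2 / a\<^sup>2 * a = (cmod z)\<^sup>2 / a" using a by (simp add: power2_eq_square)
      ultimately have "(cmod z)\<^sup>2 / a \<le> e k"
        using mJ[OF cv] u(2)[of k] unfolding cz by simp
      then show ?thesis using a unfolding z_def by (simp add: field_simps)
    qed
    have "(\<lambda>k. (cmod (q (u k) v - cinner w v))\<^sup>2) \<longlonglongrightarrow> 0"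
    proof (rule tendsto_sandwich[OF _ _ tendsto_const])
      show "(\<lambda>k. e k * a) \<longlonglongrightarrow> 0" using tendsto_mult_right[OF elim, of a] by simp
    qed (use bound in auto)
    then have "(\<lambda>k. sqrt ((cmod (q (u k) v - cinner w v))\<^sup>2)) \<longlonglongrightarrow> sqrt 0" by (rule tendsto_real_sqrt)
    then have "(\<lambda>k. q (u k) v - cinner w v) \<longlonglongrightarrow> 0" by (simp add: tendsto_norm_zero_iff)
    then show ?thesis by (simp add: LIM_zero_iff)
  qed
  show ?thesis by (rule that[OF _ f]) (use u(1) cauchy euler in simp_all)
qed

text \<open>The minimization above with the inner product as the form; closedness keeps the limit in
  \<open>R\<close>, and the Euler equation is orthogonality of \<open>x - r\<close>.\<close>

lemma closed_projection:
  fixes R :: "'h::complex_hilbert set"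
  assumes "csubspace R" "closed R"
  obtains r where "r \<in> R" "\<And>v. v \<in> R \<Longrightarrow> cinner (x - r) v = 0"
proof -
  obtain u f where u: "\<forall>k. u k \<in> R" "u \<longlonglongrightarrow> f" "\<forall>v\<in>R. (\<lambda>k. cinner (u k) v) \<longlonglongrightarrow> cinner x v"
    using coercive_form_minimization[OF assms(1) hermitian_on_cinner eq_refl[OF norm_sq_Re_cinner], of x]
    by metis
  have "f \<in> R" using closed_sequentially[OF assms(2) _ u(2)] u(1) by simp
  moreover have "cinner (x - f) v = 0" if "v \<in> R" for v
    using LIMSEQ_unique[OF u(3)[rule_format, OF that] tendsto_cinner[OF u(2) tendsto_const]]
    by (simp add: cinner_diff_left)
  ultimately show ?thesis by (rule that)
qed

text \<open>Gram-Schmidt by induction over a basis, which avoids any discussion of closedness of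
  finite-dimensional subspaces.\<close>

lemma finite_dim_projection:
  fixes U :: "'h::complex_inner set"
  assumes "csubspace U" "cfinite_dim U"
  obtains u where "u \<in> U" "\<And>v. v \<in> U \<Longrightarrow> cinner (x - u) v = 0"
proof -
  obtain B where B: "finite B" "cspan B = U"
    using cfinite_dim_span_basis[OF assms(2,1)] by metis
  have "\<exists>u\<in>cspan B. \<forall>v\<in>cspan B. cinner (x - u) v = 0" for x
    using B(1)
  proof (induction B arbitrary: x rule: finite_induct)
    case (insert b B)
    obtain b1 where b1: "b1 \<in> cspan B" "\<forall>v\<in>cspan B. cinner (b - b1) v = 0"
      using insert.IH[of b] by blast
    obtain u where u: "u \<in> cspan B" "\<forall>v\<in>cspan B. cinner (x - u) v = 0"
      using insert.IH[of x] by blast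
    define d where "d = b - b1"
    \<comment> \<open>If \<open>d = 0\<close>, division by zero gives \<open>t = 0\<close>, which is
      right because \<open>b\<close> then adds nothing to the span.\<close>
    define t where "t = cinner d (x - u) / cinner d d"
    have sub: "cspan B \<subseteq> cspan (insert b B)" by (rule cspan_mono) blast
    have d: "d \<in> cspan (insert b B)"
      unfolding d_def
      by (rule cspan_diff[OF cspan_base subsetD[OF sub b1(1)]]) simp
    have "cinner (x - (u + t *\<^sub>C d)) v = 0" if v: "v \<in> cspan (insert b B)" for v
    proof -
      obtain k where k: "v - k *\<^sub>C b \<in> cspan B"
        using v cspan_breakdown_eq by blast
      define y where "y = v - k *\<^sub>C b + k *\<^sub>C b1"
      have y: "y \<in> cspan B"
        unfolding y_def by (intro cspan_add k cspan_scale b1)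
      have v: "v = y + k *\<^sub>C d"
        unfolding y_def d_def by (simp add: scaleC_diff_right)
      have "cinner d (x - (u + t *\<^sub>C d)) = 0"
      proof (cases "d = 0")
        case False
        then show ?thesis unfolding t_def
          by (simp add: cinner_diff_right cinner_add_right cinner_scaleC_right)
      qed simp
      then have "cinner (x - (u + t *\<^sub>C d)) d = 0" using cinner_eq_0_sym by blast
      moreover have "cinner (x - (u + t *\<^sub>C d)) y = 0"
        using u(2) b1(2) y unfolding d_def[symmetric]
        by (simp add: cinner_diff_left cinner_add_left cinner_scaleC_left)
      ultimately show ?thesis unfolding v by (simp add: cinner_add_right cinner_scaleC_right)
    qed
    moreover have "u + t *\<^sub>C d \<in> cspan (insert b B)"
      using u(1) sub d by (intro cspan_add cspan_scale) auto
    ultimately show ?case by blast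
  qed simp
  then show ?thesis using that B(2) by blast
qed

text \<open>Uniform boundedness by a gliding hump.\<close>

lemma weakly_bounded_imp_bounded:
  fixes X :: "'h::complex_hilbert set"
  assumes weak: "\<And>g. \<exists>C. \<forall>h\<in>X. cmod (cinner h g) \<le> C"
  obtains C where "\<And>h. h \<in> X \<Longrightarrow> norm h \<le> C"
proof -
  have "\<exists>C. \<forall>h\<in>X. norm h \<le> C"
  proof (rule ccontr)
    assume "\<not> ?thesis"
    then have "\<exists>h\<in>X. 4 ^ k < norm h" for k :: nat by (meson not_le)
    then obtain h where h: "\<And>k. h k \<in> X" "\<And>k. 4 ^ k < norm (h k)" by metis
    \<comment> \<open>The hump \<open>r k * norm (h k)\<close> exceeds \<open>(4/3)^k\<close>, while
      all steps after the one that creates it move the point by at most \<open>r k / 2\<close> in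
      total and can destroy only half of the hump.\<close>
    define r where "r k = (1/3 :: real) ^ k" for k :: nat
    have r0: "0 < r k" for k unfolding r_def by simp
    have hpos: "0 < norm (h k)" for k using h(2)[of k] by (meson less_trans zero_less_numeral zero_less_power)
    \<comment> \<open>The values at \<open>x + d\<close> and \<open>x - d\<close> differ by
      \<open>2 * (r k * norm (h k))\<close>, so one of them is at least half as large.\<close>
    have step: "\<exists>y. norm (y - x) \<le> r k \<and> r k * norm (h k) \<le> cmod (cinner (h k) y)" for x k
    proof -
      define d where "d = complex_of_real (r k / norm (h k)) *\<^sub>C h k"
      have nd: "norm d \<le> r k" unfolding d_def norm_scaleC using r0[of k] hpos[of k] by (simp add: norm_divide)
      have "cinner (h k) d = complex_of_real (r k * norm (h k))"
        unfolding d_def cinner_scaleC_right cinner_self using hpos[of k]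
        by (simp add: power2_eq_square flip: of_real_mult of_real_divide)
      then have "cmod (cinner (h k) (x + d) - cinner (h k) (x - d)) = 2 * (r k * norm (h k))"
        using r0[of k] by (simp add: cinner_add_right cinner_diff_right norm_mult)
      then have "r k * norm (h k) \<le> cmod (cinner (h k) (x + d)) \<or> r k * norm (h k) \<le> cmod (cinner (h k) (x - d))"
        using norm_triangle_ineq4[of "cinner (h k) (x + d)" "cinner (h k) (x - d)"] by linarith
      then show ?thesis
      proof
        assume "r k * norm (h k) \<le> cmod (cinner (h k) (x + d))"
        then show ?thesis using nd by (intro exI[of _ "x + d"]) simp
      next
        assume "r k * norm (h k) \<le> cmod (cinner (h k) (x - d))"
        then show ?thesis using nd by (intro exI[of _ "x - d"]) simp
      qed
    qed
    define next' where "next' k x = (SOME y. norm (y - x) \<le> r k \<and> r k * norm (h k) \<le> cmod (cinner (h k) y))" for k x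
    define x where "x = rec_nat 0 next'"
    have xs: "norm (x (Suc k) - x k) \<le> r k" "r k * norm (h k) \<le> cmod (cinner (h k) (x (Suc k)))" for k
      using someI_ex[OF step[of "x k" k]] unfolding x_def next'_def by simp_all
    have tele: "norm (x (k + n) - x k) \<le> 3/2 * (r k - r (k + n))" for k n
    proof (induction n)
      case (Suc n)
      have "norm (x (k + Suc n) - x k) \<le> norm (x (Suc (k + n)) - x (k + n)) + norm (x (k + n) - x k)"
        using norm_triangle_ineq[of "x (Suc (k + n)) - x (k + n)" "x (k + n) - x k"] by simp
      also have "\<dots> \<le> r (k + n) + 3/2 * (r k - r (k + n))" by (rule add_mono[OF xs(1) Suc])
      also have "\<dots> = 3/2 * (r k - r (k + Suc n))" unfolding r_def by (simp add: diff_divide_distrib)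
      finally show ?case .
    qed simp
    have dx: "norm (x j - x k) \<le> 3/2 * r k" if "j \<ge> k" for j k
      using tele[of k "j - k"] that r0[of j] by simp
    have rlim: "r \<longlonglongrightarrow> 0" unfolding r_def by (rule LIMSEQ_realpow_zero) simp_all
    have "Cauchy x"
    proof (rule metric_CauchyI)
      fix d :: real assume "0 < d"
      then obtain N where N: "\<And>k. k \<ge> N \<Longrightarrow> r k < d / 3"
        using order_tendstoD(2)[OF rlim, of "d / 3"] unfolding eventually_sequentially by auto
      have "dist (x j) (x k) < d" if "j \<ge> N" "k \<ge> N" for j k
      proof -
        have "dist (x j) (x k) \<le> norm (x j - x N) + norm (x k - x N)"
          using dist_triangle2[of "x j" "x k" "x N"] by (simp add: dist_norm)
        then show ?thesis using dx[OF that(1)] dx[OF that(2)] N[of N] by simp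
      qed
      then show "\<exists>N. \<forall>j\<ge>N. \<forall>k\<ge>N. dist (x j) (x k) < d" by blast
    qed
    then obtain g where g: "x \<longlonglongrightarrow> g" using convergent_eq_Cauchy by blast
    have gx: "norm (g - x k) \<le> 3/2 * r k" for k
    proof (rule LIMSEQ_le_const2)
      show "(\<lambda>j. norm (x j - x k)) \<longlonglongrightarrow> norm (g - x k)" by (intro tendsto_intros g)
      show "\<exists>N. \<forall>n\<ge>N. norm (x n - x k) \<le> 3/2 * r k" using dx by blast
    qed
    have big: "(4/3) ^ k / 2 \<le> cmod (cinner (h k) g)" for k
    proof -
      have "cmod (cinner (h k) (g - x (Suc k))) \<le> norm (h k) * (3/2 * r (Suc k))"
        using cinner_cauchy_schwarz[of "h k" "g - x (Suc k)"] gx[of "Suc k"]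
        by (meson mult_left_mono norm_ge_zero order_trans)
      then have "cmod (cinner (h k) (g - x (Suc k))) \<le> r k * norm (h k) / 2"
        unfolding r_def by (simp add: mult.commute)
      moreover have "cmod (cinner (h k) (x (Suc k))) \<le> cmod (cinner (h k) g) + cmod (cinner (h k) (g - x (Suc k)))"
        using norm_triangle_ineq4[of "cinner (h k) g" "cinner (h k) (g - x (Suc k))"]
        by (simp add: cinner_diff_right)
      ultimately have "r k * norm (h k) / 2 \<le> cmod (cinner (h k) g)" using xs(2)[of k] by linarith
      moreover have "(4/3) ^ k \<le> r k * norm (h k)"
        using mult_left_mono[of "4 ^ k" "norm (h k)" "r k"] h(2)[of k] r0[of k]
        unfolding r_def by (simp add: power_divide)
      ultimately show ?thesis by simp
    qed
    obtain C where C: "\<And>y. y \<in> X \<Longrightarrow> cmod (cinner y g) \<le> C" using weak[of g] by blast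
    obtain k where "2 * C < (4/3) ^ k" using real_arch_pow[of "4/3" "2 * C"] by auto
    then show False using big[of k] C[OF h(1)[of k]] by simp
  qed
  then show ?thesis using that by blast
qed

subsection \<open>Unbounded operators\<close>

lemma op_app_eq: "single_valued T \<Longrightarrow> (f, g) \<in> T \<Longrightarrow> op_app T f = g"
  unfolding op_app_def by (rule the_equality) (auto dest: single_valuedD)

lemma linear_operatorD:
  assumes "linear_operator T"
  shows "csubspace T" "single_valued T"
  using assms unfolding linear_operator_def by blast+

lemma graph_add: "csubspace T \<Longrightarrow> (f, f') \<in> T \<Longrightarrow> (g, g') \<in> T \<Longrightarrow> (f + g, f' + g') \<in> T"
  using csubspace_add[of T "(f, f')" "(g, g')"] by simp

lemma graph_scale: "csubspace T \<Longrightarrow> (f, f') \<in> T \<Longrightarrow> (c *\<^sub>C f, c *\<^sub>C f') \<in> T"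
  using csubspace_scale[of T "(f, f')" c] by (simp add: scaleC_Pair)

lemma graph_diff: "csubspace T \<Longrightarrow> (f, f') \<in> T \<Longrightarrow> (g, g') \<in> T \<Longrightarrow> (f - g, f' - g') \<in> T"
  using csubspace_diff[of T "(f, f')" "(g, g')"] by simp

lemma graph_zero: "csubspace T \<Longrightarrow> (0, 0) \<in> T"
  using csubspace_0[of T] by (simp add: zero_prod_def)

lemma csubspace_Domain:
  assumes "csubspace T"
  shows "csubspace (Domain T)"
  unfolding complex_vector.subspace_def
  using graph_zero[OF assms] graph_add[OF assms] graph_scale[OF assms] by blast

lemma op_ker_shift_iff: "f \<in> op_ker (op_shift T z) \<longleftrightarrow> (f, z *\<^sub>C f) \<in> T"
  unfolding op_ker_def op_shift_def by auto

lemma csubspace_op_ker_shift: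
  assumes "csubspace T"
  shows "csubspace (op_ker (op_shift T z))"
  unfolding complex_vector.subspace_def op_ker_shift_iff
proof (intro conjI ballI allI)
  show "(0, z *\<^sub>C 0) \<in> T" using graph_zero[OF assms] by simp
  fix x y c assume x: "x \<in> op_ker (op_shift T z)"
  show "(c *\<^sub>C x, z *\<^sub>C c *\<^sub>C x) \<in> T"
    using graph_scale[OF assms, of x "z *\<^sub>C x" c] x
    by (simp add: op_ker_shift_iff scaleC_scaleC mult.commute)
  assume y: "y \<in> op_ker (op_shift T z)"
  show "(x + y, z *\<^sub>C (x + y)) \<in> T"
    using graph_add[OF assms, of x "z *\<^sub>C x" y "z *\<^sub>C y"] x y
    by (simp add: op_ker_shift_iff scaleC_add_right)
qed

lemma Range_op_shift: "Range (op_shift T z) = {f' - z *\<^sub>C f | f f'. (f, f') \<in> T}"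
  unfolding op_shift_def by auto

lemma csubspace_Range_op_shift:
  assumes "csubspace T"
  shows "csubspace (Range (op_shift T z))"
proof -
  have "Range (op_shift T z) = (\<lambda>x. snd x - z *\<^sub>C fst x) ` T"
    unfolding Range_op_shift by (auto simp: image_iff) (metis fst_conv snd_conv, blast)
  moreover have "clinear_on T (\<lambda>x. snd x - z *\<^sub>C fst x)"
    by (rule clinear_onI)
      (simp_all add: scaleC_add_right scaleC_diff_right scaleC_scaleC mult.commute)
  ultimately show ?thesis using csubspace_image[OF assms] by simp
qed

lemma adjoint_op_iff:
  assumes "single_valued T"
  shows "(g, h) \<in> adjoint_op T \<longleftrightarrow> (\<forall>f f'. (f, f') \<in> T \<longrightarrow> cinner g f' = cinner h f)"
  unfolding adjoint_op_def using op_app_eq[OF assms] by (auto simp: Domain_iff)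

lemma dense_orthogonal_zero:
  fixes x :: "'h::complex_inner"
  assumes "closure D = UNIV" "\<And>f. f \<in> D \<Longrightarrow> cinner x f = 0"
  shows "x = 0"
proof -
  obtain u where u: "\<And>k. u k \<in> D" "u \<longlonglongrightarrow> x"
    using assms(1) closure_sequential[of x D] by auto
  have "(\<lambda>k. cinner x (u k)) \<longlonglongrightarrow> cinner x x" by (intro tendsto_cinner tendsto_const u)
  moreover have "(\<lambda>k. cinner x (u k)) \<longlonglongrightarrow> 0" using assms(2) u(1) by simp
  ultimately have "cinner x x = 0" by (rule LIMSEQ_unique)
  then show ?thesis by simp
qed

lemma linear_operator_adjoint:
  assumes T: "linear_operator T" and d: "densely_defined T"
  shows "linear_operator (adjoint_op T)"
  unfolding linear_operator_def
proof
  note iff = adjoint_op_iff[OF linear_operatorD(2)[OF T]]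
  show "csubspace (adjoint_op T)"
    unfolding complex_vector.subspace_def
    by (auto simp: zero_prod_def scaleC_Pair iff cinner_add_left cinner_scaleC_left)
  show "single_valued (adjoint_op T)"
  proof (rule single_valuedI)
    fix g h h' assume "(g, h) \<in> adjoint_op T" "(g, h') \<in> adjoint_op T"
    then have "cinner (h - h') f = 0" if "f \<in> Domain T" for f
      using that unfolding iff cinner_diff_left by fastforce
    then show "h = h'"
      using dense_orthogonal_zero[of "Domain T" "h - h'"] d unfolding densely_defined_def by simp
  qed
qed

section \<open>Boundary triplets and the planes of self-adjoint extensions\<close>

locale boundary_triplet_op =
  fixes S :: "'h::complex_hilbert operator" and \<Gamma>0 \<Gamma>1 :: "'h \<Rightarrow> 'k::complex_hilbert" and n :: nat
  assumes lin: "linear_operator S" and dense: "densely_defined S" and sym: "symmetric_op S"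
    and bt: "boundary_triplet n S \<Gamma>0 \<Gamma>1"
begin

abbreviation A where "A \<equiv> adjoint_op S"

definition G where "G f = (\<Gamma>0 f, \<Gamma>1 f)"

lemmas S_sub = linear_operatorD(1)[OF lin] and S_sv = linear_operatorD(2)[OF lin]
lemmas A_lin = linear_operator_adjoint[OF lin dense]
lemmas A_sub = linear_operatorD(1)[OF A_lin] and A_sv = linear_operatorD(2)[OF A_lin]
lemmas A_iff = adjoint_op_iff[OF S_sv]

lemma fin: "cfinite_dim (UNIV :: 'k set)" and dim_n: "cdim (UNIV :: 'k set) = n"
  using bt unfolding boundary_triplet_def by blast+

lemma fin2: "cfinite_dim (V :: ('k \<times> 'k) set)"
  by (rule cfinite_dim_UNIV_prod[OF fin])

lemma boundary_maps_linear:
  assumes "f \<in> Domain A" "g \<in> Domain A" "\<Gamma> \<in> {\<Gamma>0, \<Gamma>1}"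
  shows "\<Gamma> (f + g) = \<Gamma> f + \<Gamma> g" "\<Gamma> (c *\<^sub>C f) = c *\<^sub>C \<Gamma> f"
  using bt assms unfolding boundary_triplet_def by blast+

lemma G_add: "(f, f') \<in> A \<Longrightarrow> (g, g') \<in> A \<Longrightarrow> G (f + g) = G f + G g"
  using boundary_maps_linear(1)[of f g] unfolding G_def by (simp add: Domain.DomainI)

lemma G_scale: "(f, f') \<in> A \<Longrightarrow> G (c *\<^sub>C f) = c *\<^sub>C G f"
  using boundary_maps_linear(2)[of f f] unfolding G_def scaleC_Pair by (simp add: Domain.DomainI)

lemma G_diff:
  assumes "(f, f') \<in> A" "(g, g') \<in> A"
  shows "G (f - g) = G f - G g"
  using G_add[OF graph_diff[OF A_sub assms] assms(2)] by simp

lemma G_surj: obtains f f' where "(f, f') \<in> A" "G f = u"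
proof -
  have "u \<in> (\<lambda>f. (\<Gamma>0 f, \<Gamma>1 f)) ` Domain A"
    using bt unfolding boundary_triplet_def by simp
  then show ?thesis using that unfolding G_def by blast
qed

lemma green:
  assumes "(f, f') \<in> A" "(g, g') \<in> A"
  shows "cinner f g' - cinner f' g = omega (G f) (G g)"
proof -
  have "cinner f (op_app A g) - cinner (op_app A f) g = cinner (\<Gamma>0 f) (\<Gamma>1 g) - cinner (\<Gamma>1 f) (\<Gamma>0 g)"
    using bt assms unfolding boundary_triplet_def by blast
  then show ?thesis
    using op_app_eq[OF A_sv assms(1)] op_app_eq[OF A_sv assms(2)] unfolding omega_def G_def by simp
qed

lemma S_symmetric: "(f, f') \<in> S \<Longrightarrow> (g, g') \<in> S \<Longrightarrow> cinner f g' = cinner f' g"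
  using sym op_app_eq[OF S_sv] unfolding symmetric_op_def by (metis DomainI)

lemma S_le_A: "(f, f') \<in> S \<Longrightarrow> (f, f') \<in> A"
  unfolding A_iff using S_symmetric by blast

lemma A_S_adjoint: "(f, f') \<in> A \<Longrightarrow> (g, g') \<in> S \<Longrightarrow> cinner f g' = cinner f' g"
  unfolding A_iff by blast

text \<open>By Green's identity \<open>G f\<close> is symplectically orthogonal to the range of
  \<open>G\<close>, which is the whole boundary space.\<close>

lemma S_G: assumes "(f, f') \<in> S" shows "G f = 0"
proof (rule omega_nondegenerate)
  fix v obtain g g' where g: "(g, g') \<in> A" "G g = v" by (rule G_surj)
  have "cinner g f' = cinner g' f" by (rule A_S_adjoint[OF g(1) assms])
  then have "omega (G g) (G f) = 0" using green[OF g(1) S_le_A[OF assms]] by simp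
  then show "omega (G f) v = 0" using g(2) omega_eq_0_sym by blast
qed

definition plane :: "'h operator \<Rightarrow> ('k \<times> 'k) set"
  where "plane H = G ` Domain H"

lemma plane_eq: "boundary_plane \<Gamma>0 \<Gamma>1 H = plane H"
  unfolding boundary_plane_def plane_def G_def ..

abbreviation sae where "sae \<equiv> self_adjoint_extension S"

lemma sae_lin: "sae H \<Longrightarrow> linear_operator H"
  unfolding self_adjoint_extension_def self_adjoint_def by blast

lemmas sae_sub = linear_operatorD(1)[OF sae_lin] and sae_sv = linear_operatorD(2)[OF sae_lin]

lemma sae_adjoint_iff: "sae H \<Longrightarrow> (g, h) \<in> H \<longleftrightarrow> (\<forall>f f'. (f, f') \<in> H \<longrightarrow> cinner g f' = cinner h f)"
  using adjoint_op_iff[OF sae_sv, of H g h] unfolding self_adjoint_extension_def self_adjoint_def by simp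

lemma sae_adjointI:
  assumes "sae H" "\<And>f f'. (f, f') \<in> H \<Longrightarrow> cinner g f' = cinner h f"
  shows "(g, h) \<in> H"
  using sae_adjoint_iff[OF assms(1), of g h] assms(2) by blast

lemma sae_S: "sae H \<Longrightarrow> (f, f') \<in> S \<Longrightarrow> (f, f') \<in> H"
  unfolding self_adjoint_extension_def by blast

lemma sae_A: "sae H \<Longrightarrow> (f, f') \<in> H \<Longrightarrow> (f, f') \<in> A"
  using sae_adjoint_iff sae_S unfolding A_iff by blast

lemma sae_symmetric: "sae H \<Longrightarrow> (f, f') \<in> H \<Longrightarrow> (g, g') \<in> H \<Longrightarrow> cinner f g' = cinner f' g"
  using sae_adjoint_iff by blast

lemma sae_isotropic:
  assumes "sae H" "(f, f') \<in> H" "(g, g') \<in> H"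
  shows "omega (G f) (G g) = 0"
  using green[OF sae_A[OF assms(1,2)] sae_A[OF assms(1,3)]] sae_symmetric[OF assms] by simp

text \<open>If \<open>G f\<close> equals \<open>G g\<close> with \<open>g\<close> in the domain of
  \<open>H\<close>, then Green's identity makes \<open>f\<close> symmetric against that whole
  domain, and self-adjointness admits \<open>f\<close> to it.\<close>

lemma sae_iff:
  assumes "sae H"
  shows "(f, f') \<in> H \<longleftrightarrow> (f, f') \<in> A \<and> G f \<in> plane H"
proof
  assume "(f, f') \<in> H"
  then show "(f, f') \<in> A \<and> G f \<in> plane H" using sae_A[OF assms] unfolding plane_def by blast
next
  assume f: "(f, f') \<in> A \<and> G f \<in> plane H"
  then obtain g g' where g: "(g, g') \<in> H" "G f = G g" unfolding plane_def by blast
  show "(f, f') \<in> H"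
  proof (rule sae_adjointI[OF assms])
    fix k k' assume k: "(k, k') \<in> H"
    show "cinner f k' = cinner f' k"
      using green[OF conjunct1[OF f] sae_A[OF assms k]] sae_isotropic[OF assms g(1) k] g(2) by simp
  qed
qed

lemma clinear_on_G: "V \<subseteq> Domain A \<Longrightarrow> clinear_on V G"
  using boundary_maps_linear(1) boundary_maps_linear(2)[OF _ Domain.DomainI[OF graph_zero[OF A_sub]]]
  by (intro clinear_onI) (simp_all add: G_def scaleC_Pair subset_iff)

text \<open>Through Green's identity, isotropy of the plane is the symmetry of \<open>H\<close>, and
  its maximality is the inclusion of the adjoint in \<open>H\<close>.\<close>

lemma sae_lagrangian:
  assumes "sae H"
  shows "lagrangian (plane H)"
proof (rule lagrangianI)
  have "Domain H \<subseteq> Domain A"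
  proof
    fix f assume "f \<in> Domain H"
    then obtain f' where "(f, f') \<in> H" by blast
    then show "f \<in> Domain A" using sae_A[OF assms] Domain.DomainI by metis
  qed
  then show "csubspace (plane H)"
    unfolding plane_def by (rule csubspace_image[OF csubspace_Domain[OF sae_sub[OF assms]] clinear_on_G])
  show "omega u v = 0" if "u \<in> plane H" "v \<in> plane H" for u v
    using that sae_isotropic[OF assms] unfolding plane_def by blast
  fix u assume u: "\<And>v. v \<in> plane H \<Longrightarrow> omega u v = 0"
  obtain f f' where f: "(f, f') \<in> A" "G f = u" by (rule G_surj)
  have "(f, f') \<in> H"
  proof (rule sae_adjointI[OF assms])
    fix k k' assume k: "(k, k') \<in> H"
    then have "omega (G f) (G k) = 0" using u f(2) unfolding plane_def by blast
    then show "cinner f k' = cinner f' k" using green[OF f(1) sae_A[OF assms k]] by simp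
  qed
  then show "u \<in> plane H" using f(2) unfolding plane_def by blast
qed

section \<open>Defect spaces at real points and their Cauchy data planes\<close>

abbreviation defect :: "real \<Rightarrow> 'h set"
  where "defect t \<equiv> op_ker (op_shift A (complex_of_real t))"

abbreviation rng :: "real \<Rightarrow> 'h set"
  where "rng t \<equiv> Range (op_shift S (complex_of_real t))"

definition regular :: "real \<Rightarrow> bool"
  where "regular t \<longleftrightarrow> complex_of_real t \<notin> Spec_ess S"

definition M :: "real \<Rightarrow> ('k \<times> 'k) set"
  where "M t = G ` defect t"

lemma cauchy_data_eq: "cauchy_data S \<Gamma>0 \<Gamma>1 (complex_of_real t) = M t"
  unfolding cauchy_data_def M_def G_def ..

lemma defect_iff: "f \<in> defect t \<longleftrightarrow> (\<forall>r\<in>rng t. cinner f r = 0)"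
proof -
  have "cinner f (g' - complex_of_real t *\<^sub>C g) = cinner f g' - cinner (complex_of_real t *\<^sub>C f) g" for g g'
    by (simp add: cinner_diff_right cinner_scaleC_right cinner_scaleC_left)
  then show ?thesis unfolding op_ker_shift_iff A_iff Range_op_shift by fastforce
qed

lemma regularD:
  assumes "regular t"
  shows "closed (rng t)" "\<exists>B. finite B \<and> cspan (rng t \<union> B) = UNIV"
  using assms unfolding regular_def Spec_ess_def fredholm_def by blast+

lemma rng_sub: "csubspace (rng t)"
  by (rule csubspace_Range_op_shift[OF S_sub])

lemma defect_sub: "csubspace (defect t)"
  by (rule csubspace_op_ker_shift[OF A_sub])

lemma rng_decomp:
  assumes "regular t"
  obtains r where "r \<in> rng t" "x - r \<in> defect t"
proof -
  obtain r where "r \<in> rng t" "\<And>v. v \<in> rng t \<Longrightarrow> cinner (x - r) v = 0"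
    using closed_projection[OF rng_sub regularD(1)[OF assms]] by metis
  then show ?thesis using that defect_iff by blast
qed

text \<open>A finite set \<open>B\<close> completes the range of \<open>S - t\<close> to a spanning
  set. Removing the range components from \<open>B\<close> leaves vectors of the defect space, and
  these span it.\<close>

lemma defect_finite:
  assumes "regular t"
  shows "cfinite_dim (defect t)"
proof -
  obtain B where B: "finite B" "cspan (rng t \<union> B) = UNIV" using regularD(2)[OF assms] by blast
  have "\<exists>r. r \<in> rng t \<and> b - r \<in> defect t" for b using rng_decomp[OF assms] by metis
  then obtain r where r: "\<And>b. r b \<in> rng t" "\<And>b. b - r b \<in> defect t" by metis
  let ?D = "(\<lambda>b. b - r b) ` B"
  let ?W = "{x + y | x y. x \<in> rng t \<and> y \<in> cspan ?D}"
  have W: "csubspace ?W" by (intro csubspace_sums rng_sub csubspace_span)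
  have D: "cspan ?D \<subseteq> defect t"
    using r(2) by (intro cspan_minimal defect_sub) auto
  have "rng t \<union> B \<subseteq> ?W"
  proof
    fix x assume "x \<in> rng t \<union> B"
    then show "x \<in> ?W"
    proof
      assume "x \<in> rng t"
      then show ?thesis using cspan_zero[of ?D] by force
    next
      assume "x \<in> B"
      then have "x - r x \<in> cspan ?D" by (intro cspan_base) blast
      moreover have "x = r x + (x - r x)" by simp
      ultimately show ?thesis using r(1)[of x] by blast
    qed
  qed
  from cspan_minimal[OF this W] have UW: "?W = UNIV" unfolding B(2) by blast
  have "defect t \<subseteq> cspan ?D"
  proof
    fix f assume f: "f \<in> defect t"
    have "f \<in> ?W" unfolding UW by simp
    then obtain x y where xy: "f = x + y" "x \<in> rng t" "y \<in> cspan ?D" by blast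
    have "f - y \<in> defect t" by (rule csubspace_diff[OF defect_sub f subsetD[OF D xy(3)]])
    then have "x \<in> defect t" using xy(1) by simp
    then have "cinner x x = 0" using defect_iff xy(2) by blast
    then show "f \<in> cspan ?D" using xy by simp
  qed
  then show ?thesis unfolding cfinite_dim_def using B(1) by blast
qed

lemma defectD: "f \<in> defect t \<Longrightarrow> (f, complex_of_real t *\<^sub>C f) \<in> A"
  unfolding op_ker_shift_iff .

lemma G_defect: "clinear_on (defect t) G"
  by (rule clinear_on_G) (use defectD in \<open>auto\<close>)

text \<open>Source of the signs near a regular point: between two Cauchy data planes
  \<open>omega\<close> is the inner product times the difference of the parameters. The case
  \<open>s = t\<close> is isotropy.\<close>

lemma omega_defect:
  assumes "f \<in> defect s" "g \<in> defect t"
  shows "omega (G f) (G g) = complex_of_real (t - s) * cinner f g"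
  using green[OF defectD[OF assms(1)] defectD[OF assms(2)]]
  by (simp add: cinner_scaleC_left cinner_scaleC_right algebra_simps)

text \<open>For maximality, lift \<open>u\<close> to \<open>g\<close> with \<open>G g = u\<close>.
  Green's identity makes \<open>w\<close>, the image of \<open>g\<close> under the adjoint minus
  \<open>t\<close>, orthogonal to the defect space, so \<open>w\<close> comes from some
  \<open>h\<close> in the domain of \<open>S\<close>. Subtracting \<open>h\<close> does not change
  boundary values and moves \<open>g\<close> into the defect space.\<close>

lemma M_lagrangian:
  assumes "regular t"
  shows "lagrangian (M t)"
proof (rule lagrangianI)
  show "csubspace (M t)" unfolding M_def by (intro csubspace_image defect_sub G_defect)
  show "omega u v = 0" if "u \<in> M t" "v \<in> M t" for u v
    using that omega_defect[of _ t _ t] unfolding M_def by auto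
  fix u assume u: "\<And>v. v \<in> M t \<Longrightarrow> omega u v = 0"
  obtain g g' where g: "(g, g') \<in> A" "G g = u" by (rule G_surj)
  define w where "w = g' - complex_of_real t *\<^sub>C g"
  obtain r where r: "r \<in> rng t" "w - r \<in> defect t" by (rule rng_decomp[OF assms])
  have "cinner w f = 0" if f: "f \<in> defect t" for f
  proof -
    have "omega (G g) (G f) = 0" using u f g(2) unfolding M_def by blast
    then show ?thesis
      using green[OF g(1) defectD[OF f]]
      by (simp add: w_def cinner_diff_left cinner_scaleC_left cinner_scaleC_right)
  qed
  moreover have "cinner r f = 0" if "f \<in> defect t" for f
    using that r(1) defect_iff cinner_eq_0_sym by blast
  ultimately have "cinner (w - r) (w - r) = 0"
    using r(2) by (simp only: cinner_diff_left diff_self)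
  then have "w = r" by simp
  then obtain h h' where h: "(h, h') \<in> S" "w = h' - complex_of_real t *\<^sub>C h"
    using r(1) unfolding Range_op_shift by blast
  have "(g - h, g' - h') \<in> A" by (rule graph_diff[OF A_sub g(1) S_le_A[OF h(1)]])
  moreover have "g' - h' = complex_of_real t *\<^sub>C (g - h)"
    using h(2) unfolding w_def by (simp add: algebra_simps)
  ultimately have "g - h \<in> defect t" unfolding op_ker_shift_iff by simp
  moreover have "G (g - h) = u" using G_diff[OF g(1) S_le_A[OF h(1)]] S_G[OF h(1)] g(2) by simp
  ultimately show "u \<in> M t" unfolding M_def by blast
qed

section \<open>Eigenspaces of extensions and the reduced resolvent\<close>

abbreviation eigenspace :: "'h operator \<Rightarrow> real \<Rightarrow> 'h set"
  where "eigenspace H t \<equiv> op_ker (op_shift H (complex_of_real t))"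

lemma eigenspace_le: "sae H \<Longrightarrow> eigenspace H t \<subseteq> defect t"
  using sae_A unfolding subset_iff op_ker_shift_iff by blast

lemma eigenspace_sub: "sae H \<Longrightarrow> csubspace (eigenspace H t)"
  by (intro csubspace_op_ker_shift sae_sub)

text \<open>Rank-nullity for \<open>G\<close> on the eigenspace. The kernel term does not involve
  \<open>H\<close> and cancels when two extensions are compared.\<close>

lemma cdim_eigenspace:
  assumes "sae H" "regular t"
  shows "cdim (eigenspace H t) = cdim {f \<in> defect t. G f = 0} + cdim (plane H \<inter> M t)"
proof -
  note iff = sae_iff[OF assms(1)]
  have 0: "0 \<in> plane H" by (rule csubspace_0[OF lagrangian_subspace[OF sae_lagrangian[OF assms(1)]]])
  have "G ` eigenspace H t = plane H \<inter> M t"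
    unfolding M_def set_eq_iff image_iff Int_iff Bex_def op_ker_shift_iff iff by metis
  moreover have "{f \<in> eigenspace H t. G f = 0} = {f \<in> defect t. G f = 0}"
    unfolding op_ker_shift_iff iff using 0 by auto
  ultimately show ?thesis
    using rank_nullity(2)[OF eigenspace_sub[OF assms(1)] cfinite_dim_mono[OF defect_finite[OF assms(2)]
        eigenspace_le[OF assms(1)]] clinear_on_mono[OF G_defect eigenspace_le[OF assms(1)]]] by simp
qed

lemma orth_range_eigenspace:
  assumes "sae H" "\<And>v. v \<in> Range (op_shift H (complex_of_real t)) \<Longrightarrow> cinner s v = 0"
  shows "s \<in> eigenspace H t"
  unfolding op_ker_shift_iff
proof (rule sae_adjointI[OF assms(1)])
  fix k k' assume "(k, k') \<in> H"
  then have "cinner s (k' - complex_of_real t *\<^sub>C k) = 0"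
    by (intro assms(2)) (auto simp: Range_op_shift)
  then show "cinner s k' = cinner (complex_of_real t *\<^sub>C s) k"
    by (simp add: cinner_diff_right cinner_scaleC_right cinner_scaleC_left)
qed

text \<open>The range of \<open>H - t\<close> contains the closed \<open>rng t\<close>, and what
  remains lies in the finite-dimensional defect space. Projecting there yields a vector orthogonal
  to the entire range, which is an eigenvector.\<close>

lemma range_eigenspace_decomp:
  assumes H: "sae H" and t: "regular t"
  obtains k k' s where "(k, k') \<in> H" "s \<in> eigenspace H t" "g = (k' - complex_of_real t *\<^sub>C k) + s"
proof -
  let ?V = "Range (op_shift H (complex_of_real t))"
  have V: "csubspace ?V" by (rule csubspace_Range_op_shift[OF sae_sub[OF H]])
  have rV: "rng t \<subseteq> ?V" unfolding Range_op_shift using sae_S[OF H] by blast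
  obtain r where r: "r \<in> rng t" "g - r \<in> defect t" by (rule rng_decomp[OF t])
  have U: "csubspace (defect t \<inter> ?V)" "cfinite_dim (defect t \<inter> ?V)"
    using csubspace_inter[OF defect_sub V] cfinite_dim_mono[OF defect_finite[OF t] Int_lower1]
    by auto
  obtain s1 where s1: "s1 \<in> defect t \<inter> ?V" "\<And>v. v \<in> defect t \<inter> ?V \<Longrightarrow> cinner ((g - r) - s1) v = 0"
    using finite_dim_projection[OF U, of "g - r"] by metis
  define s where "s = (g - r) - s1"
  have s: "s \<in> defect t"
    unfolding s_def using s1(1) by (intro csubspace_diff[OF defect_sub r(2)]) simp
  have "s \<in> eigenspace H t"
  proof (rule orth_range_eigenspace[OF H])
    fix v assume v: "v \<in> ?V"
    obtain r' where r': "r' \<in> rng t" "v - r' \<in> defect t" by (rule rng_decomp[OF t])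
    have "v - r' \<in> defect t \<inter> ?V"
      using r' v csubspace_diff[OF V v subsetD[OF rV r'(1)]] by simp
    then have "cinner s (v - r') = 0" unfolding s_def by (rule s1(2))
    moreover have "cinner s r' = 0" using s r'(1) defect_iff by blast
    ultimately show "cinner s v = 0" by (simp add: cinner_diff_right)
  qed
  moreover have "r + s1 \<in> ?V"
    using s1(1) by (intro csubspace_add[OF V subsetD[OF rV r(1)]]) simp
  then obtain k k' where "(k, k') \<in> H" "r + s1 = k' - complex_of_real t *\<^sub>C k"
    unfolding Range_op_shift by blast
  moreover have "g = (r + s1) + s" unfolding s_def by simp
  ultimately show ?thesis using that by metis
qed

text \<open>\<open>X\<close> collects the solutions \<open>h\<close>, orthogonal to the eigenspace,
  whose right-hand side lies in the unit ball. Writing \<open>g\<close> as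
  \<open>(H - t) k + s\<close> and moving the operator to \<open>h\<close> bounds
  \<open>cinner h g\<close> by \<open>norm k\<close>, so uniform boundedness applies to
  \<open>X\<close>.\<close>

lemma reduced_resolvent_bound:
  assumes H: "sae H" and t: "regular t"
  obtains C where "0 < C" "\<And>h h'. (h, h') \<in> H \<Longrightarrow> (\<And>k. k \<in> eigenspace H t \<Longrightarrow> cinner h k = 0) \<Longrightarrow>
    norm h \<le> C * norm (h' - complex_of_real t *\<^sub>C h)"
proof -
  define X where "X = {h. (\<exists>h'. (h, h') \<in> H \<and> norm (h' - complex_of_real t *\<^sub>C h) \<le> 1) \<and>
    (\<forall>k\<in>eigenspace H t. cinner h k = 0)}"
  have "\<exists>C. \<forall>h\<in>X. cmod (cinner h g) \<le> C" for g
  proof -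
    obtain k k' s where k: "(k, k') \<in> H" "s \<in> eigenspace H t" "g = (k' - complex_of_real t *\<^sub>C k) + s"
      by (rule range_eigenspace_decomp[OF H t])
    have "cmod (cinner h g) \<le> norm k" if h: "h \<in> X" for h
    proof -
      obtain h' where h': "(h, h') \<in> H" "norm (h' - complex_of_real t *\<^sub>C h) \<le> 1" "cinner h s = 0"
        using h k(2) unfolding X_def by blast
      have "cinner h g = cinner (h' - complex_of_real t *\<^sub>C h) k"
        unfolding k(3) using sae_symmetric[OF H h'(1) k(1)] h'(3)
        by (simp add: cinner_add_right cinner_diff_right cinner_diff_left cinner_scaleC_left cinner_scaleC_right)
      then have "cmod (cinner h g) \<le> norm (h' - complex_of_real t *\<^sub>C h) * norm k"
        by (simp only: cinner_cauchy_schwarz)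
      also have "\<dots> \<le> norm k" using h'(2) mult_right_mono[of _ 1 "norm k"] by simp
      finally show ?thesis .
    qed
    then show ?thesis by blast
  qed
  then obtain C where C: "\<And>h. h \<in> X \<Longrightarrow> norm h \<le> C" using weakly_bounded_imp_bounded[of X] by metis
  \<comment> \<open>The maximum with 1 makes the constant positive.\<close>
  have "norm h \<le> max C 1 * norm (h' - complex_of_real t *\<^sub>C h)"
    if h: "(h, h') \<in> H" "\<And>k. k \<in> eigenspace H t \<Longrightarrow> cinner h k = 0" for h h'
  proof (cases "h' - complex_of_real t *\<^sub>C h = 0")
    case True
    then have "h \<in> eigenspace H t" using h(1) unfolding op_ker_shift_iff by simp
    then have "cinner h h = 0" by (rule h(2))
    then show ?thesis by simp
  next
    case False
    define c where "c = norm (h' - complex_of_real t *\<^sub>C h)"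
    have c: "0 < c" using False unfolding c_def by simp
    let ?a = "complex_of_real (inverse c)"
    have "(?a *\<^sub>C h, ?a *\<^sub>C h') \<in> H" by (rule graph_scale[OF sae_sub[OF H] h(1)])
    moreover have "?a *\<^sub>C h' - complex_of_real t *\<^sub>C ?a *\<^sub>C h = ?a *\<^sub>C (h' - complex_of_real t *\<^sub>C h)"
      by (simp add: scaleC_diff_right scaleC_scaleC mult.commute)
    then have "norm (?a *\<^sub>C h' - complex_of_real t *\<^sub>C ?a *\<^sub>C h) \<le> 1"
      using c by (simp add: norm_scaleC norm_inverse flip: c_def)
    moreover have "\<forall>k\<in>eigenspace H t. cinner (?a *\<^sub>C h) k = 0"
      using h(2) by (simp add: cinner_scaleC_left)
    ultimately have "?a *\<^sub>C h \<in> X" unfolding X_def by blast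
    then have "norm (?a *\<^sub>C h) \<le> C" by (rule C)
    then have "norm h \<le> C * c" using c by (simp add: norm_scaleC norm_divide field_simps)
    also have "\<dots> \<le> max C 1 * c" using c by (intro mult_right_mono) auto
    finally show ?thesis unfolding c_def .
  qed
  then show ?thesis by (intro that[of "max C 1"]) auto
qed

section \<open>Passing a single regular point\<close>

lemma crossing_estimate:
  assumes H: "sae H" and t0: "regular t0"
  obtains d where "0 < d" "\<And>t f g. t \<noteq> t0 \<Longrightarrow> \<bar>t - t0\<bar> < d \<Longrightarrow> f \<in> defect t \<Longrightarrow> g \<in> defect t0 \<Longrightarrow>
    G f + G g \<in> plane H \<Longrightarrow> f \<noteq> 0 \<Longrightarrow> Re (cinner f g) < 0"
proof -
  obtain C where C: "0 < C" "\<And>h h'. (h, h') \<in> H \<Longrightarrow> (\<And>k. k \<in> eigenspace H t0 \<Longrightarrow> cinner h k = 0) \<Longrightarrow>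
    norm h \<le> C * norm (h' - complex_of_real t0 *\<^sub>C h)"
    using reduced_resolvent_bound[OF H t0] by metis
  \<comment> \<open>The radius \<open>1 / C\<close> keeps the error
    \<open>C * |t - t0| * (norm f)^2\<close> strictly below \<open>(norm f)^2\<close>.\<close>
  have "Re (cinner f g) < 0"
    if t: "t \<noteq> t0" "\<bar>t - t0\<bar> < 1 / C" and f: "f \<in> defect t" "f \<noteq> 0" and g: "g \<in> defect t0"
      and fg: "G f + G g \<in> plane H" for t f g
  proof -
    define h' where "h' = complex_of_real t *\<^sub>C f + complex_of_real t0 *\<^sub>C g"
    have hH: "(f + g, h') \<in> H"
      unfolding h'_def sae_iff[OF H] using graph_add[OF A_sub defectD[OF f(1)] defectD[OF g]]
        G_add[OF defectD[OF f(1)] defectD[OF g]] fg by simp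
    have h': "h' - complex_of_real t0 *\<^sub>C (f + g) = complex_of_real (t - t0) *\<^sub>C f"
      unfolding h'_def by (simp add: scaleC_add_right complex_vector.scale_left_diff_distrib)
    obtain k where k: "k \<in> eigenspace H t0" "\<And>v. v \<in> eigenspace H t0 \<Longrightarrow> cinner ((f + g) - k) v = 0"
      using finite_dim_projection[OF eigenspace_sub[OF H] cfinite_dim_mono[OF defect_finite[OF t0] eigenspace_le[OF H]],
          of "f + g"] by metis
    have kH: "(k, complex_of_real t0 *\<^sub>C k) \<in> H" using k(1) unfolding op_ker_shift_iff .
    \<comment> \<open>An eigenvector at \<open>t0\<close> is orthogonal to the range of
      \<open>H - t0\<close>, which contains \<open>(t - t0) f\<close>.\<close>
    have kf: "cinner k f = 0"
    proof -
      have "cinner k (h' - complex_of_real t0 *\<^sub>C (f + g)) = 0"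
        using sae_symmetric[OF H kH hH] by (simp add: cinner_diff_right cinner_scaleC_right cinner_scaleC_left)
      then show ?thesis unfolding h' using t(1) by (simp add: cinner_scaleC_right)
    qed
    define h1 where "h1 = (f + g) - k"
    have h1: "(h1, h' - complex_of_real t0 *\<^sub>C k) \<in> H"
      unfolding h1_def by (rule graph_diff[OF sae_sub[OF H] hH kH])
    have "h' - complex_of_real t0 *\<^sub>C k - complex_of_real t0 *\<^sub>C h1 = complex_of_real (t - t0) *\<^sub>C f"
      unfolding h1_def h'[symmetric] by (simp add: scaleC_diff_right scaleC_add_right)
    then have "norm h1 \<le> C * norm (complex_of_real (t - t0) *\<^sub>C f)"
      using C(2)[OF h1] k(2) unfolding h1_def by simp
    then have h1n: "norm h1 \<le> C * \<bar>t - t0\<bar> * norm f" by (simp add: norm_scaleC flip: of_real_diff)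
    have "cinner f g = cinner f h1 - cinner f f"
      unfolding h1_def using kf cinner_eq_0_sym[of k f] by (simp add: cinner_diff_right cinner_add_right)
    then have "Re (cinner f g) = Re (cinner f h1) - (norm f)\<^sup>2" by (simp add: norm_sq_Re_cinner)
    also have "Re (cinner f h1) \<le> norm f * norm h1"
      using complex_Re_le_cmod[of "cinner f h1"] cinner_cauchy_schwarz[of f h1] by linarith
    also have "norm f * norm h1 \<le> norm f * (C * \<bar>t - t0\<bar> * norm f)"
      by (rule mult_left_mono[OF h1n]) simp
    also have "\<dots> = C * \<bar>t - t0\<bar> * (norm f)\<^sup>2" by (simp add: power2_eq_square)
    also have "\<dots> < 1 * (norm f)\<^sup>2"
      using t(2) C(1) f(2) by (intro mult_strict_right_mono) (simp_all add: field_simps)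
    finally show ?thesis by simp
  qed
  then show ?thesis using that[of "1 / C"] C(1) by auto
qed

text \<open>\<open>min\<close> and \<open>max\<close> put the lower parameter first in the index, so
  one formula covers both sides of \<open>t0\<close>; the sides differ only in the dimension terms
  of the cocycle.\<close>

definition isolating :: "'h operator \<Rightarrow> real \<Rightarrow> real \<Rightarrow> bool"
  where "isolating H t0 d \<longleftrightarrow> 0 < d \<and> (\<forall>t. regular t \<longrightarrow> t \<noteq> t0 \<longrightarrow> \<bar>t - t0\<bar> < d \<longrightarrow>
    eigenspace H t = {0} \<and> plane H \<inter> M t = {0} \<and>
    duistermaat (M (min t t0)) (plane H) (M (max t t0)) = int n - int (cdim (plane H \<inter> M t0)))"

lemma isolatingD:
  assumes "isolating H t0 d" "regular t" "t \<noteq> t0" "\<bar>t - t0\<bar> < d"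
  shows "eigenspace H t = {0}" "plane H \<inter> M t = {0}"
    "duistermaat (M (min t t0)) (plane H) (M (max t t0)) = int n - int (cdim (plane H \<inter> M t0))"
  using assms unfolding isolating_def by simp_all

lemma local_crossing:
  assumes H: "sae H" and t0: "regular t0"
  obtains d where "isolating H t0 d"
proof -
  obtain d where d: "0 < d" "\<And>t f g. t \<noteq> t0 \<Longrightarrow> \<bar>t - t0\<bar> < d \<Longrightarrow> f \<in> defect t \<Longrightarrow> g \<in> defect t0 \<Longrightarrow>
    G f + G g \<in> plane H \<Longrightarrow> f \<noteq> 0 \<Longrightarrow> Re (cinner f g) < 0"
    using crossing_estimate[OF H t0] by metis
  note L = sae_lagrangian[OF H] and M0 = M_lagrangian[OF t0]
  note sL = lagrangian_subspace[OF L] and sM0 = lagrangian_subspace[OF M0]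
  have zero: "0 \<in> defect s" "G 0 = 0" "0 \<in> plane H" for s
    using csubspace_0[OF defect_sub] csubspace_0[OF sL]
      clinear_on_0[OF G_defect defect_sub] by auto
  \<comment> \<open>With \<open>g = 0\<close> the strict inequality of the estimate is
    impossible.\<close>
  have trans: "f = 0" if "t \<noteq> t0" "\<bar>t - t0\<bar> < d" "f \<in> defect t" "G f \<in> plane H" for t f
    using d(2)[OF that(1,2,3) zero(1)] that(4) zero(2) by (cases "f = 0") auto
  \<comment> \<open>If \<open>x = G f = G g\<close>, then \<open>G f + G (- g) = 0\<close> lies in
    \<open>plane H\<close>, so the estimate would make \<open>cinner f (- g)\<close> negative,
    whereas isotropy of \<open>M t0\<close> makes it zero.\<close>
  have MM: "M t \<inter> M t0 = {0}" if t: "regular t" "t \<noteq> t0" "\<bar>t - t0\<bar> < d" for t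
  proof -
    have "x = 0" if x: "x \<in> M t" "x \<in> M t0" for x
    proof -
      obtain f g where f: "f \<in> defect t" "x = G f" and g: "g \<in> defect t0" "x = G g"
        using x unfolding M_def by blast
      have mg: "- g \<in> defect t0" by (rule csubspace_neg[OF defect_sub g(1)])
      have Gmg: "G (- g) = - x" using clinear_on_minus[OF G_defect g(1)] g(2) by simp
      have "complex_of_real (t0 - t) * cinner f (- g) = omega x (- x)"
        using omega_defect[OF f(1) mg] Gmg f(2) by simp
      also have "\<dots> = 0" using lagrangian_isotropic[OF M0 x(2) x(2)] by simp
      finally have "cinner f (- g) = 0" using t(2) by (simp del: cinner_minus_right)
      moreover have "f \<noteq> 0 \<Longrightarrow> Re (cinner f (- g)) < 0"
        using d(2)[OF t(2,3) f(1) mg] Gmg f(2) zero(3) by simp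
      ultimately have "f = 0" by (cases "f = 0") simp_all
      then show ?thesis using f(2) zero(2) by simp
    qed
    then show ?thesis
      using csubspace_0[OF sM0] csubspace_0[OF lagrangian_subspace[OF M_lagrangian[OF t(1)]]]
      by blast
  qed
  have 1: "eigenspace H t = {0} \<and> plane H \<inter> M t = {0}"
    if t: "regular t" "t \<noteq> t0" "\<bar>t - t0\<bar> < d" for t
  proof -
    have "eigenspace H t \<subseteq> {0}"
    proof
      fix f assume f: "f \<in> eigenspace H t"
      then have "G f \<in> plane H" unfolding op_ker_shift_iff sae_iff[OF H] by blast
      then show "f \<in> {0}" using trans[OF t(2,3) subsetD[OF eigenspace_le[OF H] f]] by simp
    qed
    moreover have "plane H \<inter> M t \<subseteq> {0}"
    proof
      fix x assume x: "x \<in> plane H \<inter> M t"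
      then obtain f where f: "f \<in> defect t" "x = G f" unfolding M_def by blast
      then have "f = 0" using trans[OF t(2,3) f(1)] x by simp
      then show "x \<in> {0}" using f(2) zero(2) by simp
    qed
    ultimately show ?thesis
      using csubspace_0[OF eigenspace_sub[OF H]] zero(3)
        csubspace_0[OF lagrangian_subspace[OF M_lagrangian[OF t(1)]]] by blast
  qed
  \<comment> \<open>Here \<open>U\<close> is \<open>plane H \<inter> M t0\<close>: a sum
    \<open>b + c\<close> in \<open>plane H\<close> belongs to it exactly when its component in
    \<open>M t\<close> vanishes.\<close>
  have 2: "duistermaat (M t0) (plane H) (M t) = int n - int (cdim (plane H \<inter> M t0))"
    if t: "regular t" "t0 < t" "t - t0 < d" for t
  proof -
    have t': "t \<noteq> t0" "\<bar>t - t0\<bar> < d" using t by auto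
    note Mt = M_lagrangian[OF t(1)]
    show ?thesis
      unfolding dim_n[symmetric]
    proof (rule duistermaat_transversal[OF fin L M0 Mt])
      show "M t0 \<inter> M t = {0}" using MM[OF t(1) t'] by blast
      show "csubspace (plane H \<inter> M t0)" by (rule csubspace_inter[OF sL sM0])
      show "plane H \<inter> M t0 \<subseteq> plane H" by simp
    next
      fix b c assume bc: "b \<in> M t0" "c \<in> M t" "b + c \<in> plane H" "b + c \<notin> plane H \<inter> M t0"
      obtain f g where f: "f \<in> defect t" "c = G f" and g: "g \<in> defect t0" "b = G g"
        using bc(1,2) unfolding M_def by blast
      have "f \<noteq> 0" using bc f(2) zero(2) by auto
      then have "Re (cinner f g) < 0"
        using d(2)[OF t' f(1) g(1)] bc(3) f(2) g(2) by (simp add: add.commute)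
      then have "Re (cinner g f) < 0" using cinner_commute[of f g] by simp
      then show "Re (omega b c) < 0"
        using omega_defect[OF g(1) f(1)] f(2) g(2) t(2) by (simp add: mult_pos_neg)
    next
      fix b c assume bc: "b \<in> M t0" "c \<in> M t" "b + c \<in> plane H \<inter> M t0"
      then have "c \<in> M t0" using csubspace_diff[OF sM0, of "b + c" b] by simp
      then have "c = 0" using bc(2) MM[OF t(1) t'] by blast
      then show "0 \<le> Re (omega b c)" by simp
    qed
  qed
  \<comment> \<open>The lower parameter again comes first, so the factor \<open>t0 - t\<close> from
    \<open>omega_defect\<close> is positive and the sign is the same as on the other side.\<close>
  have 3: "duistermaat (M t) (plane H) (M t0) = int n - int (cdim (plane H \<inter> M t0))"
    if t: "regular t" "t < t0" "t0 - t < d" for t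
  proof -
    have t': "t \<noteq> t0" "\<bar>t - t0\<bar> < d" using t by auto
    note Mt = M_lagrangian[OF t(1)]
    show ?thesis
      unfolding dim_n[symmetric]
    proof (rule duistermaat_transversal[OF fin L Mt M0])
      show "M t \<inter> M t0 = {0}" by (rule MM[OF t(1) t'])
      show "csubspace (plane H \<inter> M t0)" by (rule csubspace_inter[OF sL sM0])
      show "plane H \<inter> M t0 \<subseteq> plane H" by simp
    next
      fix b c assume bc: "b \<in> M t" "c \<in> M t0" "b + c \<in> plane H" "b + c \<notin> plane H \<inter> M t0"
      obtain f g where f: "f \<in> defect t" "b = G f" and g: "g \<in> defect t0" "c = G g"
        using bc(1,2) unfolding M_def by blast
      have "f \<noteq> 0" using bc f(2) zero(2) by auto
      then have "Re (cinner f g) < 0"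
        using d(2)[OF t' f(1) g(1)] bc(3) f(2) g(2) by simp
      then show "Re (omega b c) < 0"
        using omega_defect[OF f(1) g(1)] f(2) g(2) t(2) by (simp add: mult_pos_neg)
    next
      fix b c assume bc: "b \<in> M t" "c \<in> M t0" "b + c \<in> plane H \<inter> M t0"
      then have "b \<in> M t0" using csubspace_diff[OF sM0, of "b + c" c] by simp
      then have "b = 0" using bc(1) MM[OF t(1) t'] by blast
      then show "0 \<le> Re (omega b c)" by simp
    qed
  qed
  have "isolating H t0 d"
    unfolding isolating_def
  proof (intro conjI allI impI d(1))
    fix t assume t: "regular t" "t \<noteq> t0" "\<bar>t - t0\<bar> < d"
    show "eigenspace H t = {0}" "plane H \<inter> M t = {0}" using 1[OF t] by simp_all
    show "duistermaat (M (min t t0)) (plane H) (M (max t t0)) = int n - int (cdim (plane H \<inter> M t0))"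
      using 2[OF t(1)] 3[OF t(1)] t(2,3) by (cases "t < t0") simp_all
  qed
  then show ?thesis by (rule that)
qed

section \<open>Counting eigenvalues and gluing along an interval\<close>

definition eigenvalues :: "'h operator \<Rightarrow> real set \<Rightarrow> real set"
  where "eigenvalues H I = {t \<in> I. eigenspace H t \<noteq> {0}}"

lemma N_count_eq: "N_count H I = (\<Sum>t\<in>eigenvalues H I. cdim (eigenspace H t))"
  unfolding N_count_def eigenvalues_def ..

lemma N_count_empty: "eigenvalues H I = {} \<Longrightarrow> N_count H I = 0"
  unfolding N_count_eq by simp

lemma N_count_single:
  assumes "eigenvalues H I \<subseteq> {t}" "t \<in> I"
  shows "N_count H I = cdim (eigenspace H t)"
proof (cases "eigenspace H t = {0}")
  case True
  then have "t \<notin> eigenvalues H I" unfolding eigenvalues_def by simp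
  then have "eigenvalues H I = {}" using assms(1) by auto
  then show ?thesis using True N_count_empty by simp
next
  case False
  then have "t \<in> eigenvalues H I" using assms(2) unfolding eigenvalues_def by simp
  then have "eigenvalues H I = {t}" using assms(1) by auto
  then show ?thesis unfolding N_count_eq by simp
qed

lemma eigenvalues_Un: "eigenvalues H (I \<union> J) = eigenvalues H I \<union> eigenvalues H J"
  unfolding eigenvalues_def by auto

lemma N_count_Un:
  assumes "finite (eigenvalues H I)" "finite (eigenvalues H J)" "I \<inter> J = {}"
  shows "N_count H (I \<union> J) = N_count H I + N_count H J"
proof -
  have "eigenvalues H I \<inter> eigenvalues H J = {}"
    using assms(3) unfolding eigenvalues_def by auto
  then show ?thesis
    unfolding N_count_eq eigenvalues_Un using sum.union_disjoint[OF assms(1,2)] by simp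
qed

text \<open>Finiteness belongs to the property because additivity of \<open>N_count\<close> over
  adjacent intervals rests on finite index sets.\<close>

definition crossing :: "'h operator \<Rightarrow> 'h operator \<Rightarrow> real \<Rightarrow> real \<Rightarrow> bool"
  where "crossing H1 H2 a b \<longleftrightarrow>
    finite (eigenvalues H1 {a<..b}) \<and> finite (eigenvalues H2 {a<..b}) \<and>
    int (N_count H1 {a<..b}) - int (N_count H2 {a<..b})
      = duistermaat (plane H1) (plane H2) (M b) - duistermaat (plane H1) (plane H2) (M a)"

lemma crossing_trans:
  assumes "crossing H1 H2 a b" "crossing H1 H2 b c" "a \<le> b" "b \<le> c"
  shows "crossing H1 H2 a c"
proof -
  have I: "{a<..c} = {a<..b} \<union> {b<..c}" "{a<..b} \<inter> {b<..c} = {}" using assms(3,4) by auto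
  have "N_count H {a<..c} = N_count H {a<..b} + N_count H {b<..c}" if "H \<in> {H1, H2}" for H
    unfolding I(1) using assms(1,2) that I(2) unfolding crossing_def by (intro N_count_Un) auto
  then show ?thesis
    using assms(1,2) unfolding crossing_def by (simp add: I(1) eigenvalues_Un)
qed

lemma crossing_local:
  assumes H: "sae H1" "sae H2" and t0: "regular t0"
  obtains d where "0 < d"
    "\<And>a b. a \<le> t0 \<Longrightarrow> t0 \<le> b \<Longrightarrow> b - a < d \<Longrightarrow> \<forall>t\<in>{a..b}. regular t \<Longrightarrow> crossing H1 H2 a b"
proof -
  obtain d1 where iso1: "isolating H1 t0 d1" by (rule local_crossing[OF H(1) t0])
  obtain d2 where iso2: "isolating H2 t0 d2" by (rule local_crossing[OF H(2) t0])
  note d1 = isolatingD[OF iso1] and d2 = isolatingD[OF iso2]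
  let ?d = "min d1 d2"
  note lag = sae_lagrangian[OF H(1)] sae_lagrangian[OF H(2)] M_lagrangian[OF t0]
  have ev: "eigenvalues H1 I \<subseteq> {t0}" "eigenvalues H2 I \<subseteq> {t0}"
    if "\<And>t. t \<in> I \<Longrightarrow> regular t \<and> \<bar>t - t0\<bar> < ?d" for I
    using that d1(1) d2(1) unfolding eigenvalues_def by auto
  have right: "crossing H1 H2 t0 b" if b: "t0 < b" "b - t0 < ?d" "\<And>t. t0 \<le> t \<Longrightarrow> t \<le> b \<Longrightarrow> regular t" for b
  proof -
    have rb: "regular b" using b(1) by (intro b(3)) auto
    have "eigenvalues H1 {t0<..b} \<subseteq> {t0}" "eigenvalues H2 {t0<..b} \<subseteq> {t0}"
      using b by (intro ev; auto)+
    then have e: "eigenvalues H1 {t0<..b} = {}" "eigenvalues H2 {t0<..b} = {}"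
      unfolding eigenvalues_def by auto
    \<comment> \<open>For each extension the dimension subtracted in the index is the one added by
      the cocycle at \<open>M t0\<close>, so both contribute \<open>n\<close>.\<close>
    have "duistermaat (plane H1) (plane H2) (M b) - duistermaat (plane H1) (plane H2) (M t0) = 0"
      using duistermaat_cocycle[OF fin lag M_lagrangian[OF rb]] d1(3)[OF rb] d2(3)[OF rb] b(1,2) by simp
    then show ?thesis unfolding crossing_def using e by (simp add: N_count_empty)
  qed
  have left: "crossing H1 H2 a t0" if a: "a < t0" "t0 - a < ?d" "\<And>t. a \<le> t \<Longrightarrow> t \<le> t0 \<Longrightarrow> regular t" for a
  proof -
    have ra: "regular a" using a(1) by (intro a(3)) auto
    have e: "eigenvalues H1 {a<..t0} \<subseteq> {t0}" "eigenvalues H2 {a<..t0} \<subseteq> {t0}"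
      using a by (intro ev; auto)+
    have z: "plane H1 \<inter> M a = {0}" "plane H2 \<inter> M a = {0}"
      using d1(2)[OF ra] d2(2)[OF ra] a(1,2) by simp_all
    \<comment> \<open>Both planes miss \<open>M a\<close>, so the cocycle adds nothing and the
      dimensions at \<open>t0\<close> survive.\<close>
    have "duistermaat (plane H1) (plane H2) (M t0) - duistermaat (plane H1) (plane H2) (M a)
        = int (cdim (plane H1 \<inter> M t0)) - int (cdim (plane H2 \<inter> M t0))"
      using duistermaat_cocycle[OF fin lag(1,2) M_lagrangian[OF ra] lag(3)]
        d1(3)[OF ra] d2(3)[OF ra] a(1,2) z by simp
    also have "\<dots> = int (cdim (eigenspace H1 t0)) - int (cdim (eigenspace H2 t0))"
      unfolding cdim_eigenspace[OF H(1) t0] cdim_eigenspace[OF H(2) t0] by simp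
    also have "\<dots> = int (N_count H1 {a<..t0}) - int (N_count H2 {a<..t0})"
      using N_count_single[OF e(1)] N_count_single[OF e(2)] a(1) by simp
    finally show ?thesis unfolding crossing_def using finite_subset[OF e(1)] finite_subset[OF e(2)] by simp
  qed
  have triv: "crossing H1 H2 t0 t0" unfolding crossing_def by (simp add: eigenvalues_def N_count_def)
  show ?thesis
  proof (rule that[of ?d])
    show "0 < ?d" using iso1 iso2 unfolding isolating_def by simp
    fix a b assume ab: "a \<le> t0" "t0 \<le> b" "b - a < ?d" "\<forall>t\<in>{a..b}. regular t"
    have "crossing H1 H2 a t0"
    proof (cases "a = t0")
      case False
      then show ?thesis using ab by (intro left) auto
    qed (simp add: triv)
    moreover have "crossing H1 H2 t0 b"
    proof (cases "b = t0")
      case False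
      then show ?thesis using ab by (intro right) auto
    qed (simp add: triv)
    ultimately show "crossing H1 H2 a b" using crossing_trans ab(1,2) by blast
  qed
qed

lemma crossing_interval:
  assumes H: "sae H1" "sae H2" and ab: "a \<le> b" and reg: "\<And>t. a \<le> t \<Longrightarrow> t \<le> b \<Longrightarrow> regular t"
  shows "crossing H1 H2 a b"
proof -
  \<comment> \<open>Bisection also offers small intervals that stick out of \<open>{a..b}\<close>,
    where regularity is unknown; the premise makes \<open>P\<close> trivial for them.\<close>
  define P where "P x y \<longleftrightarrow> (a \<le> x \<and> y \<le> b \<longrightarrow> crossing H1 H2 x y)" for x y
  have "P a b"
    using ab
  proof (induct rule: Bolzano)
    case (trans x y z)
    then show ?case unfolding P_def using crossing_trans[of H1 H2 x y z] by auto
  next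
    case (local t0)
    obtain d where d: "0 < d"
      "\<And>x y. x \<le> t0 \<Longrightarrow> t0 \<le> y \<Longrightarrow> y - x < d \<Longrightarrow> \<forall>t\<in>{x..y}. regular t \<Longrightarrow> crossing H1 H2 x y"
      by (rule crossing_local[OF H reg[OF local]]) (rule that; assumption)
    show ?case
    proof (intro exI[of _ d] conjI allI impI d(1))
      fix x y assume xy: "x \<le> t0 \<and> t0 \<le> y \<and> y - x < d"
      show "P x y" unfolding P_def
      proof
        assume "a \<le> x \<and> y \<le> b"
        then show "crossing H1 H2 x y" using xy reg by (intro d(2)) auto
      qed
    qed
  qed
  then show ?thesis unfolding P_def by simp
qed

end

subsection \<open>The Friedrichs extension\<close>

text \<open>Shifting a form by \<open>s\<close> changes it by a multiple of the squared norm; along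
  a convergent sequence this is harmless, so the Cauchy condition can be passed between
  shifts.\<close>

lemma norm_cauchy:
  fixes u :: "nat \<Rightarrow> 'b::real_normed_vector"
  assumes "u \<longlonglongrightarrow> f" "0 < e"
  shows "\<exists>N. \<forall>j\<ge>N. \<forall>k\<ge>N. \<bar>s\<bar> * (norm (u j - u k))\<^sup>2 < e"
proof -
  define d where "d = sqrt (e / (\<bar>s\<bar> + 1))"
  have d: "0 < d" "d\<^sup>2 = e / (\<bar>s\<bar> + 1)" unfolding d_def using assms(2) by simp_all
  obtain N where N: "\<And>j k. j \<ge> N \<Longrightarrow> k \<ge> N \<Longrightarrow> dist (u j) (u k) < d"
    using metric_CauchyD[OF LIMSEQ_imp_Cauchy[OF assms(1)] d(1)] by blast
  have "\<bar>s\<bar> * (norm (u j - u k))\<^sup>2 < e" if "j \<ge> N" "k \<ge> N" for j k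
  proof -
    have "(norm (u j - u k))\<^sup>2 \<le> d\<^sup>2"
      using N[OF that] by (intro power_mono) (simp_all add: dist_norm)
    then have "\<bar>s\<bar> * (norm (u j - u k))\<^sup>2 \<le> \<bar>s\<bar> * d\<^sup>2" by (rule mult_left_mono) simp
    also have "\<dots> < e" unfolding d(2) using assms(2) by (simp add: field_simps)
    finally show ?thesis .
  qed
  then show ?thesis by blast
qed

locale semibounded_triplet = boundary_triplet_op S \<Gamma>0 \<Gamma>1 n
  for S :: "'h::complex_hilbert operator" and \<Gamma>0 \<Gamma>1 :: "'h \<Rightarrow> 'k::complex_hilbert" and n :: nat +
  fixes c :: real
  assumes lower: "\<And>f f'. (f, f') \<in> S \<Longrightarrow> c * (norm f)\<^sup>2 \<le> Re (cinner f f')"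
begin

abbreviation S' where "S' \<equiv> op_app S"

lemma S'_in: "f \<in> Domain S \<Longrightarrow> (f, S' f) \<in> S"
  using op_app_eq[OF S_sv] by blast

lemma S'_add: "f \<in> Domain S \<Longrightarrow> g \<in> Domain S \<Longrightarrow> S' (f + g) = S' f + S' g"
  by (intro op_app_eq[OF S_sv] graph_add[OF S_sub] S'_in)

lemma S'_scale: "f \<in> Domain S \<Longrightarrow> S' (a *\<^sub>C f) = a *\<^sub>C S' f"
  by (intro op_app_eq[OF S_sv] graph_scale[OF S_sub] S'_in)

lemma Domain_S: "csubspace (Domain S)"
  by (rule csubspace_Domain[OF S_sub])

text \<open>The shift is a parameter: \<open>s = c\<close> makes the form nonnegative, and
  \<open>s = c - 1\<close> makes it coercive with constant 1.\<close>

definition qf :: "real \<Rightarrow> 'h \<Rightarrow> 'h \<Rightarrow> complex"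
  where "qf s f g = cinner f (S' g - complex_of_real s *\<^sub>C g)"

lemma qf_eq: "qf s f g = cinner f (S' g) - complex_of_real s * cinner f g"
  unfolding qf_def by (simp add: cinner_diff_right cinner_scaleC_right)

lemma hermitian_on_qf: "hermitian_on (Domain S) (qf s)"
proof (rule hermitian_onI)
  fix x y assume xy: "x \<in> Domain S" "y \<in> Domain S"
  have "cinner x (S' y) = cnj (cinner y (S' x))"
    using S_symmetric[OF S'_in[OF xy(1)] S'_in[OF xy(2)]] cinner_commute[of "S' x" y] by simp
  then show "qf s x y = cnj (qf s y x)"
    unfolding qf_eq using cinner_commute[of x y] by simp
  show "qf s x (a *\<^sub>C y) = a * qf s x y" for a
    unfolding qf_eq S'_scale[OF xy(2)] by (simp add: cinner_scaleC_right algebra_simps)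
  fix z assume z: "z \<in> Domain S"
  show "qf s x (y + z) = qf s x y + qf s x z"
    unfolding qf_eq S'_add[OF xy(2) z] by (simp add: cinner_add_right algebra_simps)
qed

lemma Re_qf: "Re (qf s f f) = Re (cinner f (S' f)) - s * (norm f)\<^sup>2"
  unfolding qf_eq by (simp add: norm_sq_Re_cinner)

lemma qf_lower: "f \<in> Domain S \<Longrightarrow> (c - s) * (norm f)\<^sup>2 \<le> Re (qf s f f)"
  unfolding Re_qf using lower[OF S'_in] by (simp add: algebra_simps)

lemma qf_nonneg: "f \<in> Domain S \<Longrightarrow> 0 \<le> Re (qf c f f)"
  using qf_lower[of f c] by simp

lemma qf_real: "f \<in> Domain S \<Longrightarrow> cmod (qf s f f) = \<bar>Re (qf s f f)\<bar>"
  using hermitian_on_commute[OF hermitian_on_qf, of f f s] by (simp add: complex_eq_iff cmod_def)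

definition fconv :: "(nat \<Rightarrow> 'h) \<Rightarrow> 'h \<Rightarrow> bool"
  where "fconv u f \<longleftrightarrow> (\<forall>k. u k \<in> Domain S) \<and> u \<longlonglongrightarrow> f \<and>
    (\<forall>e>0. \<exists>N. \<forall>j\<ge>N. \<forall>k\<ge>N. cmod (cinner (u j - u k) (S' (u j - u k))) < e)"

lemma form_domain_iff: "f \<in> form_domain S \<longleftrightarrow> (\<exists>u. fconv u f)"
  unfolding form_domain_def fconv_def by simp

lemma fconvD:
  assumes "fconv u f"
  shows "u k \<in> Domain S" "u \<longlonglongrightarrow> f" "u j - u k \<in> Domain S"
  using assms csubspace_diff[OF Domain_S] unfolding fconv_def by simp_all

lemma fconv_qf_cauchy:
  assumes u: "fconv u f" and e: "0 < e"
  shows "\<exists>N. \<forall>j\<ge>N. \<forall>k\<ge>N. Re (qf s (u j - u k) (u j - u k)) < e"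
proof -
  obtain N1 where N1: "\<forall>j\<ge>N1. \<forall>k\<ge>N1. \<bar>s\<bar> * (norm (u j - u k))\<^sup>2 < e / 2"
    using norm_cauchy[OF fconvD(2)[OF u], of "e / 2" s] e by auto
  obtain N2 where N2: "\<forall>j\<ge>N2. \<forall>k\<ge>N2. cmod (cinner (u j - u k) (S' (u j - u k))) < e / 2"
    using u e unfolding fconv_def by (meson half_gt_zero)
  have "Re (qf s (u j - u k) (u j - u k)) < e" if "j \<ge> max N1 N2" "k \<ge> max N1 N2" for j k
  proof -
    have "\<bar>s\<bar> * (norm (u j - u k))\<^sup>2 < e / 2" "cmod (cinner (u j - u k) (S' (u j - u k))) < e / 2"
      using N1 N2 that by simp_all
    moreover have "- (s * (norm (u j - u k))\<^sup>2) \<le> \<bar>s\<bar> * (norm (u j - u k))\<^sup>2"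
      using mult_right_mono[of "- s" "\<bar>s\<bar>" "(norm (u j - u k))\<^sup>2"] by simp
    ultimately show ?thesis
      unfolding Re_qf using complex_Re_le_cmod[of "cinner (u j - u k) (S' (u j - u k))"] by linarith
  qed
  then show ?thesis by blast
qed

text \<open>Beyond some index, \<open>u k\<close> is \<open>u N\<close> plus a vector of small form
  value; nonnegativity on the difference of these two vectors controls their mixed term.\<close>

lemma fconv_qf_bounded:
  assumes u: "fconv u f"
  obtains K N where "0 < K" "\<forall>k\<ge>N. Re (qf c (u k) (u k)) \<le> K"
proof -
  obtain N where N: "\<forall>j\<ge>N. \<forall>k\<ge>N. Re (qf c (u j - u k) (u j - u k)) < 1"
    using fconv_qf_cauchy[OF u zero_less_one] by blast
  have "Re (qf c (u k) (u k)) \<le> 2 * Re (qf c (u N) (u N)) + 2" if k: "k \<ge> N" for k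
  proof -
    let ?x = "u k - u N" and ?y = "u N"
    note m = fconvD(3)[OF u, of k N] fconvD(1)[OF u, of N]
    have e1: "Re (qf c (u k) (u k)) = Re (qf c ?x ?x) + 2 * Re (qf c ?x ?y) + Re (qf c ?y ?y)"
      using hermitian_on_expand[OF hermitian_on_qf Domain_S m, of c 1] by simp
    have "0 \<le> Re (qf c (?x - ?y) (?x - ?y))"
      by (intro qf_nonneg csubspace_diff[OF Domain_S] m)
    then have "2 * Re (qf c ?x ?y) \<le> Re (qf c ?x ?x) + Re (qf c ?y ?y)"
      using hermitian_on_expand[OF hermitian_on_qf Domain_S m, of c "-1"] by (simp add: scaleC_minus1)
    moreover have "Re (qf c ?x ?x) < 1" using N k by simp
    ultimately show ?thesis using e1 by linarith
  qed
  moreover have "0 < 2 * Re (qf c (u N) (u N)) + 2"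
    using qf_nonneg[OF fconvD(1)[OF u]] by (simp add: add_nonneg_pos)
  ultimately show ?thesis using that by blast
qed

text \<open>The difference \<open>f - u k\<close> is small against \<open>v k\<close> by
  Cauchy-Schwarz for the form, since \<open>u\<close> is Cauchy and \<open>v\<close> bounded in it.
  As \<open>f\<close> need not lie in the domain of \<open>S\<close>, the estimate is made for
  \<open>u j - u k\<close> and then passes to the limit in \<open>j\<close>.\<close>

lemma fconv_form_limit:
  assumes u: "fconv u f" and v: "fconv v g" and f: "(f, f') \<in> A"
  shows "(\<lambda>k. cinner (u k) (S' (v k))) \<longlonglongrightarrow> cinner f' g"
proof -
  obtain K N0 where K: "0 < K" "\<forall>k\<ge>N0. Re (qf c (v k) (v k)) \<le> K"
    by (rule fconv_qf_bounded[OF v])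
  define z where "z k = qf c (u k) (v k) - (cinner f' (v k) - complex_of_real c * cinner f (v k))" for k
  have z0: "z \<longlonglongrightarrow> 0"
  proof (rule LIMSEQ_I)
    fix e :: real assume e: "0 < e"
    \<comment> \<open>Chosen so that \<open>e2 * K = (e / 2)^2\<close>.\<close>
    define e2 where "e2 = e\<^sup>2 / (4 * K)"
    have "0 < e2" unfolding e2_def using e K(1) by simp
    then obtain N where N: "\<forall>j\<ge>N. \<forall>k\<ge>N. Re (qf c (u j - u k) (u j - u k)) < e2"
      using fconv_qf_cauchy[OF u] by blast
    have "norm (z k - 0) < e" if k: "k \<ge> max N N0" for k
    proof -
      have lim: "(\<lambda>j. cmod (qf c (u j - u k) (v k)))
          \<longlonglongrightarrow> cmod (cinner (f - u k) (S' (v k) - complex_of_real c *\<^sub>C v k))"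
        unfolding qf_def by (intro tendsto_norm tendsto_cinner tendsto_intros fconvD(2)[OF u])
      have "cmod (qf c (u j - u k) (v k)) \<le> e / 2" if j: "j \<ge> N" for j
      proof -
        have "(cmod (qf c (u j - u k) (v k)))\<^sup>2
            \<le> Re (qf c (u j - u k) (u j - u k)) * Re (qf c (v k) (v k))"
          by (rule hermitian_on_cauchy_schwarz[OF hermitian_on_qf Domain_S qf_nonneg
                fconvD(3)[OF u] fconvD(1)[OF v]])
        also have "\<dots> \<le> e2 * K"
          using N j k K \<open>0 < e2\<close> qf_nonneg[OF fconvD(1)[OF v, of k]]
          by (intro mult_mono) (simp_all add: less_imp_le)
        also have "\<dots> = (e / 2)\<^sup>2" unfolding e2_def using K(1) by (simp add: power_divide)
        finally show ?thesis by (rule power2_le_imp_le) (use e in simp)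
      qed
      then have "cmod (cinner (f - u k) (S' (v k) - complex_of_real c *\<^sub>C v k)) \<le> e / 2"
        by (intro LIMSEQ_le_const2[OF lim]) blast
      moreover have "cinner f (S' (v k)) = cinner f' (v k)"
        by (rule A_S_adjoint[OF f S'_in[OF fconvD(1)[OF v]]])
      then have "z k = - cinner (f - u k) (S' (v k) - complex_of_real c *\<^sub>C v k)"
        unfolding z_def qf_def by (simp add: cinner_diff_left cinner_diff_right cinner_scaleC_right algebra_simps)
      ultimately show ?thesis using e by simp
    qed
    then show "\<exists>no. \<forall>k\<ge>no. norm (z k - 0) < e" by blast
  qed
  have "(\<lambda>k. z k + cinner f' (v k) - complex_of_real c * cinner f (v k) + complex_of_real c * cinner (u k) (v k))
      \<longlonglongrightarrow> 0 + cinner f' g - complex_of_real c * cinner f g + complex_of_real c * cinner f g"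
    by (intro tendsto_add tendsto_diff tendsto_mult tendsto_const tendsto_cinner z0 fconvD(2)[OF u] fconvD(2)[OF v])
  then show ?thesis unfolding z_def qf_eq by simp
qed

abbreviation HF where "HF \<equiv> friedrichs_extension S"

lemma HF_iff: "(f, f') \<in> HF \<longleftrightarrow> (f, f') \<in> A \<and> (\<exists>u. fconv u f)"
  unfolding friedrichs_extension_def form_domain_iff by simp

text \<open>Both sides are limits of the same form values \<open>cinner (u k) (S' (v k))\<close>,
  read once from each argument.\<close>

lemma HF_symmetric:
  assumes "(f, f') \<in> HF" "(g, g') \<in> HF"
  shows "cinner f g' = cinner f' g"
proof -
  obtain u v where f: "(f, f') \<in> A" "fconv u f" and g: "(g, g') \<in> A" "fconv v g"
    using assms unfolding HF_iff by blast
  have "cinner (u k) (S' (v k)) = cnj (cinner (v k) (S' (u k)))" for k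
    using S_symmetric[OF S'_in[OF fconvD(1)[OF f(2)]] S'_in[OF fconvD(1)[OF g(2)]]]
      cinner_commute[of "S' (u k)" "v k"] by simp
  then have "(\<lambda>k. cinner (u k) (S' (v k))) \<longlonglongrightarrow> cnj (cinner g' f)"
    using tendsto_cnj[OF fconv_form_limit[OF g(2) f(2) g(1)]] by simp
  then have "cnj (cinner g' f) = cinner f' g"
    by (rule LIMSEQ_unique[OF _ fconv_form_limit[OF f(2) g(2) f(1)]])
  then show ?thesis using cinner_commute[of f g'] by simp
qed

lemma HF_lower:
  assumes "(f, f') \<in> HF"
  shows "c * (norm f)\<^sup>2 \<le> Re (cinner f f')"
proof -
  obtain u where f: "(f, f') \<in> A" "fconv u f" using assms unfolding HF_iff by blast
  have "c * (norm f)\<^sup>2 \<le> Re (cinner f' f)"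
  proof (rule LIMSEQ_le)
    show "(\<lambda>k. c * (norm (u k))\<^sup>2) \<longlonglongrightarrow> c * (norm f)\<^sup>2"
      by (intro tendsto_intros fconvD(2)[OF f(2)])
    show "(\<lambda>k. Re (cinner (u k) (S' (u k)))) \<longlonglongrightarrow> Re (cinner f' f)"
      by (rule tendsto_Re[OF fconv_form_limit[OF f(2) f(2) f(1)]])
    show "\<exists>N. \<forall>k\<ge>N. c * (norm (u k))\<^sup>2 \<le> Re (cinner (u k) (S' (u k)))"
      using lower[OF S'_in[OF fconvD(1)[OF f(2)]]] by blast
  qed
  then show ?thesis using cinner_commute[of f f'] by simp
qed

lemma S_HF: "(f, f') \<in> S \<Longrightarrow> (f, f') \<in> HF"
proof -
  assume f: "(f, f') \<in> S"
  have "S' 0 = 0" by (rule op_app_eq[OF S_sv graph_zero[OF S_sub]])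
  then have "fconv (\<lambda>_. f) f" unfolding fconv_def using f by auto
  then show ?thesis unfolding HF_iff using S_le_A[OF f] by blast
qed

text \<open>The shift \<open>c - 1\<close> makes the form coercive, and the Euler equation of its
  minimizer is the weak form of the equation for the adjoint; the minimizing sequence itself shows
  that the limit is in the form domain.\<close>

lemma HF_solve:
  obtains f f' where "(f, f') \<in> HF" "f' - complex_of_real (c - 1) *\<^sub>C f = w"
proof -
  let ?s = "c - 1"
  have co: "(norm v)\<^sup>2 \<le> Re (qf ?s v v)" if "v \<in> Domain S" for v
    using qf_lower[OF that, of ?s] by simp
  obtain u f where u: "\<forall>k. u k \<in> Domain S" "u \<longlonglongrightarrow> f"
    "\<forall>e>0. \<exists>N. \<forall>j\<ge>N. \<forall>k\<ge>N. Re (qf ?s (u j - u k) (u j - u k)) < e"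
    "\<forall>v\<in>Domain S. (\<lambda>k. qf ?s (u k) v) \<longlonglongrightarrow> cinner w v"
    using coercive_form_minimization[OF Domain_S hermitian_on_qf co, of w] by metis
  have "fconv u f" unfolding fconv_def
  proof (intro conjI u(1,2) allI impI)
    fix e :: real assume e: "0 < e"
    obtain N1 where N1: "\<forall>j\<ge>N1. \<forall>k\<ge>N1. \<bar>?s\<bar> * (norm (u j - u k))\<^sup>2 < e / 2"
      using norm_cauchy[OF u(2), of "e / 2" ?s] e by auto
    obtain N2 where N2: "\<forall>j\<ge>N2. \<forall>k\<ge>N2. Re (qf ?s (u j - u k) (u j - u k)) < e / 2"
      using u(3) e by (meson half_gt_zero)
    have "cmod (cinner (u j - u k) (S' (u j - u k))) < e" if "j \<ge> max N1 N2" "k \<ge> max N1 N2" for j k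
    proof -
      let ?d = "u j - u k"
      have d: "?d \<in> Domain S" using u(1) csubspace_diff[OF Domain_S] by simp
      have "cinner ?d (S' ?d) = qf ?s ?d ?d + complex_of_real ?s * cinner ?d ?d"
        unfolding qf_eq by simp
      then have "cmod (cinner ?d (S' ?d)) \<le> cmod (qf ?s ?d ?d) + \<bar>?s\<bar> * (norm ?d)\<^sup>2"
        using norm_triangle_ineq[of "qf ?s ?d ?d" "complex_of_real ?s * cinner ?d ?d"]
        unfolding norm_mult norm_of_real cinner_self by simp
      moreover have "cmod (qf ?s ?d ?d) = Re (qf ?s ?d ?d)"
        unfolding qf_real[OF d] using order_trans[OF zero_le_power2 co[OF d]] by simp
      moreover have "\<bar>?s\<bar> * (norm ?d)\<^sup>2 < e / 2" "Re (qf ?s ?d ?d) < e / 2"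
        using N1 N2 that by simp_all
      ultimately show ?thesis by linarith
    qed
    then show "\<exists>N. \<forall>j\<ge>N. \<forall>k\<ge>N. cmod (cinner (u j - u k) (S' (u j - u k))) < e" by blast
  qed
  moreover have "(f, w + complex_of_real ?s *\<^sub>C f) \<in> A"
    unfolding A_iff
  proof (intro allI impI)
    fix v v' assume v: "(v, v') \<in> S"
    then have vD: "v \<in> Domain S" and v': "S' v = v'" using op_app_eq[OF S_sv v] by auto
    have "(\<lambda>k. qf ?s (u k) v) \<longlonglongrightarrow> qf ?s f v"
      unfolding qf_def by (intro tendsto_cinner tendsto_const u(2))
    then have "qf ?s f v = cinner w v" using u(4) vD LIMSEQ_unique by blast
    then show "cinner f v' = cinner (w + complex_of_real ?s *\<^sub>C f) v"
      unfolding qf_eq v' cinner_add_left cinner_scaleC_left by (simp add: diff_eq_eq)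
  qed
  ultimately have "(f, w + complex_of_real ?s *\<^sub>C f) \<in> HF" unfolding HF_iff by blast
  then show ?thesis by (rule that) simp
qed

text \<open>A symmetric operator that is surjective after a real shift is self-adjoint: solve for
  \<open>p\<close> with the right-hand side of \<open>x\<close>, then test \<open>x - p\<close>
  against the solution \<open>g\<close> whose right-hand side is \<open>x - p\<close>
  itself.\<close>

lemma HF_adjoint:
  assumes "\<And>g g'. (g, g') \<in> HF \<Longrightarrow> cinner x g' = cinner x' g"
  shows "(x, x') \<in> HF"
proof -
  let ?s = "complex_of_real (c - 1)"
  obtain p p' where p: "(p, p') \<in> HF" "p' - ?s *\<^sub>C p = x' - ?s *\<^sub>C x" by (rule HF_solve)
  obtain g g' where g: "(g, g') \<in> HF" "g' - ?s *\<^sub>C g = x - p" by (rule HF_solve)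
  have "cinner (x - p) (g' - ?s *\<^sub>C g) = cinner ((x' - ?s *\<^sub>C x) - (p' - ?s *\<^sub>C p)) g"
    using assms[OF g(1)] HF_symmetric[OF p(1) g(1)]
    unfolding cinner_diff_left cinner_diff_right cinner_scaleC_left cinner_scaleC_right
      complex_cnj_complex_of_real by (simp add: algebra_simps)
  also have "\<dots> = 0" unfolding p(2) by simp
  finally have "x = p" unfolding g(2) by simp
  moreover from this have "x' = p'" using p(2) by simp
  ultimately show ?thesis using p(1) by simp
qed

lemma HF_adjoint_iff: "(x, x') \<in> HF \<longleftrightarrow> (\<forall>g g'. (g, g') \<in> HF \<longrightarrow> cinner x g' = cinner x' g)"
  using HF_adjoint[of x x'] HF_symmetric[of x x'] by blast

text \<open>Linearity also comes from \<open>HF_adjoint\<close>: sums and multiples are symmetric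
  against the whole graph, so approximating sequences never have to be combined.\<close>

lemma sae_HF: "sae HF"
proof -
  have sv: "single_valued HF"
    using A_sv unfolding single_valued_def HF_iff by blast
  have "csubspace HF"
    unfolding complex_vector.subspace_def
  proof (intro conjI ballI allI)
    have "(0, 0) \<in> HF" by (rule HF_adjoint) simp
    then show "0 \<in> HF" by (simp add: zero_prod_def)
    fix x y :: "'h \<times> 'h" and a assume x: "x \<in> HF"
    have x': "(fst x, snd x) \<in> HF" using x by simp
    have "(a *\<^sub>C fst x, a *\<^sub>C snd x) \<in> HF"
      by (rule HF_adjoint) (simp add: cinner_scaleC_left HF_symmetric[OF x'])
    then show "a *\<^sub>C x \<in> HF" unfolding scaleC_prod_def .
    assume y: "y \<in> HF"
    have y': "(fst y, snd y) \<in> HF" using y by simp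
    have "(fst x + fst y, snd x + snd y) \<in> HF"
      by (rule HF_adjoint) (simp add: cinner_add_left HF_symmetric[OF x'] HF_symmetric[OF y'])
    then show "x + y \<in> HF" unfolding plus_prod_def .
  qed
  then have "linear_operator HF" unfolding linear_operator_def using sv by blast
  moreover have "adjoint_op HF = HF"
  proof (rule set_eqI)
    fix x :: "'h \<times> 'h"
    show "x \<in> adjoint_op HF \<longleftrightarrow> x \<in> HF"
      using adjoint_op_iff[OF sv, of "fst x" "snd x"] HF_adjoint_iff[of "fst x" "snd x"] by simp
  qed
  moreover have "densely_defined HF"
  proof -
    have "Domain S \<subseteq> Domain HF" using S_HF by blast
    then show ?thesis
      using closure_mono[of "Domain S" "Domain HF"] dense unfolding densely_defined_def by blast
  qed
  moreover have "S \<subseteq> HF" using S_HF by auto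
  ultimately show ?thesis unfolding self_adjoint_extension_def self_adjoint_def by blast
qed

text \<open>The quadratic form of a self-adjoint extension stays bounded below when the domain grows by one
  dimension: on the form complement of a negative vector \<open>v\<close> it is nonnegative, and the component
  along \<open>v\<close> is controlled by the bounded functional \<open>f \<mapsto> \<langle>(H - b) v, f\<rangle>\<close>.\<close>

lemma sae_lower_span:
  assumes H: "sae H" and E: "finite E"
  shows "\<exists>b. \<forall>f f'. (f, f') \<in> H \<longrightarrow> G f \<in> cspan E \<longrightarrow> b * (norm f)\<^sup>2 \<le> Re (cinner f f')"
  using E
proof (induction E rule: finite_induct)
  case empty
  \<comment> \<open>Zero boundary values put \<open>f\<close> into the domain of the Friedrichs
    extension, whose lower bound is \<open>c\<close>.\<close>
  have "c * (norm f)\<^sup>2 \<le> Re (cinner f f')" if "(f, f') \<in> H" "G f = 0" for f f'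
  proof (rule HF_lower)
    have "0 \<in> plane HF" by (rule csubspace_0[OF lagrangian_subspace[OF sae_lagrangian[OF sae_HF]]])
    then show "(f, f') \<in> HF" unfolding sae_iff[OF sae_HF] using sae_A[OF H that(1)] that(2) by simp
  qed
  then show ?case by auto
next
  case (insert e E)
  obtain b where b: "\<forall>f f'. (f, f') \<in> H \<longrightarrow> G f \<in> cspan E \<longrightarrow> b * (norm f)\<^sup>2 \<le> Re (cinner f f')"
    using insert.IH by blast
  define Q where "Q x y = cinner (fst x) (snd y - complex_of_real b *\<^sub>C fst y)" for x y :: "'h \<times> 'h"
  have Q_eq: "Q x y = cinner (fst x) (snd y) - complex_of_real b * cinner (fst x) (fst y)" for x y
    unfolding Q_def by (simp add: cinner_diff_right cinner_scaleC_right)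
  have Qre: "Re (Q x x) = Re (cinner (fst x) (snd x)) - b * (norm (fst x))\<^sup>2" for x
    unfolding Q_eq by (simp add: norm_sq_Re_cinner)
  note sH = sae_sub[OF H]
  have Q: "hermitian_on H Q"
  proof (rule hermitian_onI)
    fix x y assume "x \<in> H" "y \<in> H"
    then have "cinner (fst x) (snd y) = cinner (snd x) (fst y)"
      using sae_symmetric[OF H, of "fst x" "snd x" "fst y" "snd y"] by simp
    then show "Q x y = cnj (Q y x)"
      unfolding Q_eq using cinner_commute[of "snd x" "fst y"] cinner_commute[of "fst x" "fst y"] by simp
  qed (simp_all add: Q_eq cinner_add_right cinner_scaleC_right algebra_simps)
  let ?V = "\<lambda>x. x \<in> H \<and> G (fst x) \<in> cspan (insert e E)"
  show ?case
  proof (cases "\<forall>x. ?V x \<longrightarrow> 0 \<le> Re (Q x x)")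
    case True
    have "b * (norm f)\<^sup>2 \<le> Re (cinner f f')" if "(f, f') \<in> H" "G f \<in> cspan (insert e E)" for f f'
      using True[rule_format, of "(f, f')"] that unfolding Qre by simp
    then show ?thesis by blast
  next
    case False
    then obtain v where v: "v \<in> H" "G (fst v) \<in> cspan (insert e E)" "Re (Q v v) < 0"
      by (auto simp: not_le)
    define \<alpha> where "\<alpha> = Re (Q v v)"
    have \<alpha>: "\<alpha> < 0" "Q v v = complex_of_real \<alpha>"
      using v(3) hermitian_on_commute[OF Q v(1) v(1)] unfolding \<alpha>_def by (simp_all add: complex_eq_iff)
    have vA: "(fst v, snd v) \<in> A" using sae_A[OF H, of "fst v" "snd v"] v(1) by simp
    obtain k where k: "G (fst v) - k *\<^sub>C e \<in> cspan E"
      using v(2) unfolding cspan_breakdown_eq by blast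
    \<comment> \<open>A negative vector must have a boundary component along \<open>e\<close>, since
      the induction hypothesis excludes it otherwise.\<close>
    have k0: "k \<noteq> 0"
    proof
      assume "k = 0"
      then have "b * (norm (fst v))\<^sup>2 \<le> Re (cinner (fst v) (snd v))"
        using k b[rule_format, of "fst v" "snd v"] v(1) by simp
      then show False using v(3) unfolding Qre by simp
    qed
    have pos: "0 \<le> Re (Q p p)" if p: "?V p" "Q v p = 0" for p
    proof -
      obtain k' where k': "G (fst p) - k' *\<^sub>C e \<in> cspan E"
        using p(1) unfolding cspan_breakdown_eq by blast
      have pA: "(fst p, snd p) \<in> A" using sae_A[OF H, of "fst p" "snd p"] p(1) by simp
      \<comment> \<open>This multiple of \<open>v\<close> removes the \<open>e\<close> component
        from the boundary value, so the induction hypothesis applies to \<open>r\<close>.\<close>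
      define r where "r = p + (- (k' / k)) *\<^sub>C v"
      have rH: "r \<in> H" unfolding r_def
        using p(1) v(1) by (intro csubspace_add[OF sH] csubspace_scale[OF sH]) auto
      have "G (fst r) = G (fst p) + (- (k' / k)) *\<^sub>C G (fst v)"
        unfolding r_def fst_add fst_scaleC G_add[OF pA graph_scale[OF A_sub vA]] G_scale[OF vA] ..
      also have "\<dots> = (G (fst p) - k' *\<^sub>C e) + (- (k' / k)) *\<^sub>C (G (fst v) - k *\<^sub>C e)"
        using k0 by (simp add: scaleC_diff_right scaleC_scaleC)
      also have "\<dots> \<in> cspan E" by (intro cspan_add k' cspan_scale k)
      finally have "0 \<le> Re (Q r r)"
        using b[rule_format, of "fst r" "snd r"] rH unfolding Qre by simp
      moreover have "Q p v = 0" using p hermitian_on_commute[OF Q, of p v] v(1) by simp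
      then have "Re (Q r r) = Re (Q p p) + (cmod (- (k' / k)))\<^sup>2 * Re (Q v v)"
        unfolding r_def using hermitian_on_expand[OF Q sH, of p v "- (k' / k)"] p(1) v(1) by simp
      moreover have "(cmod (- (k' / k)))\<^sup>2 * Re (Q v v) \<le> 0"
        using v(3) by (intro mult_nonneg_nonpos) simp_all
      ultimately show ?thesis by linarith
    qed
    \<comment> \<open>\<open>K * (norm f)^2\<close> bounds
      \<open>(cmod (Q v x))^2 / (- \<alpha>)\<close>, the most that the component along
      \<open>v\<close> can subtract from the form.\<close>
    define K where "K = (norm (snd v - complex_of_real b *\<^sub>C fst v))\<^sup>2 / (- \<alpha>)"
    have "(b - K) * (norm f)\<^sup>2 \<le> Re (cinner f f')" if f: "(f, f') \<in> H" "G f \<in> cspan (insert e E)" for f f'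
    proof -
      let ?x = "(f, f')"
      define t where "t = Q v ?x / complex_of_real \<alpha>"
      define p where "p = ?x + (- t) *\<^sub>C v"
      have pH: "p \<in> H" unfolding p_def
        using f(1) v(1) by (intro csubspace_add[OF sH] csubspace_scale[OF sH]) auto
      have fA: "(f, f') \<in> A" by (rule sae_A[OF H f(1)])
      have Gp: "G (fst p) = G f + (- t) *\<^sub>C G (fst v)"
        unfolding p_def fst_add fst_scaleC fst_conv G_add[OF fA graph_scale[OF A_sub vA]] G_scale[OF vA] ..
      have "G (fst p) \<in> cspan (insert e E)"
        unfolding Gp by (intro cspan_add f(2) cspan_scale v(2))
      moreover have tv: "(- t) *\<^sub>C v \<in> H" by (rule csubspace_scale[OF sH v(1)])
      then have Qvp: "Q v p = 0"
        unfolding p_def hermitian_on_add[OF Q v(1) f(1) tv] hermitian_on_scale[OF Q v(1) v(1)]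
        using \<alpha> by (simp add: t_def)
      ultimately have "0 \<le> Re (Q p p)" using pos pH by blast
      moreover have "Q p v = 0" using Qvp hermitian_on_commute[OF Q pH v(1)] by simp
      moreover have "?x = p + t *\<^sub>C v" unfolding p_def by simp
      ultimately have "(cmod t)\<^sup>2 * \<alpha> \<le> Re (Q ?x ?x)"
        using hermitian_on_expand[OF Q sH pH v(1), of t] unfolding \<alpha>_def by simp
      moreover have "(cmod t)\<^sup>2 * \<alpha> = - ((cmod (Q v ?x))\<^sup>2 / (- \<alpha>))"
        unfolding t_def norm_divide power_divide using \<alpha>(1) by (simp add: power2_eq_square)
      moreover have "(cmod (Q v ?x))\<^sup>2 / (- \<alpha>) \<le> K * (norm f)\<^sup>2"
      proof -
        have "Q v ?x = cinner (snd v - complex_of_real b *\<^sub>C fst v) f"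
          unfolding Q_eq using sae_symmetric[OF H _ f(1), of "fst v" "snd v"] v(1)
          by (simp add: cinner_diff_left cinner_scaleC_left)
        then have "(cmod (Q v ?x))\<^sup>2 \<le> (norm (snd v - complex_of_real b *\<^sub>C fst v) * norm f)\<^sup>2"
          using cinner_cauchy_schwarz by (intro power_mono) simp_all
        then show ?thesis
          unfolding K_def using \<alpha>(1) by (simp add: power_mult_distrib divide_right_mono_neg)
      qed
      ultimately have "- (K * (norm f)\<^sup>2) \<le> Re (Q ?x ?x)" by linarith
      then show ?thesis unfolding Qre by (simp add: algebra_simps)
    qed
    then show ?thesis by blast
  qed
qed

section \<open>Comparison with the Friedrichs plane at the bottom of the spectrum\<close>

lemma sae_lower:
  assumes "sae H"
  obtains b where "\<And>f f'. (f, f') \<in> H \<Longrightarrow> b * (norm f)\<^sup>2 \<le> Re (cinner f f')"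
proof -
  obtain E where E: "finite E" "(UNIV :: ('k \<times> 'k) set) \<subseteq> cspan E"
    using fin2[of UNIV] unfolding cfinite_dim_def by blast
  have "G f \<in> cspan E" for f using E(2) by auto
  then show ?thesis using sae_lower_span[OF assms E(1)] that by metis
qed

text \<open>The bound \<open>s + 1\<close> leaves a gap above \<open>s\<close>, so the endpoint
  \<open>s\<close> is covered too.\<close>

lemma eigenvalues_below:
  assumes H: "sae H" and low: "\<And>f f'. (f, f') \<in> H \<Longrightarrow> (s + 1) * (norm f)\<^sup>2 \<le> Re (cinner f f')"
  shows "eigenvalues H {..s} = {}"
proof -
  have "eigenspace H t = {0}" if t: "t \<le> s" for t
  proof -
    have "f = 0" if f: "f \<in> eigenspace H t" for f
    proof -
      have "(s + 1) * (norm f)\<^sup>2 \<le> t * (norm f)\<^sup>2"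
        using low[of f "complex_of_real t *\<^sub>C f"] f unfolding op_ker_shift_iff
        by (simp add: cinner_scaleC_right norm_sq_Re_cinner)
      also have "\<dots> \<le> s * (norm f)\<^sup>2" using t by (intro mult_right_mono) simp_all
      finally show ?thesis by (simp add: algebra_simps)
    qed
    then show ?thesis using csubspace_0[OF eigenspace_sub[OF H]] by blast
  qed
  then show ?thesis unfolding eigenvalues_def by auto
qed

text \<open>If \<open>u k\<close> from the domain of \<open>S\<close> approximates \<open>f\<close>
  in the form sense, then \<open>f + g - u k\<close> stays in the domain of \<open>H\<close> and
  tends to \<open>g\<close>. The form values converge, and their limit has real part
  \<open>s * (norm g)^2 - Re (omega (G f) (G g))\<close>; the excess of \<open>s + 1\<close> over
  \<open>s\<close> in the lower bound yields the strict sign.\<close>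

lemma friedrichs_estimate:
  assumes H: "sae H" and low: "\<And>f f'. (f, f') \<in> H \<Longrightarrow> (s + 1) * (norm f)\<^sup>2 \<le> Re (cinner f f')"
    and f: "(f, f') \<in> HF" and g: "g \<in> defect s" and fg: "G f + G g \<in> plane H"
  shows "Re (omega (G f) (G g)) \<le> - (norm g)\<^sup>2"
proof -
  obtain u where fA: "(f, f') \<in> A" and u: "fconv u f" using f unfolding HF_iff by blast
  note gA = defectD[OF g]
  define h' where "h' = f' + complex_of_real s *\<^sub>C g"
  have hH: "(f + g, h') \<in> H"
    unfolding h'_def sae_iff[OF H] using graph_add[OF A_sub fA gA] G_add[OF fA gA] fg by simp
  have "(s + 1) * (norm (f + g - f))\<^sup>2 \<le> Re (cinner (f + g) h' - cinner h' f - cinner f h' + cinner f' f)"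
  proof (rule LIMSEQ_le)
    show "(\<lambda>k. (s + 1) * (norm (f + g - u k))\<^sup>2) \<longlonglongrightarrow> (s + 1) * (norm (f + g - f))\<^sup>2"
      by (intro tendsto_intros fconvD(2)[OF u])
    show "(\<lambda>k. Re (cinner (f + g) h' - cinner h' (u k) - cinner (u k) h' + cinner (u k) (S' (u k))))
        \<longlonglongrightarrow> Re (cinner (f + g) h' - cinner h' f - cinner f h' + cinner f' f)"
      by (intro tendsto_Re tendsto_add tendsto_diff tendsto_const tendsto_cinner
          fconvD(2)[OF u] fconv_form_limit[OF u u fA])
    have "(s + 1) * (norm (f + g - u k))\<^sup>2
        \<le> Re (cinner (f + g) h' - cinner h' (u k) - cinner (u k) h' + cinner (u k) (S' (u k)))" for k
    proof -
      note uS = S'_in[OF fconvD(1)[OF u, of k]]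
      have "(f + g - u k, h' - S' (u k)) \<in> H" by (rule graph_diff[OF sae_sub[OF H] hH sae_S[OF H uS]])
      then have "(s + 1) * (norm (f + g - u k))\<^sup>2 \<le> Re (cinner (f + g - u k) (h' - S' (u k)))" by (rule low)
      also have "cinner (f + g - u k) (h' - S' (u k))
          = cinner (f + g) h' - cinner (f + g) (S' (u k)) - cinner (u k) h' + cinner (u k) (S' (u k))"
        unfolding cinner_diff_left cinner_diff_right by simp
      also have "cinner (f + g) (S' (u k)) = cinner h' (u k)"
        by (rule A_S_adjoint[OF sae_A[OF H hH] uS])
      finally show ?thesis .
    qed
    then show "\<exists>N. \<forall>k\<ge>N. (s + 1) * (norm (f + g - u k))\<^sup>2
        \<le> Re (cinner (f + g) h' - cinner h' (u k) - cinner (u k) h' + cinner (u k) (S' (u k)))" by blast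
  qed
  also have "cinner (f + g) h' - cinner h' f - cinner f h' + cinner f' f
      = cinner g f' - complex_of_real s * cinner g f + complex_of_real s * cinner g g"
    unfolding h'_def
    by (simp add: cinner_add_left cinner_add_right cinner_scaleC_left cinner_scaleC_right algebra_simps)
  finally have "(norm g)\<^sup>2 \<le> Re (cinner g f' - complex_of_real s * cinner g f)"
    by (simp add: norm_sq_Re_cinner algebra_simps)
  moreover have "omega (G f) (G g) = - cnj (cinner g f' - complex_of_real s * cinner g f)"
    using green[OF fA gA] cinner_commute[of f' g] cinner_commute[of f g]
    by (simp add: cinner_scaleC_right)
  ultimately show ?thesis by simp
qed

lemma duistermaat_friedrichs:
  assumes H: "sae H" and low: "\<And>f f'. (f, f') \<in> H \<Longrightarrow> (s + 1) * (norm f)\<^sup>2 \<le> Re (cinner f f')"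
    and s: "s < c" and reg: "regular s"
  shows "duistermaat (plane HF) (plane H) (M s) = int n - int (cdim (plane H \<inter> plane HF))"
proof -
  note L = sae_lagrangian[OF H] and F = sae_lagrangian[OF sae_HF] and Ms = M_lagrangian[OF reg]
  note sL = lagrangian_subspace[OF L] and sF = lagrangian_subspace[OF F] and sM = lagrangian_subspace[OF Ms]
  have G0: "G 0 = 0" using clinear_on_0[OF G_defect defect_sub] .
  \<comment> \<open>A common vector would come from an eigenvector of the Friedrichs extension at
    \<open>s\<close>, below its lower bound \<open>c\<close>.\<close>
  have FM: "plane HF \<inter> M s = {0}"
  proof -
    have "x = 0" if x: "x \<in> plane HF" "x \<in> M s" for x
    proof -
      obtain f where f: "f \<in> defect s" "x = G f" using x(2) unfolding M_def by blast
      have "(f, complex_of_real s *\<^sub>C f) \<in> HF"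
        unfolding sae_iff[OF sae_HF] using defectD[OF f(1)] x(1) f(2) by simp
      then have "c * (norm f)\<^sup>2 \<le> s * (norm f)\<^sup>2"
        using HF_lower by (fastforce simp: cinner_scaleC_right norm_sq_Re_cinner)
      then have "f = 0" using s by (cases "f = 0") simp_all
      then show ?thesis using f(2) G0 by simp
    qed
    then show ?thesis using csubspace_0[OF sF] csubspace_0[OF sM] by blast
  qed
  show ?thesis
    unfolding dim_n[symmetric]
  proof (rule duistermaat_transversal[OF fin L F Ms FM])
    show "csubspace (plane H \<inter> plane HF)" by (rule csubspace_inter[OF sL sF])
    show "plane H \<inter> plane HF \<subseteq> plane H" by simp
  next
    fix x y assume xy: "x \<in> plane HF" "y \<in> M s" "x + y \<in> plane H" "x + y \<notin> plane H \<inter> plane HF"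
    obtain f f' where f: "(f, f') \<in> HF" "x = G f" using xy(1) unfolding plane_def by blast
    obtain g where g: "g \<in> defect s" "y = G g" using xy(2) unfolding M_def by blast
    have "g \<noteq> 0" using xy G0 g(2) by auto
    then have "0 < (norm g)\<^sup>2" by simp
    moreover have "Re (omega x y) \<le> - (norm g)\<^sup>2"
      unfolding f(2) g(2)
      by (rule friedrichs_estimate[OF H low f(1) g(1)]) (use xy(3) in \<open>simp_all only: f(2) g(2)\<close>)
    ultimately show "Re (omega x y) < 0" by linarith
  next
    fix x y assume xy: "x \<in> plane HF" "y \<in> M s" "x + y \<in> plane H \<inter> plane HF"
    then have "y \<in> plane HF" using csubspace_diff[OF sF, of "x + y" x] by simp
    then have "y = 0" using xy(2) FM by blast
    then show "0 \<le> Re (omega x y)" by simp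
  qed
qed

lemma spectral_shift_below:
  assumes H: "sae H1" "sae H2" and reg: "\<And>s. s \<le> t \<Longrightarrow> regular s"
  shows "spectral_shift H1 H2 t
    = duistermaat (plane H1) (plane H2) (M t) - duistermaat (plane H1) (plane H2) (plane HF)"
proof -
  obtain b1 where b1: "\<And>f f'. (f, f') \<in> H1 \<Longrightarrow> b1 * (norm f)\<^sup>2 \<le> Re (cinner f f')"
    by (rule sae_lower[OF H(1)]) (rule that; assumption)
  obtain b2 where b2: "\<And>f f'. (f, f') \<in> H2 \<Longrightarrow> b2 * (norm f)\<^sup>2 \<le> Re (cinner f f')"
    by (rule sae_lower[OF H(2)]) (rule that; assumption)
  \<comment> \<open>Subtracting 1 gives \<open>s < c\<close> strictly and leaves room for the bound
    \<open>s + 1\<close> of both extensions.\<close>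
  define s where "s = min t (min c (min b1 b2)) - 1"
  have s: "s \<le> t" "s < c" "s + 1 \<le> b1" "s + 1 \<le> b2" unfolding s_def by auto
  have low1: "(s + 1) * (norm f)\<^sup>2 \<le> Re (cinner f f')" if "(f, f') \<in> H1" for f f'
    using order_trans[OF mult_right_mono[OF s(3) zero_le_power2] b1[OF that]] .
  have low2: "(s + 1) * (norm f)\<^sup>2 \<le> Re (cinner f f')" if "(f, f') \<in> H2" for f f'
    using order_trans[OF mult_right_mono[OF s(4) zero_le_power2] b2[OF that]] .
  note e1 = eigenvalues_below[OF H(1) low1] and e2 = eigenvalues_below[OF H(2) low2]
  have cr: "crossing H1 H2 s t" by (rule crossing_interval[OF H s(1) reg])
  have I: "{..t} = {..s} \<union> {s<..t}" "{..s} \<inter> {s<..t} = {}" using s(1) by auto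
  have "N_count H1 {..t} = N_count H1 {s<..t}" "N_count H2 {..t} = N_count H2 {s<..t}"
    unfolding I(1) using cr e1 e2 I(2) unfolding crossing_def
    by (simp_all add: N_count_Un N_count_empty)
  \<comment> \<open>For each extension the dimension of the intersection with
    \<open>plane HF\<close> leaves the index and returns through the cocycle, so both contribute
    \<open>n\<close>.\<close>
  moreover have "duistermaat (plane H1) (plane H2) (M s) = duistermaat (plane H1) (plane H2) (plane HF)"
    using duistermaat_cocycle[OF fin sae_lagrangian[OF H(1)] sae_lagrangian[OF H(2)]
        sae_lagrangian[OF sae_HF] M_lagrangian[OF reg[OF s(1)]]]
      duistermaat_friedrichs[OF H(1) low1 s(2) reg[OF s(1)]]
      duistermaat_friedrichs[OF H(2) low2 s(2) reg[OF s(1)]] by simp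
  ultimately show ?thesis using cr unfolding crossing_def spectral_shift_def by simp
qed

end

theorem theorem1p2:
  fixes S H1 H2 HF :: "'h::complex_hilbert operator"
    and \<Gamma>0 \<Gamma>1 :: "'h \<Rightarrow> 'k::complex_hilbert"
    and L1 L2 F :: "('k \<times> 'k) set"
    and M :: "complex \<Rightarrow> ('k \<times> 'k) set"
    and n :: nat
  assumes "separable_space (euclidean :: 'h topology)"
    and "linear_operator S" and "closed S" and "densely_defined S"
    and "symmetric_op S" and "bounded_below S"
    and "defect_numbers S n n"
    and "boundary_triplet n S \<Gamma>0 \<Gamma>1"
    and "self_adjoint_extension S H1" and "self_adjoint_extension S H2"
    and "HF = friedrichs_extension S"
    and "L1 = boundary_plane \<Gamma>0 \<Gamma>1 H1" and "L2 = boundary_plane \<Gamma>0 \<Gamma>1 H2"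
    and "F = boundary_plane \<Gamma>0 \<Gamma>1 HF"
    and "\<And>z. M z = cauchy_data S \<Gamma>0 \<Gamma>1 z"
  shows "(\<forall>a b :: real. a \<le> b \<and> complex_of_real ` {a..b} \<inter> Spec_ess S = {} \<longrightarrow>
            int (N_count H1 {a<..b}) - int (N_count H2 {a<..b})
              = duistermaat L1 L2 (M (complex_of_real b))
                - duistermaat L1 L2 (M (complex_of_real a))) \<and>
         (\<forall>t :: real. (\<forall>\<mu> :: real. complex_of_real \<mu> \<in> Spec_ess S \<longrightarrow> t < \<mu>) \<longrightarrow>
            spectral_shift H1 H2 t
              = duistermaat L1 L2 (M (complex_of_real t)) - duistermaat L1 L2 F)"
proof -
  obtain c where c: "\<And>f. f \<in> Domain S \<Longrightarrow> c * (norm f)\<^sup>2 \<le> Re (cinner f (op_app S f))"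
    using assms(6) unfolding bounded_below_def by auto
  interpret boundary_triplet_op S \<Gamma>0 \<Gamma>1 n
    using assms(2,4,5,8) by unfold_locales
  interpret semibounded_triplet S \<Gamma>0 \<Gamma>1 n c
  proof
    fix f f' assume f: "(f, f') \<in> S"
    then show "c * (norm f)\<^sup>2 \<le> Re (cinner f f')"
      using c[of f] op_app_eq[OF S_sv f] by (simp add: Domain.DomainI)
  qed
  have L: "L1 = plane H1" "L2 = plane H2" "F = plane (friedrichs_extension S)"
    using assms(11-14) by (simp_all add: plane_eq)
  \<comment> \<open>The \<open>M\<close> of the statement shadows the locale constant, hence the
    qualified name.\<close>
  have MM: "M (complex_of_real t) = boundary_triplet_op.M S \<Gamma>0 \<Gamma>1 t" for t
    unfolding assms(15) by (rule cauchy_data_eq)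
  show ?thesis
  proof (intro conjI allI impI)
    fix a b :: real assume ab: "a \<le> b \<and> complex_of_real ` {a..b} \<inter> Spec_ess S = {}"
    have "regular t" if "a \<le> t" "t \<le> b" for t
    proof -
      have "complex_of_real t \<in> complex_of_real ` {a..b}" using that by simp
      then show ?thesis using ab unfolding regular_def by blast
    qed
    then show "int (N_count H1 {a<..b}) - int (N_count H2 {a<..b})
        = duistermaat L1 L2 (M (complex_of_real b)) - duistermaat L1 L2 (M (complex_of_real a))"
      using crossing_interval[OF assms(9,10), of a b] ab unfolding L MM crossing_def by blast
  next
    fix t :: real assume t: "\<forall>\<mu> :: real. complex_of_real \<mu> \<in> Spec_ess S \<longrightarrow> t < \<mu>"
    have "regular s" if "s \<le> t" for s
      using t that unfolding regular_def by (meson not_le)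
    then show "spectral_shift H1 H2 t = duistermaat L1 L2 (M (complex_of_real t)) - duistermaat L1 L2 F"
      unfolding L MM by (rule spectral_shift_below[OF assms(9,10)])
  qed
qed

end
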